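(* Let $\sigma$ be an irreducible incommensurable normalized multiscale substitution scheme in $\mathbb{R}^d$ with prototiles $T_1,\dots,T_n$ and constants of substitution $\alpha_{hj}^{(k)}$. For $j\in\{1,\dots,n\}$ and $0\le a<b\le 1$ put $$\varphi_{j,[a,b]}:=\sum_{h=1}^n\Big(\frac1d\sum_{k=1}^{k_{hj}}\left(\alpha_{hj}^{(k)}\right)^d\Big(\max\{a,\alpha_{hj}^{(k)}\}^{-d}-\max\{b,\alpha_{hj}^{(k)}\}^{-d}\Big)\Big)q_h ,$$ with $q_h$ as defined in the context. Then for every tile $T$ of legal type and scale, the number of tiles of type $j$ in $F_t(T)$ with scale in $[a,b]$ grows as $$\varphi_{j,[a,b]}\,\mathrm{vol}(e^tT)+o\big(\mathrm{vol}(e^tT)\big),\qquad t\to\infty.$$ In particular, for every $\mathcal{T}\in\mathbb{X}_\sigma^F$ and every sequence $(T^{(m)})_{m\ge0}$ of supertiles of growing order in $\mathcal{T}$, the number of tiles of type $j$ with scale in $[a,b]$ in the patch $[T^{(m)}]^{\mathcal{T}}$ grows as $$\varphi_{j,[a,b]}\,\mathrm{vol}(T^{(m)})+o\big(\mathrm{vol}(T^{(m)})\big),\qquad m\to\infty.$$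
   Context: Schemes. A tile in $\mathbb{R}^d$ is a bounded Lebesgue measurable set $T$ of positive measure $\mathrm{vol}\,T$ whose boundary has measure zero. A tessellation of $U\subset\mathbb{R}^d$ is a collection of tiles with pairwise disjoint interiors and union $U$; it is called a patch if $U$ is bounded ($U$ is then the support of the patch) and a tiling if $U=\mathbb{R}^d$. For a tiling $\mathcal{T}$ and bounded $B$, $[B]^{\mathcal{T}}$ is the patch of all tiles of $\mathcal{T}$ that intersect $B$. A multiscale substitution scheme $\sigma=(\tau_\sigma,\varrho_\sigma)$ consists of a finite list of prototiles $\tau_\sigma=(T_1,\dots,T_n)$ and, for each $i$, a tessellation $\varrho_\sigma(T_i)$ of $T_i$ all of whose tiles are translates of rescaled prototiles; the list of these rescaled prototiles is $\omega_\sigma(T_i)=(\alpha_{ij}^{(k)}T_j:\ j=1,\dots,n,\ k=1,\dots,k_{ij})$. The numbers $\alpha_{ij}^{(k)}\in(0,1)$ are the constants of substitution. A translate of $\alpha T_j$, $\alpha>0$, is a tile of type $j$ and scale $\alpha$. Standing assumptions: $\sigma$ is normalized, i.e. $\mathrm{vol}\,T_i=1$ for all $i$; distinct prototiles are geometrically different ($T_i$ is not a rescaled copy of $T_j$ for $i\ne j$), so the type of a tile is determined by the tile. With $\beta_j^{\min}:=\min\{\alpha:\exists i,\ \varrho_\sigma(T_i)\text{ contains a copy of }\alpha T_j\}$, a tile of legal type and scale is a translate of $\alpha T_j$ with $\alpha\in(\beta_j^{\min},1]$. Substitution semi-flow. For $t\ge 0$, $F_t(T_i)$ is the patch supported on $e^tT_i$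 obtained by starting with $e^tT_i$ and repeatedly substituting (according to the rescaled rule $\varrho_\sigma$) every tile of volume $>1$, until all tiles have volume $\le 1$. In the same way $F_t$ is defined on every tile $T$ that is a translate of $\alpha T_i$ with $0<\alpha\le 1$ ($F_t(T)$ is supported on $e^tT$), on patches of such tiles, and on tilings by such tiles (tile by tile). $\sigma$ is irreducible if for all $i,j$ there is $t>0$ such that $F_t(T_i)$ contains a tile of type $j$. $\sigma$ is incommensurable if there are $i,j$ and $t_1,t_2>0$ with $t_1\notin\mathbb{Q}t_2$ such that $F_{t_1}(T_i)$ contains a tile of type $i$ and unit volume and $F_{t_2}(T_j)$ contains a tile of type $j$ and unit volume. Matrices. $M_\sigma(s)$ is the $n\times n$ matrix with entries $(M_\sigma(s))_{ij}=\sum_{k=1}^{k_{ij}}(\alpha_{ij}^{(k)})^s$, $M_\sigma'$ its entrywise derivative, and $Q_\sigma=\mathrm{adj}(I-M_\sigma(d))/\big(-\mathrm{tr}(\mathrm{adj}(I-M_\sigma(d))\cdot M_\sigma'(d))\big)$ ($\mathrm{adj}$ = adjugate). $Q_\sigma$ is a positive rank $1$ matrix and column $h$ of $Q_\sigma$ is $q_h\cdot(1,\dots,1)^T$; this defines $q_h$. Tiling space. Position each $T_i$ so that the origin is an interior point. Let $\mathscr{P}_\sigma=\{F_t(T_i): t\ge0,\ i=1,\dots,n\}$. Identify a patch or tiling with the closed set which is the union of the boundaries of its tiles. On closed subsets of $\mathbb{R}^d$ use the metric $D(A_1,A_2)=\inf(\{r>0: A_1\cap B(0,1/r)\subset A_2^{+r},\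 A_2\cap B(0,1/r)\subset A_1^{+r}\}\cup\{1\})$, where $A^{+r}$ is the $r$-neighborhood of $A$ and $B(x,R)$ is the open Euclidean ball. $\mathbb{X}^F_\sigma$ is the set of all tilings $\mathcal{T}$ of $\mathbb{R}^d$ such that every sub-patch of $\mathcal{T}$ is a limit, with respect to $D$, of translated sub-patches of elements of $\mathscr{P}_\sigma$. Supertiles. Fix a stationary tiling $\mathcal{S}\in\mathbb{X}_\sigma^F$, i.e. a nested union $\mathcal{S}=\bigcup_{k\ge0}F_{a+ks}(T_i)$ with $a\ge 0$, $s>0$ such that $F_s(T_i)$ contains a tile of type $i$ and unit volume, and the origin an interior point of $T_i$; then $F_s(\mathcal{S})=\mathcal{S}$. For $m\in\mathbb{N}$ let $\mathcal{S}^{-m}$ be the tiling with tiles $e^{ms}T$, $T$ a tile of $\mathcal{S}$; these are the $m$-supertiles (supertiles of order $m$) of $\mathcal{S}$. For general $\mathcal{T}\in\mathbb{X}_\sigma^F$ (the orbit of $\mathcal{S}$ under translations is dense) write $\mathcal{T}=\lim_n(\mathcal{S}+v_n)$, $v_n\in\mathbb{R}^d$, with $\partial\mathcal{S}^{-m}+v_n$ converging for every $m$; the limit is a subset of $\partial\mathcal{T}$ that defines a tiling whose tiles are the $m$-supertiles of $\mathcal{T}$. A sequence of supertiles of growing order is a sequence $(T^{(m)})_{m\ge0}$ with $T^{(m)}$ an $m$-supertile of $\mathcal{T}$.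
   Formalization: In the supertile claim, tilings consist of translates of αT_j with α≤1, and limits of tilings mean boundaries converge and each limit tile is a limit of tiles of its type; with boundaries alone the claim fails, e.g. for prototiles [0,1] and [0,1). *)

theory Defs
  imports
    "HOL-Analysis.Analysis"
    "HOL-Library.Landau_Symbols"
    "Jordan_Normal_Form.Determinant"
begin

definition tile :: "'a::euclidean_space set \<Rightarrow> bool" where
  "tile T \<longleftrightarrow> bounded T \<and> T \<in> sets lebesgue \<and> measure lebesgue T > 0
     \<and> frontier T \<in> null_sets lebesgue"

text \<open>Tiles have non-empty interior, so a collection of tiles with pairwise disjoint interiors
  has no repetitions and can be taken to be a set.\<close>

definition tessellation :: "'a::euclidean_space set \<Rightarrow> 'a set set \<Rightarrow> bool" where
  "tessellation U P \<longleftrightarrow> (\<forall>T\<in>P. tile T)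
     \<and> pairwise (\<lambda>X Y. disjnt (interior X) (interior Y)) P \<and> \<Union>P = U"

definition patch :: "'a::euclidean_space set set \<Rightarrow> bool" where
  "patch P \<longleftrightarrow> (\<exists>U. bounded U \<and> tessellation U P)"

definition tiling :: "'a::euclidean_space set set \<Rightarrow> bool" where
  "tiling P \<longleftrightarrow> tessellation UNIV P"

definition touching :: "'a::euclidean_space set \<Rightarrow> 'a set set \<Rightarrow> 'a set set" where
  "touching B P = {X \<in> P. X \<inter> B \<noteq> {}}"

definition copy :: "real \<Rightarrow> 'a::euclidean_space \<Rightarrow> 'a set \<Rightarrow> 'a set" where
  "copy \<alpha> v X = (\<lambda>x. v + \<alpha> *\<^sub>R x) ` X"

definition copies :: "real \<Rightarrow> 'a::euclidean_space \<Rightarrow> 'a set set \<Rightarrow> 'a set set" where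
  "copies \<alpha> v P = copy \<alpha> v ` P"

text \<open>Prototiles are indexed from 0. An entry \<open>(j, \<alpha>, v)\<close> of \<open>rule \<sigma> i\<close> stands for the tile
  \<open>v + \<alpha> T\<^sub>j\<close> of the tessellation of \<open>T\<^sub>i\<close>.\<close>

record 'a scheme =
  prototiles :: "'a set list"
  rule :: "nat \<Rightarrow> (nat \<times> real \<times> 'a) list"

definition ntypes :: "('a::euclidean_space) scheme \<Rightarrow> nat" where
  "ntypes \<sigma> = length (prototiles \<sigma>)"

definition proto :: "('a::euclidean_space) scheme \<Rightarrow> nat \<Rightarrow> 'a set" where
  "proto \<sigma> j = prototiles \<sigma> ! j"

definition rho :: "('a::euclidean_space) scheme \<Rightarrow> nat \<Rightarrow> 'a set set" where
  "rho \<sigma> i = (\<lambda>(j, \<alpha>, v). copy \<alpha> v (proto \<sigma> j)) ` set (rule \<sigma> i)"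

text \<open>The list of the constants of substitution \<open>\<alpha>\<^sub>i\<^sub>j\<^sup>(\<^sup>k\<^sup>)\<close>, \<open>k = 1, \<dots>, k\<^sub>i\<^sub>j\<close>.\<close>

definition consts_of_subst :: "('a::euclidean_space) scheme \<Rightarrow> nat \<Rightarrow> nat \<Rightarrow> real list" where
  "consts_of_subst \<sigma> i j = map (\<lambda>(l, \<alpha>, v). \<alpha>) (filter (\<lambda>(l, \<alpha>, v). l = j) (rule \<sigma> i))"

definition tile_of :: "('a::euclidean_space) scheme \<Rightarrow> nat \<Rightarrow> real \<Rightarrow> 'a set \<Rightarrow> bool" where
  "tile_of \<sigma> j \<alpha> X \<longleftrightarrow> j < ntypes \<sigma> \<and> \<alpha> > 0 \<and> (\<exists>v. X = copy \<alpha> v (proto \<sigma> j))"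

definition has_type :: "('a::euclidean_space) scheme \<Rightarrow> nat \<Rightarrow> 'a set \<Rightarrow> bool" where
  "has_type \<sigma> j X \<longleftrightarrow> (\<exists>\<alpha>. tile_of \<sigma> j \<alpha> X)"

text \<open>The last clause says that distinct prototiles are geometrically different; it makes the type
  of a tile well defined. Together with \<open>distinct (rule \<sigma> i)\<close> it also ensures that distinct
  entries of the rule are distinct tiles of \<open>rho \<sigma> i\<close>.\<close>

definition multiscale_scheme :: "('a::euclidean_space) scheme \<Rightarrow> bool" where
  "multiscale_scheme \<sigma> \<longleftrightarrow>
     ntypes \<sigma> \<ge> 1 \<and>
     (\<forall>i<ntypes \<sigma>. tile (proto \<sigma> i)) \<and>
     (\<forall>i<ntypes \<sigma>. distinct (rule \<sigma> i) \<and>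
        (\<forall>(j, \<alpha>, v) \<in> set (rule \<sigma> i). j < ntypes \<sigma> \<and> 0 < \<alpha> \<and> \<alpha> < 1) \<and>
        tessellation (proto \<sigma> i) (rho \<sigma> i)) \<and>
     (\<forall>i<ntypes \<sigma>. \<forall>j<ntypes \<sigma>. i \<noteq> j \<longrightarrow> \<not> has_type \<sigma> j (proto \<sigma> i))"

definition normalized :: "('a::euclidean_space) scheme \<Rightarrow> bool" where
  "normalized \<sigma> \<longleftrightarrow> (\<forall>i<ntypes \<sigma>. measure lebesgue (proto \<sigma> i) = 1)"

definition beta_min :: "('a::euclidean_space) scheme \<Rightarrow> nat \<Rightarrow> real" where
  "beta_min \<sigma> j = Min {\<alpha>. \<exists>i<ntypes \<sigma>. \<exists>X\<in>rho \<sigma> i. tile_of \<sigma> j \<alpha> X}"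

definition legal_tile :: "('a::euclidean_space) scheme \<Rightarrow> 'a set \<Rightarrow> bool" where
  "legal_tile \<sigma> X \<longleftrightarrow> (\<exists>j \<alpha>. beta_min \<sigma> j < \<alpha> \<and> \<alpha> \<le> 1 \<and> tile_of \<sigma> j \<alpha> X)"

text \<open>For \<open>X = v + \<alpha> T\<^sub>i\<close> the representation is unique under the standing assumptions, and the result
  is \<open>v + \<alpha> \<rho>(T\<^sub>i)\<close>.\<close>

definition substitute :: "('a::euclidean_space) scheme \<Rightarrow> 'a set \<Rightarrow> 'a set set" where
  "substitute \<sigma> X = {Z. \<exists>i<ntypes \<sigma>. \<exists>\<alpha>>0. \<exists>v. X = copy \<alpha> v (proto \<sigma> i) \<and>
     Z \<in> copies \<alpha> v (rho \<sigma> i)}"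

definition subst_step :: "('a::euclidean_space) scheme \<Rightarrow> 'a set set \<Rightarrow> 'a set set" where
  "subst_step \<sigma> P = (\<Union>X\<in>P. if measure lebesgue X > 1 then substitute \<sigma> X else {X})"

definition flow :: "('a::euclidean_space) scheme \<Rightarrow> real \<Rightarrow> 'a set \<Rightarrow> 'a set set" where
  "flow \<sigma> t T = (subst_step \<sigma> ^^
     (LEAST k. \<forall>X \<in> (subst_step \<sigma> ^^ k) {copy (exp t) 0 T}. measure lebesgue X \<le> 1))
       {copy (exp t) 0 T}"

definition irreducible_scheme :: "('a::euclidean_space) scheme \<Rightarrow> bool" where
  "irreducible_scheme \<sigma> \<longleftrightarrow> (\<forall>i<ntypes \<sigma>. \<forall>j<ntypes \<sigma>.
     \<exists>t>0. \<exists>X \<in> flow \<sigma> t (proto \<sigma> i). has_type \<sigma> j X)"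

definition return_time :: "('a::euclidean_space) scheme \<Rightarrow> nat \<Rightarrow> real \<Rightarrow> bool" where
  "return_time \<sigma> i t \<longleftrightarrow> t > 0 \<and>
     (\<exists>X \<in> flow \<sigma> t (proto \<sigma> i). has_type \<sigma> i X \<and> measure lebesgue X = 1)"

definition incommensurable :: "('a::euclidean_space) scheme \<Rightarrow> bool" where
  "incommensurable \<sigma> \<longleftrightarrow> (\<exists>i<ntypes \<sigma>. \<exists>j<ntypes \<sigma>. \<exists>t1 t2.
     return_time \<sigma> i t1 \<and> return_time \<sigma> j t2 \<and> t1 / t2 \<notin> \<rat>)"

definition count_tiles ::
    "('a::euclidean_space) scheme \<Rightarrow> nat \<Rightarrow> real \<Rightarrow> real \<Rightarrow> 'a set set \<Rightarrow> nat" where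
  "count_tiles \<sigma> j a b P = card {X \<in> P. \<exists>\<alpha>\<in>{a..b}. tile_of \<sigma> j \<alpha> X}"

definition subst_matrix :: "('a::euclidean_space) scheme \<Rightarrow> real \<Rightarrow> real Matrix.mat" where
  "subst_matrix \<sigma> s = Matrix.mat (ntypes \<sigma>) (ntypes \<sigma>)
     (\<lambda>(i, j). \<Sum>\<alpha>\<leftarrow>consts_of_subst \<sigma> i j. \<alpha> powr s)"

definition subst_matrix_deriv :: "('a::euclidean_space) scheme \<Rightarrow> real \<Rightarrow> real Matrix.mat" where
  "subst_matrix_deriv \<sigma> s = Matrix.mat (ntypes \<sigma>) (ntypes \<sigma>)
     (\<lambda>(i, j). deriv (\<lambda>u. subst_matrix \<sigma> u $$ (i, j)) s)"

definition mat_trace :: "real Matrix.mat \<Rightarrow> real" where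
  "mat_trace A = sum_list (diag_mat A)"

definition Q_matrix :: "('a::euclidean_space) scheme \<Rightarrow> real Matrix.mat" where
  "Q_matrix \<sigma> = (let d = real DIM('a); A = adj_mat (1\<^sub>m (ntypes \<sigma>) - subst_matrix \<sigma> d)
     in (1 / (- mat_trace (A * subst_matrix_deriv \<sigma> d))) \<cdot>\<^sub>m A)"

text \<open>\<open>Q_matrix \<sigma>\<close> has constant columns when \<open>\<sigma>\<close> is normalized and irreducible.\<close>

definition q_col :: "('a::euclidean_space) scheme \<Rightarrow> nat \<Rightarrow> real" where
  "q_col \<sigma> h = (THE q. Matrix.col (Q_matrix \<sigma>) h = q \<cdot>\<^sub>v Matrix.vec (ntypes \<sigma>) (\<lambda>_. 1))"

definition phi :: "('a::euclidean_space) scheme \<Rightarrow> nat \<Rightarrow> real \<Rightarrow> real \<Rightarrow> real" where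
  "phi \<sigma> j a b = (\<Sum>h<ntypes \<sigma>.
     (1 / real DIM('a) * (\<Sum>\<alpha>\<leftarrow>consts_of_subst \<sigma> h j. \<alpha> ^ DIM('a) *
        (max a \<alpha> powi (- int DIM('a)) - max b \<alpha> powi (- int DIM('a))))) * q_col \<sigma> h)"

definition boundary :: "'a::euclidean_space set set \<Rightarrow> 'a set" where
  "boundary P = (\<Union>X\<in>P. frontier X)"

definition nbhd :: "real \<Rightarrow> 'a::euclidean_space set \<Rightarrow> 'a set" where
  "nbhd r A = (\<Union>a\<in>A. ball a r)"

definition D_dist :: "'a::euclidean_space set \<Rightarrow> 'a set \<Rightarrow> real" where
  "D_dist A1 A2 = Inf ({r. r > 0 \<and> A1 \<inter> ball 0 (1 / r) \<subseteq> nbhd r A2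
     \<and> A2 \<inter> ball 0 (1 / r) \<subseteq> nbhd r A1} \<union> {1})"

definition D_lim :: "(nat \<Rightarrow> 'a::euclidean_space set) \<Rightarrow> 'a set \<Rightarrow> bool" where
  "D_lim As A \<longleftrightarrow> (\<lambda>n. D_dist (As n) A) \<longlonglongrightarrow> 0"

definition origin_interior :: "('a::euclidean_space) scheme \<Rightarrow> bool" where
  "origin_interior \<sigma> \<longleftrightarrow> (\<forall>i<ntypes \<sigma>. 0 \<in> interior (proto \<sigma> i))"

definition generating_patches :: "('a::euclidean_space) scheme \<Rightarrow> 'a set set set" where
  "generating_patches \<sigma> = {flow \<sigma> t (proto \<sigma> i) | t i. t \<ge> 0 \<and> i < ntypes \<sigma>}"

text \<open>Since boundaries do not see which tile owns a boundary point, the tiles of the tilings have to be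
  required explicitly to be rescaled prototiles, of scale at most 1 as in the domain of the flow.\<close>

definition tiling_space :: "('a::euclidean_space) scheme \<Rightarrow> 'a set set set" where
  "tiling_space \<sigma> = {\<T>. tiling \<T> \<and> (\<forall>X\<in>\<T>. \<exists>j. \<exists>\<alpha>\<le>1. tile_of \<sigma> j \<alpha> X) \<and>
     (\<forall>P\<subseteq>\<T>. patch P \<longrightarrow>
       (\<exists>Ps vs. (\<forall>n. patch (Ps n) \<and> (\<exists>G \<in> generating_patches \<sigma>. Ps n \<subseteq> G)) \<and>
          D_lim (\<lambda>n. boundary (copies 1 (vs n) (Ps n))) (boundary P)))}"

definition stationary :: "('a::euclidean_space) scheme \<Rightarrow> real \<Rightarrow> 'a set set \<Rightarrow> bool" where
  "stationary \<sigma> s \<S> \<longleftrightarrow> \<S> \<in> tiling_space \<sigma> \<and> (\<exists>i<ntypes \<sigma>. \<exists>a\<ge>0.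
     return_time \<sigma> i s \<and> 0 \<in> interior (proto \<sigma> i) \<and>
     (\<forall>k::nat. flow \<sigma> (a + real k * s) (proto \<sigma> i) \<subseteq> flow \<sigma> (a + real (Suc k) * s) (proto \<sigma> i)) \<and>
     \<S> = (\<Union>k::nat. flow \<sigma> (a + real k * s) (proto \<sigma> i)))"

text \<open>Convergence of tilings: the boundaries converge, and the limit inherits its decomposition into
  typed tiles, i.e. every tile of the limit is a limit of tiles of the same type. The second clause
  is needed because the boundary alone need not determine the tiles (for instance if two
  prototiles differ only in boundary points, or if prototiles are disconnected).\<close>

definition tiling_lim ::
    "('a::euclidean_space) scheme \<Rightarrow> (nat \<Rightarrow> 'a set set) \<Rightarrow> 'a set set \<Rightarrow> bool" where
  "tiling_lim \<sigma> \<T>s \<T> \<longleftrightarrow> D_lim (\<lambda>n. boundary (\<T>s n)) (boundary \<T>) \<and>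
     (\<forall>X\<in>\<T>. \<forall>j. has_type \<sigma> j X \<longrightarrow>
       (\<exists>Xs. (\<forall>\<^sub>F n in sequentially. Xs n \<in> \<T>s n \<and> has_type \<sigma> j (Xs n)) \<and>
          D_lim (\<lambda>n. frontier (Xs n)) (frontier X)))"

text \<open>\<open>\<T>sup m\<close> is the tiling whose tiles are the \<open>m\<close>-supertiles of \<open>\<T>\<close>, obtained from the stationary
  tiling \<open>\<S>\<close> along the translations \<open>v\<close>.\<close>

definition supertile_tilings :: "('a::euclidean_space) scheme \<Rightarrow> real \<Rightarrow> 'a set set \<Rightarrow>
    (nat \<Rightarrow> 'a) \<Rightarrow> 'a set set \<Rightarrow> (nat \<Rightarrow> 'a set set) \<Rightarrow> bool" where
  "supertile_tilings \<sigma> s \<S> v \<T> \<T>sup \<longleftrightarrow>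
     tiling_lim \<sigma> (\<lambda>n. copies 1 (v n) \<S>) \<T> \<and>
     (\<forall>m. tiling (\<T>sup m) \<and> (\<forall>X\<in>\<T>sup m. \<exists>j. has_type \<sigma> j X) \<and>
        tiling_lim \<sigma> (\<lambda>n. copies 1 (v n) (copies (exp (real m * s)) 0 \<S>)) (\<T>sup m))"

end

theory Submission
  imports Defs
begin

text \<open>Rescaled to \<open>f i t = e\<^sup>-\<^sup>d\<^sup>t N i t\<close>, the number \<open>N i t\<close> of tiles of type \<open>j\<close> with scale in \<open>[a, b]\<close> in \<open>F\<^sub>t(T\<^sub>i)\<close>
  solves a Markov renewal equation: an entry of \<open>\<rho>(T\<^sub>i)\<close> of scale \<open>\<alpha>\<close> has probability \<open>\<alpha>\<^sup>d\<close> and delay \<open>ln (1/\<alpha>)\<close>.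
  Irreducibility and incommensurability make the set of path lengths between any two types asymptotically
  dense, which forces \<open>f i t\<close> to converge to a limit independent of \<open>i\<close>; a conservation law weighted by the
  left invariant vector \<open>u\<close> of \<open>M(d)\<close> computes the limit. All rows of the adjugate of \<open>I - M(d)\<close>
  equal the same multiple of \<open>u\<close>, and \<open>q\<^sub>h\<close> is \<open>u\<^sub>h\<close> divided by the mean delay.

  A supertile of a tiling in the tiling space is a limit of supertiles of translates of the stationary
  tiling, inside which the tiles are given by the flow. In the limit the tiles correspond to each other
  except near the boundary of the supertile, where there are only \<open>o(vol)\<close> many.\<close>

section \<open>Renewal equations\<close>

text \<open>The probabilities attached to a rule add up to 1 because volumes do, so past the support
  of the forcing term a solution is a weighted average of its own earlier values. Averages preserve
  bounds and moduli of continuity, and the convergence proof rests on this. Averaging only speaks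
  about the exact times reached by paths, and a dense set of times controls all times only for a
  uniformly continuous function. Counts jump, so convergence is proved for continuous forcing terms
  first, and indicators of time intervals are squeezed between trapezoids.

  For supertiles the obstacle is that tilings converge only through the boundaries of their tiles.
  The scale and position of a tile are recovered from its boundary by support functions, and a
  volume argument rules out tiles of the approximating tilings that come from no tile of the limit.
  Scales still move a little in the limit, so tiles with scale close to a or b may enter or leave
  the interval; continuity of \<open>phi\<close> in a and b absorbs this.\<close>

lemma nat_combinations_asymptotically_dense:
  fixes t1 t2 \<epsilon> :: real
  assumes "t1 > 0" "t2 > 0" "t1 / t2 \<notin> \<rat>" "\<epsilon> > 0"
  shows "\<forall>\<^sub>F x in at_top. \<exists>n m::nat. \<bar>x - (real n * t1 + real m * t2)\<bar> \<le> \<epsilon>"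
proof -
  define \<theta> where "\<theta> = t1 / t2"
  have th: "\<theta> > 0" using assms by (simp add: \<theta>_def)
  obtain N :: nat where N: "N > 0" "1 / real N < \<epsilon> / t2"
    by (metis assms(2,4) divide_pos_pos nat_approx_posE zero_less_Suc)
  obtain h k :: int where hk: "0 < k" "k \<le> int N" "\<bar>of_int k * \<theta> - of_int h\<bar> < 1 / real N"
    using Dirichlet_approx[OF N(1), of \<theta>] by blast
  \<comment> \<open>Dirichlet approximation leaves the sign of h open, but only h >= 0 makes B a
    natural multiple of t2. Since k \<theta> > 0 and 1 / N <= 1, the integer h exceeds -1.\<close>
  have "of_int h > of_int k * \<theta> - 1 / real N" using hk by linarith
  moreover have "1 / real N \<le> 1" using N by simp
  moreover have "of_int k * \<theta> > 0" using hk th by simp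
  ultimately have "of_int h > (-1::real)" by linarith
  then have h0: "h \<ge> 0" by linarith
  define A where "A = real (nat k) * t1"
  define B where "B = real (nat h) * t2"
  have AB: "A = (of_int k * \<theta>) * t2" "B = of_int h * t2"
    using hk h0 assms by (auto simp: A_def B_def \<theta>_def)
  have "\<bar>A - B\<bar> = \<bar>of_int k * \<theta> - of_int h\<bar> * t2"
    using assms(2) by (simp add: AB abs_mult flip: left_diff_distrib)
  also have "\<dots> < 1 / real N * t2" using hk assms by (intro mult_strict_right_mono) auto
  also have "\<dots> < \<epsilon> / t2 * t2" using N assms by (intro mult_strict_right_mono) auto
  finally have d1: "\<bar>A - B\<bar> < \<epsilon>" using assms by simp
  have "A \<noteq> B"
  proof
    assume "A = B"
    then have "of_int k * \<theta> = of_int h" using AB assms by simp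
    then have "\<theta> = of_int h / of_int k" using hk by (simp add: field_simps)
    then show False using assms(3) \<theta>_def by auto
  qed
  have A0: "A \<ge> 0" "B \<ge> 0" using assms by (auto simp: A_def B_def)
  \<comment> \<open>Sums of K numbers, each equal to a or b, run from K a to K b in steps of b - a <
    \<epsilon>. The ranges for K and K + 1 leave no gap once K >= a / (b - a), which explains the
    threshold a b / (b - a).\<close>
  have key: "\<exists>K j::nat. j \<le> K \<and> \<bar>x - (real (K - j) * a + real j * b)\<bar> \<le> \<epsilon>"
    if ab: "0 \<le> a" "a < b" "b - a < \<epsilon>" and x: "x \<ge> a * b / (b - a)" for a b x
  proof -
    define K where "K = nat \<lceil>x / b\<rceil>"
    have b0: "b > 0" using ab by simp
    have x0: "x \<ge> 0" using x ab b0 by (smt (verit) divide_nonneg_pos mult_nonneg_nonneg)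
    have "real K = of_int \<lceil>x / b\<rceil>" using x0 b0 by (simp add: K_def of_nat_nat)
    then have K: "real K \<ge> x / b" "real K \<le> x / b + 1" by linarith+
    have K1: "x \<le> real K * b" using K b0 by (simp add: field_simps)
    have "real K * a \<le> (x / b + 1) * a" using K ab by (intro mult_right_mono) auto
    also have "\<dots> \<le> x"
    proof -
      have "a * b \<le> x * (b - a)" using x ab by (simp add: field_simps)
      then have "x * a + a * b \<le> x * b" by (simp add: algebra_simps)
      then show ?thesis using b0 by (simp add: field_simps)
    qed
    finally have K2: "real K * a \<le> x" .
    define j where "j = nat \<lfloor>(x - real K * a) / (b - a)\<rfloor>"
    have "real j = of_int \<lfloor>(x - real K * a) / (b - a)\<rfloor>" using K2 ab by (simp add: j_def of_nat_nat)
    then have j: "real j \<le> (x - real K * a) / (b - a)" "real j \<ge> (x - real K * a) / (b - a) - 1" by linarith+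
    have "(x - real K * a) / (b - a) \<le> real K" using K1 ab by (simp add: field_simps)
    then have jK: "j \<le> K" using j by linarith
    have "real (K - j) * a + real j * b = real K * a + real j * (b - a)"
      using jK by (simp add: of_nat_diff algebra_simps)
    moreover have "real j * (b - a) \<le> x - real K * a" using j(1) ab by (simp add: field_simps)
    moreover have "real j * (b - a) \<ge> x - real K * a - (b - a)" 
    proof -
      have "((x - real K * a) / (b - a) - 1) * (b - a) \<le> real j * (b - a)"
        using j(2) ab by (intro mult_right_mono) auto
      moreover have "((x - real K * a) / (b - a) - 1) * (b - a) = x - real K * a - (b - a)"
        using ab by (subst left_diff_distrib) simp
      ultimately show ?thesis by linarith
    qed
    ultimately show ?thesis using jK ab by (intro exI[of _ K] exI[of _ j]) auto
  qed
  define a where "a = min A B" define b where "b = max A B"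
  have ab: "0 \<le> a" "a < b" "b - a < \<epsilon>" using A0 \<open>A \<noteq> B\<close> d1 by (auto simp: a_def b_def)
  have "\<exists>n m::nat. \<bar>x - (real n * t1 + real m * t2)\<bar> \<le> \<epsilon>" if x: "x \<ge> a * b / (b - a)" for x
  proof -
    obtain K j :: nat where Kj: "\<bar>x - (real (K - j) * a + real j * b)\<bar> \<le> \<epsilon>"
      using key[OF ab x] by blast
    have "real (K - j) * a + real j * b = (if A \<le> B then real ((K - j) * nat k) * t1 + real (j * nat h) * t2
       else real (j * nat k) * t1 + real ((K - j) * nat h) * t2)"
      by (auto simp: a_def b_def A_def B_def)
    then show ?thesis using Kj by (metis (no_types))
  qed
  then show ?thesis by (auto simp: eventually_at_top_linorder)
qed

lemma integral_window_tendsto: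
  fixes f :: "real \<Rightarrow> real"
  assumes "(f \<longlongrightarrow> L) at_top" "continuous_on UNIV f" "s > 0"
  shows "((\<lambda>T. integral {T - s..T} f) \<longlongrightarrow> s * L) at_top"
proof (rule tendstoI)
  fix \<epsilon> :: real assume eps: "\<epsilon> > 0"
  define \<eta> where "\<eta> = \<epsilon> / (2 * s)"
  have eta: "\<eta> > 0" "s * \<eta> < \<epsilon>" using eps assms by (auto simp: \<eta>_def field_simps)
  obtain T0 where T0: "\<And>t. t \<ge> T0 \<Longrightarrow> \<bar>f t - L\<bar> < \<eta>"
    using tendstoD[OF assms(1) eta(1)] unfolding eventually_at_top_linorder dist_real_def by blast
  show "\<forall>\<^sub>F T in at_top. dist (integral {T - s..T} f) (s * L) < \<epsilon>"
    using eventually_ge_at_top[of "T0 + s"]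
  proof eventually_elim
    case (elim T)
    have int: "f integrable_on {T - s..T}"
      using assms(2) by (intro integrable_continuous_interval) (auto intro: continuous_on_subset)
    have b: "L - \<eta> \<le> f x" "f x \<le> L + \<eta>" if "x \<in> {T - s..T}" for x
      using T0[of x] that elim by auto
    have "integral {T - s..T} f \<le> integral {T - s..T} (\<lambda>x. L + \<eta>)"
      by (rule integral_le[OF int]) (use b in auto)
    moreover have "integral {T - s..T} (\<lambda>x. L - \<eta>) \<le> integral {T - s..T} f"
      by (rule integral_le[OF _ int]) (use b in auto)
    ultimately have "integral {T - s..T} f \<le> s * L + s * \<eta>" "s * L - s * \<eta> \<le> integral {T - s..T} f"
      using assms(3) by (auto simp: algebra_simps)
    then show ?case using eta(2) by (auto simp: dist_real_def abs_less_iff)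
  qed
qed

text \<open>A Markov renewal process on the states \<open>{..<n}\<close>: an edge \<open>e \<in> E i\<close> is taken from state \<open>i\<close>
  with probability \<open>p e\<close> and leads to state \<open>tgt e\<close> after the delay \<open>len e\<close>.\<close>

locale markov_renewal =
  fixes n :: nat and E :: "nat \<Rightarrow> 'e set" and tgt :: "'e \<Rightarrow> nat" and p len :: "'e \<Rightarrow> real"
  assumes n_pos: "n \<ge> 1"
    and finite_E: "\<And>i. i < n \<Longrightarrow> finite (E i)"
    and tgt_less: "\<And>i e. i < n \<Longrightarrow> e \<in> E i \<Longrightarrow> tgt e < n"
    and p_pos: "\<And>i e. i < n \<Longrightarrow> e \<in> E i \<Longrightarrow> p e > 0"
    and len_pos: "\<And>i e. i < n \<Longrightarrow> e \<in> E i \<Longrightarrow> len e > 0"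
    and sum_p: "\<And>i. i < n \<Longrightarrow> (\<Sum>e\<in>E i. p e) = 1"
begin

section \<open>Extreme delays and probabilities, and averages over the edges of a state\<close>

definition edges :: "'e set" where "edges = (\<Union>i<n. E i)"
definition lmin :: real where "lmin = Min (len ` edges)"
definition lmax :: real where "lmax = Max (len ` edges)"
definition pmin :: real where "pmin = Min (p ` edges)"

lemma finite_edges: "finite edges" by (simp add: edges_def finite_E)

lemma E_nonempty: "i < n \<Longrightarrow> E i \<noteq> {}"
  using sum_p by force

lemma edges_nonempty: "edges \<noteq> {}"
  using E_nonempty[of 0] n_pos unfolding edges_def by force

lemma lmin_pos: "lmin > 0"
  unfolding lmin_def using finite_edges edges_nonempty by (auto simp: edges_def len_pos)

lemma pmin_pos: "pmin > 0"
  unfolding pmin_def using finite_edges edges_nonempty by (auto simp: edges_def p_pos)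

lemma lmin_le: "i < n \<Longrightarrow> e \<in> E i \<Longrightarrow> lmin \<le> len e"
  unfolding lmin_def using finite_edges by (auto simp: edges_def intro!: Min_le)

lemma lmax_ge: "i < n \<Longrightarrow> e \<in> E i \<Longrightarrow> len e \<le> lmax"
  unfolding lmax_def using finite_edges by (auto simp: edges_def intro!: Max_ge)

lemma lmax_pos: "lmax > 0"
proof -
  obtain e where "e \<in> E 0" using E_nonempty[of 0] n_pos by auto
  then show ?thesis using len_pos[of 0 e] lmax_ge[of 0 e] n_pos by linarith
qed

lemma pmin_le: "i < n \<Longrightarrow> e \<in> E i \<Longrightarrow> pmin \<le> p e"
  unfolding pmin_def using finite_edges by (auto simp: edges_def intro!: Min_le)

lemma p_le_1:
  assumes "i < n" "e \<in> E i" shows "p e \<le> 1"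
proof -
  have "p e \<le> (\<Sum>e\<in>E i. p e)"
    using assms p_pos[OF assms(1)] finite_E by (intro member_le_sum) (auto intro: less_imp_le)
  then show ?thesis using sum_p assms by simp
qed

lemma pmin_le_1: "pmin \<le> 1"
proof -
  obtain e where "e \<in> E 0" using E_nonempty[of 0] n_pos by auto
  then show ?thesis using p_le_1[of 0 e] pmin_le[of 0 e] n_pos by linarith
qed

lemma average_le:
  assumes "i < n" "\<And>e. e \<in> E i \<Longrightarrow> x e \<le> C"
  shows "(\<Sum>e\<in>E i. p e * x e) \<le> C"
proof -
  have "(\<Sum>e\<in>E i. p e * x e) \<le> (\<Sum>e\<in>E i. p e * C)"
    using assms p_pos[OF assms(1)] by (intro sum_mono mult_left_mono) (auto intro: less_imp_le)
  also have "\<dots> = C" using sum_p[OF assms(1)] by (simp flip: sum_distrib_right)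
  finally show ?thesis .
qed

lemma average_ge:
  assumes "i < n" "\<And>e. e \<in> E i \<Longrightarrow> C \<le> x e"
  shows "C \<le> (\<Sum>e\<in>E i. p e * x e)"
  using average_le[of i "\<lambda>e. - x e" "- C"] assms by (simp add: sum_negf)

lemma average_split:
  assumes "i < n" "e \<in> E i" "\<And>e. e \<in> E i \<Longrightarrow> x e \<le> C"
  shows "(\<Sum>e\<in>E i. p e * x e) \<le> C - p e * (C - x e)"
proof -
  have "0 \<le> p e' * (C - x e')" if "e' \<in> E i" for e'
    using p_pos[OF assms(1) that] assms(3)[OF that] by simp
  then have "p e * (C - x e) \<le> (\<Sum>e\<in>E i. p e * (C - x e))"
    using assms(2) finite_E[OF assms(1)]
    by (intro member_le_sum[of e "E i" "\<lambda>e. p e * (C - x e)"]) auto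
  also have "\<dots> = C - (\<Sum>e\<in>E i. p e * x e)"
    using sum_p[OF assms(1)] by (simp add: right_diff_distrib sum_subtractf flip: sum_distrib_right)
  finally show ?thesis by simp
qed

text \<open>Every edge delays by at least \<open>lmin\<close> > 0, so the renewal equation expresses
  a value at t through values at times up to t - \<open>lmin\<close>. Finitely many such reductions
  lead below c, where solutions vanish.\<close>

lemma delay_induct [consumes 0, case_names base step]:
  fixes c t :: real
  assumes base: "\<And>t. t < c \<Longrightarrow> P t"
    and step: "\<And>t. (\<And>x. x \<le> t - lmin \<Longrightarrow> P x) \<Longrightarrow> P t"
  shows "P t"
proof -
  have "t < c + real k * lmin \<Longrightarrow> P t" for k t
  proof (induction k arbitrary: t)
    case 0
    then show ?case using base by simp
  next
    case (Suc k)
    show ?case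
      by (rule step, rule Suc.IH) (use Suc.prems in \<open>simp add: algebra_simps\<close>)
  qed
  moreover obtain k :: nat where "(t - c) / lmin < real k" using reals_Archimedean2 by blast
  then have "t < c + real k * lmin" using lmin_pos by (simp add: field_simps)
  ultimately show ?thesis by blast
qed

section \<open>Solutions of the renewal equation: comparison, existence, regularity\<close>

definition solution :: "real \<Rightarrow> (nat \<Rightarrow> real \<Rightarrow> real) \<Rightarrow> (nat \<Rightarrow> real \<Rightarrow> real) \<Rightarrow> bool" where
  "solution c g f \<longleftrightarrow> (\<forall>i<n. \<forall>t. (t < c \<longrightarrow> f i t = 0) \<and>
     f i t = g i t + (\<Sum>e\<in>E i. p e * f (tgt e) (t - len e)))"

lemma solution_zero: "solution c g f \<Longrightarrow> i < n \<Longrightarrow> t < c \<Longrightarrow> f i t = 0"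
  by (simp add: solution_def)

lemma solution_eq: "solution c g f \<Longrightarrow> i < n \<Longrightarrow>
    f i t = g i t + (\<Sum>e\<in>E i. p e * f (tgt e) (t - len e))"
  by (simp add: solution_def)

text \<open>The starting times c and c' may differ, since both functions vanish before the smaller
  one. Continuous bounds of a forcing term may thus start earlier than the term they bound.\<close>

lemma solution_mono:
  assumes f: "solution c g f" and f': "solution c' g' f'"
    and le: "\<And>i t. i < n \<Longrightarrow> g i t \<le> g' i t" and i: "i < n"
  shows "f i t \<le> f' i t"
proof -
  have "\<forall>i<n. f i t \<le> f' i t"
  proof (induction t rule: delay_induct[where c = "min c c'"])
    case (base t)
    then show ?case using f f' by (simp add: solution_zero)
  next
    case (step t)
    show ?case
    proof (intro allI impI)
      fix i assume i: "i < n"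
      have "(\<Sum>e\<in>E i. p e * f (tgt e) (t - len e)) \<le> (\<Sum>e\<in>E i. p e * f' (tgt e) (t - len e))"
        using step lmin_le[OF i] p_pos[OF i] tgt_less[OF i]
        by (intro sum_mono mult_left_mono) (auto intro: less_imp_le)
      then show "f i t \<le> f' i t"
        using solution_eq[OF f i, of t] solution_eq[OF f' i, of t] le[OF i, of t] by linarith
    qed
  qed
  then show ?thesis using i by simp
qed

text \<open>Picard iterates: \<open>iterate g k\<close> is the part of the renewal series carried by
  paths with fewer than k edges.\<close>

primrec iterate :: "(nat \<Rightarrow> real \<Rightarrow> real) \<Rightarrow> nat \<Rightarrow> nat \<Rightarrow> real \<Rightarrow> real" where
  "iterate g 0 i t = 0"
| "iterate g (Suc k) i t = g i t + (\<Sum>e\<in>E i. p e * iterate g k (tgt e) (t - len e))"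

lemma iterate_zero:
  assumes "\<And>i t. i < n \<Longrightarrow> t < c \<Longrightarrow> g i t = 0" "i < n" "t < c"
  shows "iterate g k i t = 0"
  using assms(2,3)
proof (induction k arbitrary: i t)
  case (Suc k)
  have "(\<Sum>e\<in>E i. p e * iterate g k (tgt e) (t - len e)) = 0"
  proof (intro sum.neutral ballI)
    fix e assume e: "e \<in> E i"
    show "p e * iterate g k (tgt e) (t - len e) = 0"
      using Suc.IH[of "tgt e" "t - len e"] tgt_less[OF _ e] len_pos[OF _ e] Suc.prems by simp
  qed
  then show ?case using assms(1) Suc.prems by simp
qed simp

text \<open>Paths with k edges use up at least k \<open>lmin\<close> of time. Before c + k
  \<open>lmin\<close> a further iteration therefore only adds values of g at times below c, which
  are 0.\<close>

lemma iterate_Suc: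
  assumes "\<And>i t. i < n \<Longrightarrow> t < c \<Longrightarrow> g i t = 0" "i < n" "t < c + real k * lmin"
  shows "iterate g (Suc k) i t = iterate g k i t"
  using assms(2,3)
proof (induction k arbitrary: i t)
  case 0
  then have "iterate g (Suc 0) i t = 0"
    using iterate_zero[of c g i t "Suc 0"] assms(1) by simp
  then show ?case by simp
next
  case (Suc k)
  have "iterate g (Suc k) (tgt e) (t - len e) = iterate g k (tgt e) (t - len e)" if "e \<in> E i" for e
    using lmin_le[OF Suc.prems(1) that] tgt_less[OF Suc.prems(1) that] Suc.prems
    by (intro Suc.IH) (auto simp: algebra_simps)
  then show ?case by (subst (1 2) iterate.simps) (simp del: iterate.simps cong: sum.cong)
qed

lemma iterate_stable:
  assumes "\<And>i t. i < n \<Longrightarrow> t < c \<Longrightarrow> g i t = 0" "i < n" "t < c + real k * lmin" "k \<le> k'"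
  shows "iterate g k' i t = iterate g k i t"
  using assms(4)
proof (induction k' rule: dec_induct)
  case (step m)
  have "real k * lmin \<le> real m * lmin" using step lmin_pos by simp
  then have "t < c + real m * lmin" using assms(3) by linarith
  then show ?case using iterate_Suc[of c g i t m] assms(1,2) step by simp
qed simp

lemma solution_exists:
  assumes g0: "\<And>i t. i < n \<Longrightarrow> t < c \<Longrightarrow> g i t = 0"
    and cont: "\<And>i. i < n \<Longrightarrow> continuous_on UNIV (g i)"
  obtains f where "solution c g f" "\<And>i. i < n \<Longrightarrow> continuous_on UNIV (f i)"
proof -
  define K where "K t = nat \<lceil>(t - c) / lmin\<rceil> + 1" for t
  define f where "f i t = iterate g (K t) i t" for i t
  have K: "t < c + real (K t) * lmin" for t
  proof -
    have "(t - c) / lmin < real (K t)" unfolding K_def by linarith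
    then show ?thesis using lmin_pos by (simp add: field_simps)
  qed
  have f_eq: "f i t = iterate g k i t" if "i < n" "t < c + real k * lmin" for i t k
    using iterate_stable[of c g i t "K t" "max k (K t)"] iterate_stable[of c g i t k "max k (K t)"] K[of t] that g0
    by (simp add: f_def)
  have "solution c g f"
    unfolding solution_def
  proof (intro allI impI conjI)
    fix i t assume i: "i < n"
    show "f i t = 0" if "t < c" using f_eq[of i t 0] that i by simp
    have "f i t = iterate g (Suc (K t)) i t"
      using K[of t] i lmin_pos by (intro f_eq) (auto simp: algebra_simps)
    moreover have "iterate g (K t) (tgt e) (t - len e) = f (tgt e) (t - len e)" if "e \<in> E i" for e
      using K[of t] i that len_pos[OF i that] tgt_less[OF i that] by (intro f_eq[symmetric]) auto
    ultimately show "f i t = g i t + (\<Sum>e\<in>E i. p e * f (tgt e) (t - len e))" by simp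
  qed
  moreover have "continuous_on UNIV (f i)" if i: "i < n" for i
  proof -
    have it: "continuous_on UNIV (iterate g k i)" if "i < n" for k i
      using that
    proof (induction k arbitrary: i)
      case (Suc k)
      have "continuous_on UNIV (\<lambda>t. iterate g k (tgt e) (t - len e))" if "e \<in> E i" for e
        by (rule continuous_on_compose2[OF Suc.IH[of "tgt e"]]) 
          (use that tgt_less Suc.prems in \<open>auto intro!: continuous_intros\<close>)
      then show ?case using cont[OF Suc.prems] by (auto intro!: continuous_intros)
    qed (simp)
    have "isCont (f i) t" for t
    proof -
      \<comment> \<open>The number of iterations in \<open>f\<close> varies with the time, but on
        this open half line the single iterate with index \<open>K t\<close> represents
        \<open>f i\<close>, so continuity at t is inherited from it.\<close>
      let ?S = "{..<c + real (K t) * lmin}"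
      have "continuous_on ?S (f i)"
        by (rule continuous_on_cong[THEN iffD2, OF refl _ continuous_on_subset[OF it[OF i, of "K t"]]])
          (auto simp: f_eq i)
      then show ?thesis using K[of t] continuous_on_eq_continuous_at[of ?S "f i"] by auto
    qed
    then show ?thesis by (simp add: continuous_on_eq_continuous_at)
  qed
  ultimately show ?thesis using that by blast
qed

text \<open>On a compact window this is the Heine-Cantor theorem. To the left of it f is 0, and to
  the right f is an average of translates of itself, so the modulus of continuity found on the
  window persists forever.\<close>

lemma solution_uniformly_continuous:
  assumes f: "solution c g f" and G: "\<And>i t. i < n \<Longrightarrow> t > G \<Longrightarrow> g i t = 0"
    and cont: "\<And>i. i < n \<Longrightarrow> continuous_on UNIV (f i)" and eps: "\<epsilon> > 0"
  obtains \<delta> where "\<delta> > 0" "\<And>i x y. i < n \<Longrightarrow> \<bar>x - y\<bar> \<le> \<delta> \<Longrightarrow> \<bar>f i x - f i y\<bar> \<le> \<epsilon>"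
proof -
  define H where "H = max G c"
  have "\<forall>\<^sub>F \<delta> in at_right 0. \<forall>x\<in>{c-2..H+3}. \<forall>y\<in>{c-2..H+3}. \<bar>x - y\<bar> \<le> \<delta> \<longrightarrow> \<bar>f i x - f i y\<bar> \<le> \<epsilon>"
    if i: "i < n" for i
  proof -
    have "uniformly_continuous_on {c-2..H+3} (f i)"
      using cont[OF i] by (intro compact_uniformly_continuous) (auto intro: continuous_on_subset)
    then obtain d where d: "d > 0" "\<And>x y. x \<in> {c-2..H+3} \<Longrightarrow> y \<in> {c-2..H+3} \<Longrightarrow> dist y x < d \<Longrightarrow> dist (f i y) (f i x) < \<epsilon>"
      unfolding uniformly_continuous_on_def using eps by metis
    have "\<bar>f i x - f i y\<bar> \<le> \<epsilon>" if "x \<in> {c-2..H+3}" "y \<in> {c-2..H+3}" "\<bar>x - y\<bar> \<le> r" "r < d" for x y r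
      using d(2)[of y x] that by (simp add: dist_real_def)
    then show ?thesis using d(1) unfolding eventually_at_right_field by blast
  qed
  then have "\<forall>\<^sub>F \<delta> in at_right 0. \<forall>i\<in>{..<n}. \<forall>x\<in>{c-2..H+3}. \<forall>y\<in>{c-2..H+3}. \<bar>x - y\<bar> \<le> \<delta> \<longrightarrow> \<bar>f i x - f i y\<bar> \<le> \<epsilon>"
    by (subst eventually_ball_finite_distrib) auto
  then obtain b where b: "b > 0" "\<And>\<delta>. 0 < \<delta> \<Longrightarrow> \<delta> < b \<Longrightarrow> \<forall>i\<in>{..<n}. \<forall>x\<in>{c-2..H+3}. \<forall>y\<in>{c-2..H+3}. \<bar>x - y\<bar> \<le> \<delta> \<longrightarrow> \<bar>f i x - f i y\<bar> \<le> \<epsilon>"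
    unfolding eventually_at_right_field by auto
  \<comment> \<open>The cap 1 matches the margins of the window: for x < c - 1 both x and x + r lie
    before c, for x > \<open>H\<close> + 2 both lie past G, and otherwise both lie in the
    window.\<close>
  define \<delta> where "\<delta> = min 1 (b / 2)"
  have \<delta>: "\<delta> > 0" "\<delta> \<le> 1" "\<delta> < b" using b by (auto simp: \<delta>_def min_def)
  have "\<forall>i<n. \<forall>r. \<bar>r\<bar> \<le> \<delta> \<longrightarrow> \<bar>f i x - f i (x + r)\<bar> \<le> \<epsilon>" for x
  proof (induction x rule: delay_induct[where c = "c - 1"])
    case (base x)
    then show ?case using f \<delta> eps by (auto simp: solution_zero)
  next
    case (step x)
    show ?case
    proof (intro allI impI)
      fix i r assume i: "i < n" and r: "\<bar>r\<bar> \<le> \<delta>"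
      consider "x < c - 1" | "x \<in> {c-1..H+2}" | "x > H + 2" by force
      then show "\<bar>f i x - f i (x + r)\<bar> \<le> \<epsilon>"
      proof cases
        case 1 then show ?thesis using f \<delta> eps r i by (auto simp: solution_zero)
      next
        case 2 
        then have "x \<in> {c-2..H+3}" "x + r \<in> {c-2..H+3}" "\<bar>x - (x+r)\<bar> \<le> \<delta>" using r \<delta> by auto
        then show ?thesis using b(2)[OF \<delta>(1,3)] i by blast
      next
        case 3
        then have "g i x = 0" "g i (x + r) = 0" using G[OF i] r \<delta> by (auto simp: H_def)
        then have eq: "f i x - f i (x + r) = (\<Sum>e\<in>E i. p e * (f (tgt e) (x - len e) - f (tgt e) (x + r - len e)))"
          using solution_eq[OF f i, of x] solution_eq[OF f i, of "x + r"]
          by (simp add: right_diff_distrib sum_subtractf)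
        have *: "\<bar>f (tgt e) (x - len e) - f (tgt e) (x + r - len e)\<bar> \<le> \<epsilon>" if "e \<in> E i" for e
          using step[of "x - len e"] lmin_le[OF i that] tgt_less[OF i that] r
          by (simp add: algebra_simps)
        show ?thesis unfolding eq abs_le_iff
          using average_le[OF i, of "\<lambda>e. f (tgt e) (x - len e) - f (tgt e) (x + r - len e)" \<epsilon>]
            average_ge[OF i, of "- \<epsilon>" "\<lambda>e. f (tgt e) (x - len e) - f (tgt e) (x + r - len e)"] * 
          by (smt (verit) abs_le_iff)
      qed
    qed
  qed
  then have "\<bar>f i x - f i y\<bar> \<le> \<epsilon>" if "i < n" "\<bar>x - y\<bar> \<le> \<delta>" for i x y
    using that by (metis abs_minus_commute add_diff_cancel_left' diff_add_cancel add.commute)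
  then show ?thesis using that \<delta>(1) by blast
qed

text \<open>Compactness bounds f on {c..G}; past G a value is an average of earlier ones and cannot
  exceed their bound.\<close>

lemma solution_bounded:
  assumes f: "solution c g f" and G: "\<And>i t. i < n \<Longrightarrow> t > G \<Longrightarrow> g i t = 0"
    and cont: "\<And>i. i < n \<Longrightarrow> continuous_on UNIV (f i)"
  obtains B where "\<And>i x. i < n \<Longrightarrow> \<bar>f i x\<bar> \<le> B"
proof -
  have "\<forall>i. \<exists>B. i < n \<longrightarrow> (\<forall>x\<in>{c..G}. \<bar>f i x\<bar> \<le> B)"
  proof
    fix i
    show "\<exists>B. i < n \<longrightarrow> (\<forall>x\<in>{c..G}. \<bar>f i x\<bar> \<le> B)"
    proof (cases "i < n")
      case True
      have "bounded (f i ` {c..G})"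
        using cont[OF True] by (intro compact_imp_bounded compact_continuous_image) (auto intro: continuous_on_subset)
      then show ?thesis by (auto simp: bounded_iff)
    qed auto
  qed
  then obtain Bf where Bf: "\<And>i x. i < n \<Longrightarrow> x \<in> {c..G} \<Longrightarrow> \<bar>f i x\<bar> \<le> Bf i" by metis
  define B where "B = (\<Sum>i<n. \<bar>Bf i\<bar>)"
  have B: "Bf i \<le> B" if "i < n" for i
  proof -
    have "\<bar>Bf i\<bar> \<le> B" unfolding B_def using that by (intro member_le_sum) auto
    then show ?thesis by simp
  qed
  have B0: "B \<ge> 0" by (simp add: B_def sum_nonneg)
  have "\<forall>i<n. \<bar>f i x\<bar> \<le> B" for x
  proof (induction x rule: delay_induct[where c = c])
    case (base t)
    then show ?case using f B0 by (simp add: solution_zero)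
  next
    case (step x)
    show ?case
    proof (intro allI impI)
      fix i assume i: "i < n"
      consider "x < c" | "x \<in> {c..G}" | "x > G" by force
      then show "\<bar>f i x\<bar> \<le> B"
      proof cases
        case 3
        then have eq: "f i x = (\<Sum>e\<in>E i. p e * f (tgt e) (x - len e))"
          using solution_eq[OF f i, of x] G[OF i] by simp
        have *: "\<bar>f (tgt e) (x - len e)\<bar> \<le> B" if "e \<in> E i" for e
          using step[of "x - len e"] lmin_le[OF i that] tgt_less[OF i that] by simp
        show ?thesis unfolding eq abs_le_iff
          using average_le[OF i, of "\<lambda>e. f (tgt e) (x - len e)" B]
            average_ge[OF i, of "- B" "\<lambda>e. f (tgt e) (x - len e)"] * 
          by (smt (verit) abs_le_iff)
      qed (use f B0 Bf[OF i] B[OF i] i in \<open>force simp: solution_zero\<close>)+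
    qed
  qed
  then show ?thesis using that by blast
qed

section \<open>Paths and their total delays\<close>

inductive path :: "nat \<Rightarrow> real \<Rightarrow> nat \<Rightarrow> bool" where
  path_refl: "i < n \<Longrightarrow> path i 0 i"
| path_step: "i < n \<Longrightarrow> e \<in> E i \<Longrightarrow> path (tgt e) x l \<Longrightarrow> path i (len e + x) l"

lemma path_source: "path i x l \<Longrightarrow> i < n" by (induction rule: path.induct) auto
lemma path_target: "path i x l \<Longrightarrow> l < n" by (induction rule: path.induct) auto
lemma path_nonneg: "path i x l \<Longrightarrow> x \<ge> 0"
  by (induction rule: path.induct) (auto dest: len_pos)

lemma path_trans: "path i x j \<Longrightarrow> path j y l \<Longrightarrow> path i (x + y) l"
  by (induction rule: path.induct) (auto simp: add.assoc intro: path.intros)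

lemma path_loop: "path i x i \<Longrightarrow> path i (real k * x) i"
proof (induction k)
  case (Suc k)
  then show ?case using path_trans[of i x i "real k * x" i] by (simp add: algebra_simps)
qed (auto intro: path_refl dest: path_source)

text \<open>If \<open>f i t\<close> is close to the bound \<open>C\<close>, then averaging forces \<open>f\<close> to be close to \<open>C\<close> at every earlier time
  reached from \<open>(i, t)\<close> along a path, with a loss depending only on the length of the path.\<close>

lemma path_bound:
  assumes "path i x l" and f: "solution c g f" and G: "\<And>i t. i < n \<Longrightarrow> t > G \<Longrightarrow> g i t = 0"
    and "t - x > G" "\<And>i y. i < n \<Longrightarrow> y \<ge> t - x - lmax \<Longrightarrow> f i y \<le> C"
  shows "f i t \<le> C - pmin powr (x / lmin) * (C - f l (t - x))"
  using assms(1,4,5)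
proof (induction arbitrary: t rule: path.induct)
  case (path_refl i)
  then show ?case using pmin_pos by simp
next
  case (path_step i e x l)
  have x0: "x \<ge> 0" using path_nonneg path_step by blast
  have eq: "f i t = (\<Sum>e\<in>E i. p e * f (tgt e) (t - len e))"
    using solution_eq[OF f path_step(1), of t] G[OF path_step(1)] len_pos[OF path_step(1,2)] x0 path_step.prems(1) by simp
  have le: "f (tgt e') (t - len e') \<le> C" if "e' \<in> E i" for e'
    using tgt_less[OF path_step(1) that] lmax_ge[OF path_step(1) that] len_pos[OF path_step(1,2)] x0
    by (intro path_step.prems(2)) auto
  define fl where "fl = f l (t - (len e + x))"
  have fl: "fl \<le> C" unfolding fl_def using path_target[OF path_step(3)] lmax_pos 
    by (intro path_step.prems(2)) auto
  have IH: "f (tgt e) (t - len e) \<le> C - pmin powr (x / lmin) * (C - fl)"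
    using path_step.IH[of "t - len e"] path_step.prems by (simp add: fl_def algebra_simps)
  \<comment> \<open>A path of length x has at most x / \<open>lmin\<close> edges, each of
    probability at least \<open>pmin\<close>, so \<open>pmin powr (x / lmin)\<close> is a lower
    bound for the probability of the path. A further edge raises the exponent by at least 1.\<close>
  have "pmin powr ((len e + x) / lmin) \<le> pmin powr (1 + x / lmin)"
    using pmin_pos pmin_le_1 lmin_le[OF path_step(1,2)] lmin_pos
    by (intro powr_mono') (auto simp: field_simps)
  also have "\<dots> = pmin * pmin powr (x / lmin)" using pmin_pos by (simp add: powr_add)
  also have "\<dots> \<le> p e * pmin powr (x / lmin)"
    using pmin_le[OF path_step(1,2)] by (intro mult_right_mono) auto
  finally have w: "pmin powr ((len e + x) / lmin) * (C - fl) \<le> p e * pmin powr (x / lmin) * (C - fl)"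
    using fl by (intro mult_right_mono) auto
  have "f i t \<le> C - p e * (C - f (tgt e) (t - len e))"
    unfolding eq by (rule average_split[OF path_step(1,2) le])
  moreover have "p e * (C - f (tgt e) (t - len e)) \<ge> p e * (pmin powr (x / lmin) * (C - fl))"
    using IH p_pos[OF path_step(1,2)] by (intro mult_left_mono) auto
  ultimately show ?case using w by (simp add: fl_def mult.assoc)
qed

end

section \<open>Convergence of solutions in the non-lattice case\<close>

locale nonlattice_renewal = markov_renewal +
  assumes irreducible: "\<And>i l. i < n \<Longrightarrow> l < n \<Longrightarrow> \<exists>x. path i x l"
    and nonlattice: "\<exists>i j t1 t2. path i t1 i \<and> path j t2 j \<and> t1 > 0 \<and> t2 > 0 \<and> t1 / t2 \<notin> \<rat>"
begin

text \<open>A path from i to l may pass through \<open>i1\<close> and \<open>j1\<close>, the base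
  points of the two incommensurable loops, and go round each loop as often as desired. Its length is
  a fixed c1 + c2 + c3 plus a natural combination of t1 and t2. The finiteness of the set of states
  makes R uniform.\<close>

lemma path_lengths_dense:
  assumes "\<epsilon> > 0"
  obtains R where "R > 0" "\<And>i l x. i < n \<Longrightarrow> l < n \<Longrightarrow> x \<ge> R \<Longrightarrow> \<exists>y. path i y l \<and> \<bar>x - y\<bar> \<le> \<epsilon>"
proof -
  obtain i1 j1 t1 t2 where L: "path i1 t1 i1" "path j1 t2 j1" "t1 > 0" "t2 > 0" "t1 / t2 \<notin> \<rat>"
    using nonlattice by blast
  have ev: "\<forall>\<^sub>F x in at_top. \<exists>y. path i y l \<and> \<bar>x - y\<bar> \<le> \<epsilon>" if il: "i < n" "l < n" for i l
  proof -
    obtain c1 where c1: "path i c1 i1" using irreducible il path_source[OF L(1)] by blast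
    obtain c2 where c2: "path i1 c2 j1" using irreducible path_source[OF L(1)] path_source[OF L(2)] by blast
    obtain c3 where c3: "path j1 c3 l" using irreducible il path_source[OF L(2)] by blast
    have "filterlim (\<lambda>x. x + (- (c1 + c2 + c3))) at_top (at_top :: real filter)"
      by (rule filterlim_tendsto_add_at_top[OF tendsto_const filterlim_ident, simplified add.commute])
    then have "\<forall>\<^sub>F x in at_top. \<exists>k m::nat. \<bar>(x + (- (c1 + c2 + c3))) - (real k * t1 + real m * t2)\<bar> \<le> \<epsilon>"
      using nat_combinations_asymptotically_dense[OF L(3,4,5) assms] by (rule eventually_compose_filterlim[rotated])
    then show ?thesis
    proof (rule eventually_mono)
      fix x assume "\<exists>k m::nat. \<bar>(x + (- (c1 + c2 + c3))) - (real k * t1 + real m * t2)\<bar> \<le> \<epsilon>"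
      then obtain k m :: nat where km: "\<bar>(x + (- (c1 + c2 + c3))) - (real k * t1 + real m * t2)\<bar> \<le> \<epsilon>" by blast
      have "path i (c1 + (real k * t1 + (c2 + (real m * t2 + c3)))) l"
        using c1 c2 c3 L path_loop path_trans by meson
      then show "\<exists>y. path i y l \<and> \<bar>x - y\<bar> \<le> \<epsilon>"
        using km by (intro exI[of _ "c1 + (real k * t1 + (c2 + (real m * t2 + c3)))"]) (auto simp: algebra_simps)
    qed
  qed
  have "\<forall>\<^sub>F x in at_top. \<forall>i\<in>{..<n}. \<forall>l\<in>{..<n}. \<exists>y. path i y l \<and> \<bar>x - y\<bar> \<le> \<epsilon>"
    by (subst eventually_ball_finite_distrib, simp, intro ballI, subst eventually_ball_finite_distrib)
      (auto intro: ev)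
  then obtain R where "\<And>x i l. x \<ge> R \<Longrightarrow> i < n \<Longrightarrow> l < n \<Longrightarrow> \<exists>y. path i y l \<and> \<bar>x - y\<bar> \<le> \<epsilon>"
    unfolding eventually_at_top_linorder by (metis lessThan_iff)
  then show ?thesis using that[of "max R 1"] by auto
qed

text \<open>Close to the upper limit \<open>M\<close> of \<open>f\<close> at some late time, \<open>f\<close> is close to \<open>M\<close> at all times reached by paths.
  These are dense in a window longer than every delay, so by uniform continuity \<open>f\<close> is close to \<open>M\<close> on
  that window, and hence forever after.\<close>

theorem solution_converges:
  assumes f: "solution c g f" and G: "\<And>i t. i < n \<Longrightarrow> t > G \<Longrightarrow> g i t = 0"
    and cont: "\<And>i. i < n \<Longrightarrow> continuous_on UNIV (f i)"
  obtains L where "\<And>i. i < n \<Longrightarrow> (f i \<longlongrightarrow> L) at_top"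
proof -
  obtain B where B: "\<And>i x. i < n \<Longrightarrow> \<bar>f i x\<bar> \<le> B" using solution_bounded[OF f G cont] by blast
  \<comment> \<open>The infimum M of the eventual upper bounds is the limit superior of the maximum
    of all \<open>f i\<close>.\<close>
  define U where "U = {m. \<exists>T. \<forall>t\<ge>T. \<forall>i<n. f i t \<le> m}"
  define M where "M = Inf U"
  have n0: "0 < n" using n_pos by simp
  have Une: "U \<noteq> {}" using B unfolding U_def by (auto intro!: exI[of _ B] simp: abs_le_iff)
  have Ubd: "bdd_below U"
  proof (rule bdd_belowI)
    fix m assume "m \<in> U"
    then obtain T where "f 0 T \<le> m" using n0 by (auto simp: U_def)
    then show "- B \<le> m" using B[OF n0, of T] by linarith
  qed
  have upper: "\<exists>T. \<forall>t\<ge>T. \<forall>i<n. f i t \<le> M + \<eta>" if eta: "\<eta> > 0" for \<eta>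
  proof -
    obtain m where "m \<in> U" "m < M + \<eta>"
      using cInf_lessD[OF Une, of "M + \<eta>"] eta M_def by auto
    then show ?thesis unfolding U_def by (smt (verit) mem_Collect_eq)
  qed
  have freq: "\<exists>t\<ge>T. \<exists>i<n. f i t \<ge> M - \<eta>" if "\<eta> > 0" for \<eta> T
  proof (rule ccontr)
    assume "\<not> ?thesis"
    then have "\<forall>t\<ge>T. \<forall>i<n. f i t \<le> M - \<eta>" by (meson less_imp_le not_le)
    then have "M - \<eta> \<in> U" unfolding U_def by blast
    then have "M \<le> M - \<eta>" using cInf_lower Ubd M_def by metis
    then show False using that by simp
  qed
  have lower: "\<exists>T. \<forall>t\<ge>T. \<forall>i<n. M - \<epsilon> \<le> f i t" if eps: "\<epsilon> > 0" for \<epsilon>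
  proof -
    obtain \<delta> where \<delta>: "\<delta> > 0" "\<And>i x y. i < n \<Longrightarrow> \<bar>x - y\<bar> \<le> \<delta> \<Longrightarrow> \<bar>f i x - f i y\<bar> \<le> \<epsilon> / 2"
      by (rule solution_uniformly_continuous[OF f G cont, where \<epsilon> = "\<epsilon> / 2"]) (use eps in auto)
    obtain R where R: "R > 0" "\<And>i l x. i < n \<Longrightarrow> l < n \<Longrightarrow> x \<ge> R \<Longrightarrow> \<exists>y. path i y l \<and> \<bar>x - y\<bar> \<le> \<delta>"
      using path_lengths_dense[OF \<delta>(1)] by metis
    \<comment> \<open>The longest path used: a target in the window {R..R + \<open>lmax\<close>} is
      missed by at most \<delta>.\<close>
    define X where "X = R + lmax + \<delta>"
    define w where "w = pmin powr (X / lmin)"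
    have w: "w > 0" using pmin_pos by (simp add: w_def)
    \<comment> \<open>With C = M + \<eta> and \<open>f i0 t0\<close> >= M - \<eta>, the path bound
      gives w d <= 2 \<eta> = w \<epsilon> / 2, where d is the gap between C and the value at the
      end of the path. So d <= \<epsilon> / 2; the other half of \<epsilon> is spent on uniform
      continuity.\<close>
    define \<eta> where "\<eta> = w * \<epsilon> / 4"
    have eta: "\<eta> > 0" using w eps by (simp add: \<eta>_def)
    obtain T0 where T0: "\<And>t i. t \<ge> T0 \<Longrightarrow> i < n \<Longrightarrow> f i t \<le> M + \<eta>" using upper[OF eta] by blast
    \<comment> \<open>Going back from t0 by a path of length up to X and one more delay still ends
      past \<open>T0\<close>, where M + \<eta> is an upper bound, and past G.\<close>
    obtain t0 i0 where t0: "t0 \<ge> max T0 G + X + lmax + 1" "i0 < n" "f i0 t0 \<ge> M - \<eta>"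
      using freq[OF eta] by blast
    have window: "f l (t0 - x) \<ge> M - \<epsilon>" if l: "l < n" and x: "x \<in> {R..R + lmax}" for l x
    proof -
      obtain y where y: "path i0 y l" "\<bar>x - y\<bar> \<le> \<delta>" using R(2)[OF t0(2) l, of x] x by auto
      have yX: "y \<le> X" using y x by (auto simp: X_def)
      define d where "d = M + \<eta> - f l (t0 - y)"
      have d0: "d \<ge> 0" unfolding d_def using T0[of "t0 - y" l] t0 yX l lmax_pos by auto
      have "f i0 t0 \<le> M + \<eta> - pmin powr (y / lmin) * d"
        unfolding d_def
        by (rule path_bound[OF y(1) f G]) (use t0 yX lmax_pos T0 in auto)
      moreover have "w \<le> pmin powr (y / lmin)"
        unfolding w_def using pmin_pos pmin_le_1 yX lmin_pos by (intro powr_mono') (auto simp: divide_right_mono)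
      then have "w * d \<le> pmin powr (y / lmin) * d" using d0 by (rule mult_right_mono)
      ultimately have "w * d \<le> 2 * \<eta>" using t0(3) by linarith
      then have "w * d \<le> w * (\<epsilon> / 2)" by (simp add: \<eta>_def mult.commute)
      then have "d \<le> \<epsilon> / 2" using w by simp
      then have "f l (t0 - y) \<ge> M - \<epsilon> / 2" using eta unfolding d_def by linarith
      moreover have "\<bar>f l (t0 - x) - f l (t0 - y)\<bar> \<le> \<epsilon> / 2" using y by (intro \<delta>(2)[OF l]) auto
      ultimately show ?thesis by linarith
    qed
    \<comment> \<open>No delay is longer than the window, so after the window each value averages
      values at times no earlier than the start of the window, all of which already satisfy the
      lower bound.\<close>
    have "\<forall>i<n. t \<ge> t0 - R - lmax \<longrightarrow> M - \<epsilon> \<le> f i t" for t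
    proof (induction t rule: delay_induct[where c = "t0 - R - lmax"])
      case (step t)
      show ?case
      proof (intro allI impI)
        fix i assume i: "i < n" and t: "t \<ge> t0 - R - lmax"
        show "M - \<epsilon> \<le> f i t"
        proof (cases "t \<le> t0 - R")
          case True
          then show ?thesis using window[OF i, of "t0 - t"] t by auto
        next
          case False
          then have "g i t = 0" using t0 \<delta> lmax_pos by (intro G[OF i]) (auto simp: X_def)
          then have eq: "f i t = (\<Sum>e\<in>E i. p e * f (tgt e) (t - len e))" using solution_eq[OF f i, of t] by simp
          show ?thesis unfolding eq
          proof (rule average_ge[OF i])
            fix e assume e: "e \<in> E i"
            show "M - \<epsilon> \<le> f (tgt e) (t - len e)"
              using step[of "t - len e"] lmin_le[OF i e] lmax_ge[OF i e] tgt_less[OF i e] False by auto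
          qed
        qed
      qed
    qed auto
    then show ?thesis by blast
  qed
  have "(f i \<longlongrightarrow> M) at_top" if i: "i < n" for i
  proof (rule tendstoI)
    fix \<epsilon> :: real assume eps: "\<epsilon> > 0"
    obtain T1 where T1: "\<And>t i. t \<ge> T1 \<Longrightarrow> i < n \<Longrightarrow> f i t \<le> M + \<epsilon> / 2" using upper[of "\<epsilon> / 2"] eps by auto
    obtain T2 where T2: "\<And>t i. t \<ge> T2 \<Longrightarrow> i < n \<Longrightarrow> M - \<epsilon> / 2 \<le> f i t" using lower[of "\<epsilon> / 2"] eps by auto
    show "\<forall>\<^sub>F t in at_top. dist (f i t) M < \<epsilon>"
      using eventually_ge_at_top[of "max T1 T2"]
    proof eventually_elim
      case (elim t)
      then show ?case using T1[of t i] T2[of t i] eps i unfolding dist_real_def by (auto simp: abs_less_iff)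
    qed
  qed
  then show ?thesis using that by blast
qed

text \<open>The limit is identified by a conservation law: for left invariant \<open>u\<close> the quantity
  \<open>\<Sum>i. u i * (\<Sum>e\<in>E i. p e * integral {T - len e..T} (f (tgt e)))\<close> is independent of \<open>T\<close> once \<open>g\<close> has vanished.\<close>

theorem key_renewal:
  assumes f: "solution c g f" and G: "\<And>i t. i < n \<Longrightarrow> t > G \<Longrightarrow> g i t = 0"
    and contg: "\<And>i. i < n \<Longrightarrow> continuous_on UNIV (g i)"
    and cont: "\<And>i. i < n \<Longrightarrow> continuous_on UNIV (f i)"
    and g0: "\<And>i t. i < n \<Longrightarrow> t < c \<Longrightarrow> g i t = 0"
    and u: "\<And>l. l < n \<Longrightarrow> (\<Sum>i<n. u i * (\<Sum>e | e \<in> E i \<and> tgt e = l. p e)) = u l"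
    and mu: "(\<Sum>i<n. u i * (\<Sum>e\<in>E i. p e * len e)) \<noteq> 0"
    and i: "i < n"
  shows "(f i \<longlongrightarrow> (\<Sum>i<n. u i * integral {c..G} (g i)) / (\<Sum>i<n. u i * (\<Sum>e\<in>E i. p e * len e))) at_top"
proof -
  obtain L where L: "\<And>i. i < n \<Longrightarrow> (f i \<longlongrightarrow> L) at_top" using solution_converges[OF f G cont] by blast
  define \<mu> where "\<mu> = (\<Sum>i<n. u i * (\<Sum>e\<in>E i. p e * len e))"
  \<comment> \<open>Integration starts strictly before c, so that f vanishes on all of {b - s..b},
    including the right end point.\<close>
  define b where "b = c - 1"
  define J where "J l t = integral {b..t} (f l)" for l t
  have intf: "f l integrable_on {x..y}" if "l < n" for l x y
    using cont[OF that] by (intro integrable_continuous_interval) (auto intro: continuous_on_subset)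
  have intg: "g l integrable_on {x..y}" if "l < n" for l x y
    using contg[OF that] by (intro integrable_continuous_interval) (auto intro: continuous_on_subset)
  \<comment> \<open>Left invariance of u: one transition does not change the u-weighted sum of a
    function of the state.\<close>
  have total: "(\<Sum>i<n. u i * (\<Sum>e\<in>E i. p e * X (tgt e))) = (\<Sum>l<n. u l * X l)" for X :: "nat \<Rightarrow> real"
  proof -
    have "(\<Sum>e\<in>E i. p e * X (tgt e)) = (\<Sum>l<n. (\<Sum>e | e \<in> E i \<and> tgt e = l. p e) * X l)" if i: "i < n" for i
    proof -
      have "(\<Sum>e\<in>E i. p e * X (tgt e)) = (\<Sum>l<n. \<Sum>e | e \<in> E i \<and> tgt e = l. p e * X (tgt e))"
        by (rule sum.group[symmetric]) (use finite_E[OF i] tgt_less[OF i] in auto)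
      also have "\<dots> = (\<Sum>l<n. (\<Sum>e | e \<in> E i \<and> tgt e = l. p e) * X l)"
        unfolding sum_distrib_right by (intro sum.cong refl) auto
      finally show ?thesis .
    qed
    then have "(\<Sum>i<n. u i * (\<Sum>e\<in>E i. p e * X (tgt e))) 
      = (\<Sum>i<n. \<Sum>l<n. u i * (\<Sum>e | e \<in> E i \<and> tgt e = l. p e) * X l)"
      by (simp add: sum_distrib_left[of "u _" _ "{..<n}"] mult.assoc)
    also have "\<dots> = (\<Sum>l<n. (\<Sum>i<n. u i * (\<Sum>e | e \<in> E i \<and> tgt e = l. p e)) * X l)"
      by (subst sum.swap) (simp add: sum_distrib_right)
    finally show ?thesis using u by simp
  qed
  have shift: "integral {b..T} (\<lambda>t. f l (t - s)) = J l (T - s)" if "l < n" "s > 0" "T - s \<ge> b" for l s T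
  proof -
    have "integral {b..T} (f l \<circ> (\<lambda>x. x + (- s))) = integral {b + (- s)..T + (- s)} (f l)"
      using cont[OF that(1)] by (intro integral_shift) (auto intro: continuous_on_subset)
    also have "\<dots> = integral {b - s..b} (f l) + integral {b..T - s} (f l)"
      using that intf[OF that(1)] by (subst Henstock_Kurzweil_Integration.integral_combine) auto
    also have "integral {b - s..b} (f l) = integral {b - s..b} (\<lambda>_. 0)"
      using solution_zero[OF f that(1)] by (intro integral_cong) (auto simp: b_def)
    finally show ?thesis by (simp add: J_def o_def)
  qed
  have conserved: "(\<Sum>i<n. u i * (\<Sum>e\<in>E i. p e * integral {T - len e..T} (f (tgt e)))) = (\<Sum>i<n. u i * integral {c..G} (g i))"
    if T: "T \<ge> b + lmax" "T \<ge> G" "T \<ge> c" for T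
  proof -
    have gi: "integral {b..T} (g i) = integral {c..G} (g i)" if i: "i < n" for i
    proof -
      have "integral {b..T} (g i) = integral UNIV (\<lambda>x. if x \<in> {b..T} then g i x else 0)"
        by (simp only: Henstock_Kurzweil_Integration.integral_restrict_UNIV)
      also have "\<dots> = integral UNIV (\<lambda>x. if x \<in> {c..G} then g i x else 0)"
        using g0[OF i] G[OF i] T by (intro integral_cong) (auto simp: b_def not_le)
      also have "\<dots> = integral {c..G} (g i)" by (simp only: Henstock_Kurzweil_Integration.integral_restrict_UNIV)
      finally show ?thesis .
    qed
    have Ji: "J i T = integral {c..G} (g i) + (\<Sum>e\<in>E i. p e * J (tgt e) (T - len e))" if i: "i < n" for i
    proof -
      have "J i T = integral {b..T} (\<lambda>t. g i t + (\<Sum>e\<in>E i. p e * f (tgt e) (t - len e)))"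
        unfolding J_def by (rule integral_cong) (rule solution_eq[OF f i])
      also have "\<dots> = integral {b..T} (g i) + (\<Sum>e\<in>E i. p e * integral {b..T} (\<lambda>t. f (tgt e) (t - len e)))"
      proof -
        have ii: "(\<lambda>t. f (tgt e) (t - len e)) integrable_on {b..T}" if "e \<in> E i" for e
          by (intro integrable_continuous_interval continuous_on_compose2[OF cont[OF tgt_less[OF i that]]]
            continuous_on_diff continuous_on_id continuous_on_const subset_UNIV)
        have ij: "(\<lambda>t. p e * f (tgt e) (t - len e)) integrable_on {b..T}" if "e \<in> E i" for e
          by (rule integrable_on_mult_right) (rule ii[OF that])
        have "integral {b..T} (\<lambda>t. g i t + (\<Sum>e\<in>E i. p e * f (tgt e) (t - len e)))
          = integral {b..T} (g i) + integral {b..T} (\<lambda>t. \<Sum>e\<in>E i. p e * f (tgt e) (t - len e))"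
          by (intro integral_add intg[OF i] integrable_sum finite_E[OF i] ij)
        also have "integral {b..T} (\<lambda>t. \<Sum>e\<in>E i. p e * f (tgt e) (t - len e)) 
          = (\<Sum>e\<in>E i. integral {b..T} (\<lambda>t. p e * f (tgt e) (t - len e)))"
          by (intro integral_sum finite_E[OF i] ij)
        finally show ?thesis by simp
      qed
      also have "(\<Sum>e\<in>E i. p e * integral {b..T} (\<lambda>t. f (tgt e) (t - len e))) = (\<Sum>e\<in>E i. p e * J (tgt e) (T - len e))"
      proof (intro sum.cong refl)
        fix e assume e: "e \<in> E i"
        show "p e * integral {b..T} (\<lambda>t. f (tgt e) (t - len e)) = p e * J (tgt e) (T - len e)"
          using shift[OF tgt_less[OF i e] len_pos[OF i e], of T] lmax_ge[OF i e] T by simp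
      qed
      finally show ?thesis using gi[OF i] by simp
    qed
    have win: "integral {T - len e..T} (f (tgt e)) = J (tgt e) T - J (tgt e) (T - len e)" if "i < n" "e \<in> E i" for i e
    proof -
      have "J (tgt e) (T - len e) + integral {T - len e..T} (f (tgt e)) = J (tgt e) T" unfolding J_def
        by (intro Henstock_Kurzweil_Integration.integral_combine intf[OF tgt_less[OF that]])
          (use lmax_ge[OF that] len_pos[OF that] T in auto)
      then show ?thesis by simp
    qed
    \<comment> \<open>Each window is a difference of primitives. By \<open>total\<close> the terms
      at T sum to the u-weighted sum of the \<open>J i T\<close>, and the integrated equation
      \<open>Ji\<close> cancels this against the terms at T - \<open>len e\<close>, leaving only the
      integrals of g.\<close>
    have "(\<Sum>i<n. u i * (\<Sum>e\<in>E i. p e * integral {T - len e..T} (f (tgt e)))) 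
       = (\<Sum>i<n. u i * (\<Sum>e\<in>E i. p e * J (tgt e) T)) - (\<Sum>i<n. u i * (\<Sum>e\<in>E i. p e * J (tgt e) (T - len e)))"
      unfolding sum_subtractf[symmetric] right_diff_distrib[symmetric]
      by (intro sum.cong refl arg_cong2[where f = "(*)"]) (auto simp: win)
    also have "\<dots> = (\<Sum>i<n. u i * J i T) - (\<Sum>i<n. u i * (\<Sum>e\<in>E i. p e * J (tgt e) (T - len e)))"
      using total[of "\<lambda>l. J l T"] by simp
    also have "\<dots> = (\<Sum>i<n. u i * integral {c..G} (g i))"
      unfolding sum_subtractf[symmetric] right_diff_distrib[symmetric]
      by (intro sum.cong refl arg_cong2[where f = "(*)"]) (auto simp: Ji)
    finally show ?thesis .
  qed
  have lim1: "((\<lambda>T. \<Sum>i<n. u i * (\<Sum>e\<in>E i. p e * integral {T - len e..T} (f (tgt e)))) \<longlongrightarrow>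
      (\<Sum>i<n. u i * (\<Sum>e\<in>E i. p e * (len e * L)))) at_top"
    using L cont len_pos tgt_less by (intro tendsto_sum tendsto_mult tendsto_const integral_window_tendsto) auto
  have muL: "(\<Sum>i<n. u i * (\<Sum>e\<in>E i. p e * (len e * L))) = \<mu> * L"
    by (simp add: \<mu>_def sum_distrib_right mult.assoc)
  have lim2: "((\<lambda>T. \<Sum>i<n. u i * (\<Sum>e\<in>E i. p e * integral {T - len e..T} (f (tgt e)))) \<longlongrightarrow>
      (\<Sum>i<n. u i * integral {c..G} (g i))) at_top"
    by (rule tendsto_eventually, use eventually_ge_at_top[of "max (b + lmax) (max G c)"] in eventually_elim)
      (auto intro: conserved)
  have "\<mu> * L = (\<Sum>i<n. u i * integral {c..G} (g i))"
    using tendsto_unique[OF trivial_limit_at_top_linorder lim1 lim2] muL by simp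
  then have "L = (\<Sum>i<n. u i * integral {c..G} (g i)) / \<mu>" using mu by (simp add: \<mu>_def field_simps)
  then show ?thesis using L[OF i] by (simp add: \<mu>_def)
qed

text \<open>For discontinuous \<open>g\<close> (here: counts, which jump) continuity of \<open>f\<close> is replaced by a sandwich, as
  solutions are monotone in \<open>g\<close>.\<close>

theorem renewal_limit:
  assumes f: "solution c g f"
    and u: "\<And>l. l < n \<Longrightarrow> (\<Sum>i<n. u i * (\<Sum>e | e \<in> E i \<and> tgt e = l. p e)) = u l"
    and mu: "(\<Sum>i<n. u i * (\<Sum>e\<in>E i. p e * len e)) > 0"
    and sandwich: "\<And>\<epsilon>. \<epsilon> > 0 \<Longrightarrow> \<exists>gl gu c' G'. (\<forall>i<n. continuous_on UNIV (gl i) \<and> continuous_on UNIV (gu i) \<and>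
          (\<forall>t. t \<notin> {c'..G'} \<longrightarrow> gl i t = 0 \<and> gu i t = 0) \<and> (\<forall>t. gl i t \<le> g i t \<and> g i t \<le> gu i t)) \<and>
          I - \<epsilon> \<le> (\<Sum>i<n. u i * integral {c'..G'} (gl i)) \<and> (\<Sum>i<n. u i * integral {c'..G'} (gu i)) \<le> I + \<epsilon>"
    and i: "i < n"
  shows "(f i \<longlongrightarrow> I / (\<Sum>i<n. u i * (\<Sum>e\<in>E i. p e * len e))) at_top"
proof (rule tendstoI)
  fix \<epsilon> :: real assume eps: "\<epsilon> > 0"
  define \<mu> where "\<mu> = (\<Sum>i<n. u i * (\<Sum>e\<in>E i. p e * len e))"
  have mu0: "\<mu> > 0" using mu by (simp add: \<mu>_def)
  obtain gl gu c' G' where g: "\<And>i. i < n \<Longrightarrow> continuous_on UNIV (gl i)" "\<And>i. i < n \<Longrightarrow> continuous_on UNIV (gu i)"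
    "\<And>i t. i < n \<Longrightarrow> t \<notin> {c'..G'} \<Longrightarrow> gl i t = 0" "\<And>i t. i < n \<Longrightarrow> t \<notin> {c'..G'} \<Longrightarrow> gu i t = 0"
    "\<And>i t. i < n \<Longrightarrow> gl i t \<le> g i t" "\<And>i t. i < n \<Longrightarrow> g i t \<le> gu i t"
    "I - \<mu> * \<epsilon> / 2 \<le> (\<Sum>i<n. u i * integral {c'..G'} (gl i))" "(\<Sum>i<n. u i * integral {c'..G'} (gu i)) \<le> I + \<mu> * \<epsilon> / 2"
  proof -
    \<comment> \<open>After division by \<mu> this tolerance becomes \<epsilon> / 2, so both
      bounding limits lie strictly within \<epsilon> of the target.\<close>
    have "\<mu> * \<epsilon> / 2 > 0" using mu0 eps by simp
    from sandwich[OF this] obtain gl gu c' G' where *: "\<forall>i<n. continuous_on UNIV (gl i) \<and> continuous_on UNIV (gu i) \<and>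
          (\<forall>t. t \<notin> {c'..G'} \<longrightarrow> gl i t = 0 \<and> gu i t = 0) \<and> (\<forall>t. gl i t \<le> g i t \<and> g i t \<le> gu i t)"
      "I - \<mu> * \<epsilon> / 2 \<le> (\<Sum>i<n. u i * integral {c'..G'} (gl i))" "(\<Sum>i<n. u i * integral {c'..G'} (gu i)) \<le> I + \<mu> * \<epsilon> / 2"
      by blast
    then show ?thesis by (intro that[of gl gu c' G']) auto
  qed
  obtain fl where fl: "solution c' gl fl" "\<And>i. i < n \<Longrightarrow> continuous_on UNIV (fl i)"
    by (rule solution_exists[of c' gl]) (use g(1,3) in auto)
  obtain fu where fu: "solution c' gu fu" "\<And>i. i < n \<Longrightarrow> continuous_on UNIV (fu i)"
    by (rule solution_exists[of c' gu]) (use g(2,4) in auto)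
  have fl_lim: "(fl i \<longlongrightarrow> (\<Sum>i<n. u i * integral {c'..G'} (gl i)) / \<mu>) at_top" unfolding \<mu>_def
    by (rule key_renewal[OF fl(1) _ g(1) fl(2) _ u]) (use mu g(3) i in auto)
  have fu_lim: "(fu i \<longlongrightarrow> (\<Sum>i<n. u i * integral {c'..G'} (gu i)) / \<mu>) at_top" unfolding \<mu>_def
    by (rule key_renewal[OF fu(1) _ g(2) fu(2) _ u]) (use mu g(4) i in auto)
  have "(I / \<mu> - \<epsilon>) * \<mu> < I - \<mu> * \<epsilon> / 2" "I + \<mu> * \<epsilon> / 2 < (I / \<mu> + \<epsilon>) * \<mu>"
    using mu0 eps by (simp_all add: left_diff_distrib distrib_right)
  then have lt: "I / \<mu> - \<epsilon> < (\<Sum>i<n. u i * integral {c'..G'} (gl i)) / \<mu>"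
    "(\<Sum>i<n. u i * integral {c'..G'} (gu i)) / \<mu> < I / \<mu> + \<epsilon>"
    unfolding pos_less_divide_eq[OF mu0] pos_divide_less_eq[OF mu0] using g(7,8) by linarith+
  have "\<forall>\<^sub>F t in at_top. I / \<mu> - \<epsilon> < fl i t" "\<forall>\<^sub>F t in at_top. fu i t < I / \<mu> + \<epsilon>"
    by (rule order_tendstoD(1)[OF fl_lim lt(1)], rule order_tendstoD(2)[OF fu_lim lt(2)])
  then show "\<forall>\<^sub>F t in at_top. dist (f i t) (I / (\<Sum>i<n. u i * (\<Sum>e\<in>E i. p e * len e))) < \<epsilon>"
    unfolding \<mu>_def[symmetric]
  proof eventually_elim
    case (elim t)
    moreover have "fl i t \<le> f i t" "f i t \<le> fu i t"
      by (rule solution_mono[OF fl(1) f g(5) i]; assumption) (rule solution_mono[OF f fu(1) g(6) i]; assumption)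
    ultimately show ?case by (simp add: dist_real_def abs_less_iff)
  qed
qed

end

text \<open>The bounds are k times trapezoids with ramps of width \<delta>, outside {A..B} for the
  upper bound and inside for the lower one. S is only fixed up to its end points, which carry no
  mass.\<close>

lemma interval_indicator_sandwich:
  fixes k :: "real \<Rightarrow> real"
  assumes k: "continuous_on UNIV k" "\<And>t. k t \<ge> 0" and AB: "A \<le> B" and cG: "c \<le> A - 1" "B + 1 \<le> G"
    and S: "{A<..<B} \<subseteq> S" "S \<subseteq> {A..B}" and eps: "\<epsilon> > 0"
  shows "\<exists>kl ku. continuous_on UNIV kl \<and> continuous_on UNIV ku \<and>
     (\<forall>t. t \<notin> {c..G} \<longrightarrow> kl t = 0 \<and> ku t = 0) \<and>
     (\<forall>t. kl t \<le> k t * indicator S t \<and> k t * indicator S t \<le> ku t) \<and>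
     integral {A..B} k - \<epsilon> \<le> integral {c..G} kl \<and> integral {c..G} ku \<le> integral {A..B} k + \<epsilon>"
proof -
  have int: "h integrable_on {x..y}" if "continuous_on UNIV h" for x y and h :: "real \<Rightarrow> real"
    using that by (intro integrable_continuous_interval) (auto intro: continuous_on_subset)
  have "bounded (k ` {A-1..B+1})"
    using k(1) by (intro compact_imp_bounded compact_continuous_image) (auto intro: continuous_on_subset)
  then obtain K0 where K0: "\<And>x. x \<in> {A-1..B+1} \<Longrightarrow> \<bar>k x\<bar> \<le> K0"
    unfolding bounded_iff real_norm_def by blast
  define K where "K = max K0 1"
  have K: "K > 0" "k x \<le> K" if "x \<in> {A-1..B+1}" for x using K0[OF that] by (auto simp: K_def)
  have K0: "K > 0" by (simp add: K_def)
  \<comment> \<open>The factor 2 pays for two ramps, each of integral at most \<delta> K; the cap 1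
    keeps the outer ramps inside {c..G}.\<close>
  define \<delta> where "\<delta> = min 1 (\<epsilon> / (2 * K))"
  have \<delta>: "\<delta> > 0" "\<delta> \<le> 1" "2 * \<delta> * K \<le> \<epsilon>"
    using eps K0 by (auto simp: \<delta>_def min_def field_simps)
  have small: "integral {x..x+\<delta>} k \<le> \<delta> * K" if "A - 1 \<le> x" "x + \<delta> \<le> B + 1" for x
  proof -
    have "integral {x..x+\<delta>} k \<le> integral {x..x+\<delta>} (\<lambda>_. K)"
      using that K(2) by (intro integral_le int[OF k(1)]) auto
    then show ?thesis using \<delta> by simp
  qed
  define ku where "ku t = k t * max 0 (min 1 (1 + min (t - A) (B - t) / \<delta>))" for t
  define kl where "kl t = k t * max 0 (min 1 (min (t - A) (B - t) / \<delta>))" for t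
  have cont: "continuous_on UNIV kl" "continuous_on UNIV ku"
    unfolding kl_def ku_def using k(1) \<delta>(1) by (auto intro!: continuous_intros)
  have ku0: "ku t = 0" if "t \<notin> {A-\<delta>..B+\<delta>}" for t
  proof -
    have "min (t - A) (B - t) \<le> - \<delta>" using that by auto
    then have "1 + min (t - A) (B - t) / \<delta> \<le> 0" using \<delta>(1) by (simp add: field_simps)
    then show ?thesis by (simp add: ku_def)
  qed
  have kl0: "kl t = 0" if "t \<notin> {A<..<B}" for t
  proof -
    have "min (t - A) (B - t) \<le> 0" using that by auto
    then have "min (t - A) (B - t) / \<delta> \<le> 0" using \<delta>(1) by (simp add: field_simps)
    then show ?thesis by (simp add: kl_def)
  qed
  have kul: "0 \<le> ku t" "ku t \<le> k t" "0 \<le> kl t" "kl t \<le> k t" for t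
    using k(2)[of t] mult_left_mono[of _ 1 "k t"] by (auto simp: ku_def kl_def max_def)
  have ku1: "ku t = k t" if "t \<in> {A..B}" for t
  proof -
    have "min (t - A) (B - t) \<ge> 0" using that by auto
    then have "1 + min (t - A) (B - t) / \<delta> \<ge> 1" using \<delta>(1) by (simp add: field_simps)
    then show ?thesis by (simp add: ku_def min_def)
  qed
  have kl1: "kl t = k t" if "t \<in> {A+\<delta>..B-\<delta>}" for t
  proof -
    have "min (t - A) (B - t) \<ge> \<delta>" using that by auto
    then have "min (t - A) (B - t) / \<delta> \<ge> 1" using \<delta>(1) by (simp add: field_simps)
    then show ?thesis by (simp add: kl_def min_def)
  qed
  have "integral {c..G} ku \<le> integral {c..G} (\<lambda>t. if t \<in> {A-\<delta>..B+\<delta>} then k t else 0)"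
  proof (rule integral_le[OF int[OF cont(2)]])
    show "(\<lambda>t. if t \<in> {A - \<delta>..B + \<delta>} then k t else 0) integrable_on {c..G}"
      using int[OF k(1)] cG \<delta> by (subst integrable_restrict_Int) (simp add: Int_absorb2)
    show "ku t \<le> (if t \<in> {A - \<delta>..B + \<delta>} then k t else 0)" if "t \<in> {c..G}" for t
      using ku0[of t] kul(2)[of t] by auto
  qed
  also have "\<dots> = integral {A-\<delta>..B+\<delta>} k"
    using cG \<delta> by (subst Henstock_Kurzweil_Integration.integral_restrict_Int) (simp add: Int_absorb2)
  also have "\<dots> = integral {A-\<delta>..A} k + (integral {A..B} k + integral {B..B+\<delta>} k)"
    using AB \<delta> int[OF k(1)] by (simp add: Henstock_Kurzweil_Integration.integral_combine)
  also have "\<dots> \<le> integral {A..B} k + \<epsilon>"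
    using small[of "A - \<delta>"] small[of B] \<delta> AB by simp
  finally have upper: "integral {c..G} ku \<le> integral {A..B} k + \<epsilon>" .
  have lower: "integral {A..B} k - \<epsilon> \<le> integral {c..G} kl"
  proof (cases "A + \<delta> \<le> B - \<delta>")
    case True
    have "integral {A..B} k = integral {A..A+\<delta>} k + (integral {A+\<delta>..B-\<delta>} k + integral {B-\<delta>..B} k)"
      using True \<delta> int[OF k(1)] by (simp add: Henstock_Kurzweil_Integration.integral_combine)
    also have "\<dots> \<le> integral {A+\<delta>..B-\<delta>} k + \<epsilon>"
      using small[of "A"] small[of "B-\<delta>"] \<delta> True by simp
    also have "integral {A+\<delta>..B-\<delta>} k = integral {c..G} (\<lambda>t. if t \<in> {A+\<delta>..B-\<delta>} then k t else 0)"
      using cG \<delta> by (subst Henstock_Kurzweil_Integration.integral_restrict_Int) (simp add: Int_absorb2)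
    also have "\<dots> \<le> integral {c..G} kl"
    proof (rule integral_le[OF _ int[OF cont(1)]])
      show "(\<lambda>t. if t \<in> {A + \<delta>..B - \<delta>} then k t else 0) integrable_on {c..G}"
        using int[OF k(1)] cG \<delta> by (subst integrable_restrict_Int) (simp add: Int_absorb2)
      show "(if t \<in> {A + \<delta>..B - \<delta>} then k t else 0) \<le> kl t" if "t \<in> {c..G}" for t
        using kl1[of t] kul(3)[of t] by auto
    qed
    finally show ?thesis by simp
  next
    case False
    \<comment> \<open>Here the interval is shorter than its two inner ramps, so its whole integral
      is at most \<epsilon> and nonnegativity of \<open>kl\<close> suffices.\<close>
    have "integral {A..B} k \<le> integral {A..B} (\<lambda>_. K)"
      using K(2) by (intro integral_le int[OF k(1)]) auto
    also have "\<dots> = (B - A) * K" using AB by simp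
    also have "\<dots> \<le> 2 * \<delta> * K" using False K0 by (intro mult_right_mono) auto
    also have "\<dots> \<le> \<epsilon>" by (rule \<delta>(3))
    finally have "integral {A..B} k \<le> \<epsilon>" .
    moreover have "0 \<le> integral {c..G} kl" by (intro integral_nonneg int[OF cont(1)]) (rule kul)
    ultimately show ?thesis by simp
  qed
  have "kl t \<le> k t * indicator S t" "k t * indicator S t \<le> ku t" for t
  proof -
    have "t \<notin> S \<Longrightarrow> t \<notin> {A<..<B}" "t \<in> S \<Longrightarrow> t \<in> {A..B}" using S by blast+
    then show "kl t \<le> k t * indicator S t" "k t * indicator S t \<le> ku t"
      using kl0[of t] kul[of t] ku1[of t] by (auto simp: indicator_def)
  qed
  moreover have "kl t = 0" "ku t = 0" if "t \<notin> {c..G}" for t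
    using that cG \<delta> AB by (intro kl0 ku0; force)+
  ultimately show ?thesis using cont upper lower by (intro exI[of _ kl] exI[of _ ku]) auto
qed

section \<open>Tiles and substitution\<close>

lemma copy_copy: "copy \<alpha> v (copy \<beta> w X) = copy (\<alpha> * \<beta>) (v + \<alpha> *\<^sub>R w) X"
  by (auto simp: copy_def image_image scaleR_add_right add.assoc)

lemma copy_1_0 [simp]: "copy 1 0 X = X"
  by (simp add: copy_def)

lemma copy_Union: "copy \<alpha> v (\<Union>P) = (\<Union>X\<in>P. copy \<alpha> v X)"
  by (auto simp: copy_def)

lemma copy_as_translation: "copy \<alpha> v X = (+) v ` (*\<^sub>R) \<alpha> ` X"
  by (simp add: copy_def image_image)

lemma measure_copy:
  fixes X :: "'a::euclidean_space set"
  shows "measure lebesgue (copy \<alpha> v X) = \<bar>\<alpha>\<bar> ^ DIM('a) * measure lebesgue X"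
  using measure_lebesgue_affine[of \<alpha> v X] by (simp add: copy_def add.commute)

lemma interior_copy:
  fixes X :: "'a::euclidean_space set"
  assumes "\<alpha> \<noteq> 0" shows "interior (copy \<alpha> v X) = copy \<alpha> v (interior X)"
proof -
  have "interior ((*\<^sub>R) \<alpha> ` X) = (*\<^sub>R) \<alpha> ` interior X"
    by (rule interior_injective_linear_image) (use assms in \<open>auto intro: injI\<close>)
  then show ?thesis by (simp only: copy_as_translation interior_translation)
qed

lemma closure_copy:
  fixes X :: "'a::euclidean_space set"
  shows "closure (copy \<alpha> v X) = copy \<alpha> v (closure X)"
  by (simp only: copy_as_translation closure_translation closure_scaleR)

lemma copy_diff:
  assumes "\<alpha> \<noteq> 0" shows "copy \<alpha> v (X - Y) = copy \<alpha> v X - copy \<alpha> v Y"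
  unfolding copy_def by (rule image_set_diff) (use assms in \<open>auto intro: injI\<close>)

lemma frontier_copy:
  fixes X :: "'a::euclidean_space set"
  assumes "\<alpha> \<noteq> 0" shows "frontier (copy \<alpha> v X) = copy \<alpha> v (frontier X)"
  using assms by (simp add: frontier_def closure_copy interior_copy copy_diff)

lemma bounded_copy: "bounded X \<Longrightarrow> bounded (copy \<alpha> v X)"
  unfolding copy_as_translation by (intro bounded_translation bounded_scaling)

lemma copy_inter_copy:
  assumes "\<alpha> \<noteq> 0" shows "copy \<alpha> v X \<inter> copy \<alpha> v Y = copy \<alpha> v (X \<inter> Y)"
  unfolding copy_def by (rule image_Int[symmetric]) (use assms in \<open>auto intro: injI\<close>)

lemma copies_disjoint:
  fixes P :: "'a::euclidean_space set set"
  assumes "pairwise (\<lambda>X Y. disjnt (interior X) (interior Y)) P" "\<alpha> \<noteq> 0"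
  shows "pairwise (\<lambda>X Y. disjnt (interior X) (interior Y)) (copies \<alpha> v P)"
proof (rule pairwiseI)
  fix A B assume "A \<in> copies \<alpha> v P" "B \<in> copies \<alpha> v P" "A \<noteq> B"
  then obtain X Y where XY: "X \<in> P" "Y \<in> P" "A = copy \<alpha> v X" "B = copy \<alpha> v Y" "X \<noteq> Y"
    by (auto simp: copies_def)
  then have "interior X \<inter> interior Y = {}" using assms(1) by (auto simp: pairwise_def disjnt_def)
  then have "copy \<alpha> v (interior X) \<inter> copy \<alpha> v (interior Y) = {}"
    using copy_inter_copy[OF assms(2), of v "interior X" "interior Y"] by (simp add: copy_def)
  then show "disjnt (interior A) (interior B)" using XY assms(2) by (simp add: interior_copy disjnt_def)
qed

lemma tile_lmeasurable: "tile X \<Longrightarrow> X \<in> lmeasurable"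
  unfolding tile_def by (auto intro: measurable_Jordan simp: negligible_iff_null_sets)

lemma tile_copy:
  fixes X :: "'a::euclidean_space set"
  assumes "tile X" "\<alpha> > 0" shows "tile (copy \<alpha> v X)"
proof -
  have "negligible (frontier X)" using assms by (simp add: tile_def negligible_iff_null_sets)
  then have "negligible (copy \<alpha> v (frontier X))" unfolding copy_def
    by (intro negligible_differentiable_image_negligible) (auto intro!: derivative_intros)
  then have n: "negligible (frontier (copy \<alpha> v X))" using assms by (simp add: frontier_copy)
  moreover have b: "bounded (copy \<alpha> v X)" using assms by (simp add: bounded_copy tile_def)
  moreover have "measure lebesgue (copy \<alpha> v X) > 0" using assms by (simp add: measure_copy tile_def)
  ultimately show ?thesis using measurable_Jordan[OF b n] by (auto simp: tile_def negligible_iff_null_sets)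
qed

lemma tile_interior_nonempty:
  assumes "tile X" shows "interior X \<noteq> {}"
proof
  assume "interior X = {}"
  then have "X \<subseteq> frontier X" using closure_subset by (auto simp: frontier_def)
  then have "negligible X" using assms negligible_subset by (auto simp: tile_def negligible_iff_null_sets)
  then show False using assms by (simp add: tile_def negligible_imp_measure0)
qed

lemma tiles_negligible_inter:
  assumes "tile X" "tile Y" "disjnt (interior X) (interior Y)" shows "negligible (X \<inter> Y)"
proof -
  have "X \<inter> Y \<subseteq> frontier X \<union> frontier Y"
    using assms(3) closure_subset unfolding frontier_def disjnt_def by blast
  moreover have "negligible (frontier X \<union> frontier Y)"
    using assms by (intro negligible_Un) (auto simp: tile_def negligible_iff_null_sets)
  ultimately show ?thesis using negligible_subset by blast
qed

lemma tessellation_measure: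
  assumes "tessellation U P" "finite P"
  shows "measure lebesgue U = (\<Sum>X\<in>P. measure lebesgue X)"
proof -
  have "pairwise (\<lambda>X Y. negligible (X \<inter> Y)) P"
  proof (rule pairwiseI)
    fix X Y assume "X \<in> P" "Y \<in> P" "X \<noteq> Y"
    then have "tile X" "tile Y" "disjnt (interior X) (interior Y)"
      using assms(1) by (auto simp: tessellation_def pairwise_def)
    then show "negligible (X \<inter> Y)" by (rule tiles_negligible_inter)
  qed
  then show ?thesis
    using assms measure_negligible_finite_Union[of P] tile_lmeasurable by (auto simp: tessellation_def)
qed

text \<open>Iterating the translation would produce the points x + k v of X for all natural k, and
  these leave every bounded set unless v = 0. This yields uniqueness of the position of a
  tile.\<close>

lemma bounded_translate_eq:
  fixes X :: "'a::real_normed_vector set"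
  assumes "bounded X" "X \<noteq> {}" "(+) v ` X = X" shows "v = 0"
proof (rule ccontr)
  assume v: "v \<noteq> 0"
  obtain x where x: "x \<in> X" using assms by auto
  obtain B where B: "\<And>y. y \<in> X \<Longrightarrow> norm y \<le> B" using assms(1) by (auto simp: bounded_iff)
  have mem: "x + real k *\<^sub>R v \<in> X" for k
  proof (induction k)
    case (Suc k)
    then have "v + (x + real k *\<^sub>R v) \<in> (+) v ` X" by blast
    then show ?case using assms(3) by (simp add: algebra_simps)
  qed (use x in simp)
  obtain k :: nat where k: "real k > (B + norm x) / norm v" using reals_Archimedean2 by blast
  have "real k * norm v \<le> norm (x + real k *\<^sub>R v) + norm x"
    using norm_triangle_ineq4[of "x + real k *\<^sub>R v" x] by simp
  also have "\<dots> \<le> B + norm x" using B[OF mem] by simp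
  finally show False using k v by (simp add: field_simps)
qed

text \<open>The flow without its inflation. In this form it applies to the children of a tile
  wherever they lie, which makes it recursive.\<close>

definition final :: "('a::euclidean_space) scheme \<Rightarrow> 'a set \<Rightarrow> 'a set set" where
  "final \<sigma> X = (subst_step \<sigma> ^^
     (LEAST k. \<forall>Z \<in> (subst_step \<sigma> ^^ k) {X}. measure lebesgue Z \<le> 1)) {X}"

lemma flow_eq_final: "flow \<sigma> t X = final \<sigma> (copy (exp t) 0 X)"
  by (simp add: flow_def final_def)

lemma subst_step_UN: "(subst_step \<sigma> ^^ k) (\<Union>x\<in>A. P x) = (\<Union>x\<in>A. (subst_step \<sigma> ^^ k) (P x))"
proof (induction k)
  case (Suc k)
  have "subst_step \<sigma> (\<Union>x\<in>A. Q x) = (\<Union>x\<in>A. subst_step \<sigma> (Q x))" for Q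
    unfolding subst_step_def by (rule UN_UN_flatten)
  then show ?case by (simp add: Suc)
qed simp

lemma subst_step_fixed:
  assumes "\<forall>Z\<in>P. measure lebesgue Z \<le> 1" shows "subst_step \<sigma> P = P"
  using assms unfolding subst_step_def by force

lemma subst_step_stable:
  assumes "\<forall>Z\<in>(subst_step \<sigma> ^^ k) P. measure lebesgue Z \<le> 1" "k \<le> k'"
  shows "(subst_step \<sigma> ^^ k') P = (subst_step \<sigma> ^^ k) P"
  using assms(2)
proof (induction k' rule: dec_induct)
  case (step m)
  then show ?case using subst_step_fixed[of "(subst_step \<sigma> ^^ k) P"] assms(1) by simp
qed simp

text \<open>Patches of tiles of volume at most 1 are fixed by further steps, so any sufficient
  number of steps gives the same result as the least one.\<close>

lemma final_eq:
  assumes "\<forall>Z\<in>(subst_step \<sigma> ^^ k) {X}. measure lebesgue Z \<le> 1"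
  shows "final \<sigma> X = (subst_step \<sigma> ^^ k) {X}"
proof -
  let ?l = "LEAST k. \<forall>Z \<in> (subst_step \<sigma> ^^ k) {X}. measure lebesgue Z \<le> 1"
  have "\<forall>Z \<in> (subst_step \<sigma> ^^ ?l) {X}. measure lebesgue Z \<le> 1" using assms by (rule LeastI)
  moreover have "?l \<le> k" using assms by (rule Least_le)
  ultimately show ?thesis unfolding final_def by (rule subst_step_stable[symmetric])
qed

section \<open>Normalized schemes: tiles, substitution and the recursion for counts\<close>

locale normalized_scheme =
  fixes \<sigma> :: "('a::euclidean_space) scheme"
  assumes scheme: "multiscale_scheme \<sigma>" and normalized: "normalized \<sigma>"
begin

lemma ntypes_pos: "ntypes \<sigma> \<ge> 1" using scheme by (simp add: multiscale_scheme_def)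

lemma tile_proto: "i < ntypes \<sigma> \<Longrightarrow> tile (proto \<sigma> i)"
  using scheme by (simp add: multiscale_scheme_def)

lemma measure_proto: "i < ntypes \<sigma> \<Longrightarrow> measure lebesgue (proto \<sigma> i) = 1"
  using normalized by (simp add: normalized_def)

lemma distinct_rule: "i < ntypes \<sigma> \<Longrightarrow> distinct (rule \<sigma> i)"
  using scheme by (simp add: multiscale_scheme_def)

lemma rule_entry:
  assumes "i < ntypes \<sigma>" "(l, \<alpha>, w) \<in> set (rule \<sigma> i)"
  shows "l < ntypes \<sigma>" "\<alpha> > 0" "\<alpha> < 1"
  using scheme assms unfolding multiscale_scheme_def by fastforce+

lemma tessellation_rho: "i < ntypes \<sigma> \<Longrightarrow> tessellation (proto \<sigma> i) (rho \<sigma> i)"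
  using scheme by (simp add: multiscale_scheme_def)

lemma proto_nonempty: "i < ntypes \<sigma> \<Longrightarrow> proto \<sigma> i \<noteq> {}"
  using tile_interior_nonempty[OF tile_proto[of i]] interior_empty by metis

lemma measure_copy_proto: "i < ntypes \<sigma> \<Longrightarrow> measure lebesgue (copy x v (proto \<sigma> i)) = \<bar>x\<bar> ^ DIM('a)"
  by (simp add: measure_copy measure_proto)

text \<open>The type is determined because prototiles are not rescaled copies of each other, the
  scale because prototiles have volume 1, and the position because a nonempty bounded set equals
  none of its proper translates.\<close>

lemma copy_proto_inj:
  assumes "copy x v (proto \<sigma> i) = copy y w (proto \<sigma> l)" "i < ntypes \<sigma>" "l < ntypes \<sigma>" "x > 0" "y > 0"
  shows "i = l \<and> x = y \<and> v = w"
proof -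
  have il: "i = l"
  proof (rule ccontr)
    assume ne: "i \<noteq> l"
    have "copy (1 / x) (- (1 / x) *\<^sub>R v) (copy x v (proto \<sigma> i)) = proto \<sigma> i"
      using assms(4) by (simp add: copy_copy)
    then have "proto \<sigma> i = copy (1 / x) (- (1 / x) *\<^sub>R v) (copy y w (proto \<sigma> l))" using assms by simp
    then have "tile_of \<sigma> l (1 / x * y) (proto \<sigma> i)"
      using assms unfolding tile_of_def copy_copy by auto
    then have "has_type \<sigma> l (proto \<sigma> i)" unfolding has_type_def by blast
    then show False using scheme assms ne unfolding multiscale_scheme_def by blast
  qed
  have "x ^ DIM('a) = y ^ DIM('a)"
    using measure_copy_proto[of i x v] measure_copy_proto[of l y w] assms by simp
  then have xy: "x = y" using assms by (simp add: power_eq_iff_eq_base)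
  have "(+) v ` (*\<^sub>R) x ` proto \<sigma> i = (+) w ` (*\<^sub>R) x ` proto \<sigma> i"
    using assms(1) il xy by (simp add: copy_as_translation)
  then have "(+) (v - w) ` ((*\<^sub>R) x ` proto \<sigma> i) = (*\<^sub>R) x ` proto \<sigma> i"
  proof -
    assume *: "(+) v ` (*\<^sub>R) x ` proto \<sigma> i = (+) w ` (*\<^sub>R) x ` proto \<sigma> i"
    have "(+) (v - w) ` ((*\<^sub>R) x ` proto \<sigma> i) = (+) (- w) ` (+) v ` (*\<^sub>R) x ` proto \<sigma> i"
      by (simp add: image_image algebra_simps)
    also have "\<dots> = (*\<^sub>R) x ` proto \<sigma> i" unfolding * by (simp add: image_image)
    finally show ?thesis .
  qed
  moreover have "bounded ((*\<^sub>R) x ` proto \<sigma> i)" using tile_proto[OF assms(2)] by (auto simp: tile_def intro: bounded_scaling)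
  ultimately have "v - w = 0" using bounded_translate_eq proto_nonempty[OF assms(2)] by blast
  then show ?thesis using il xy by simp
qed

lemma tile_of_copy_iff:
  assumes "i < ntypes \<sigma>" "x > 0"
  shows "tile_of \<sigma> j \<alpha> (copy x v (proto \<sigma> i)) \<longleftrightarrow> i = j \<and> \<alpha> = x"
  using copy_proto_inj[of x v i \<alpha> _ j] assms unfolding tile_of_def by blast

lemma has_type_copy_iff:
  assumes "i < ntypes \<sigma>" "x > 0"
  shows "has_type \<sigma> j (copy x v (proto \<sigma> i)) \<longleftrightarrow> i = j"
  unfolding has_type_def by (simp add: tile_of_copy_iff assms)

lemma rule_tiles_inj:
  assumes "i < ntypes \<sigma>" "x > 0"
  shows "inj_on (\<lambda>(l, \<alpha>, w). copy (x * \<alpha>) (v + x *\<^sub>R w) (proto \<sigma> l)) (set (rule \<sigma> i))"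
proof -
  have "l = l' \<and> \<alpha> = \<alpha>' \<and> w = w'"
    if *: "(l, \<alpha>, w) \<in> set (rule \<sigma> i)" "(l', \<alpha>', w') \<in> set (rule \<sigma> i)"
      "copy (x * \<alpha>) (v + x *\<^sub>R w) (proto \<sigma> l) = copy (x * \<alpha>') (v + x *\<^sub>R w') (proto \<sigma> l')"
    for l \<alpha> w l' \<alpha>' w'
    using copy_proto_inj[OF *(3)] rule_entry[OF assms(1) *(1)] rule_entry[OF assms(1) *(2)] assms(2) by auto
  then show ?thesis unfolding inj_on_def by fast
qed

lemma substitute_eq:
  assumes "i < ntypes \<sigma>" "x > 0"
  shows "substitute \<sigma> (copy x v (proto \<sigma> i)) =
    (\<lambda>(l, \<alpha>, w). copy (x * \<alpha>) (v + x *\<^sub>R w) (proto \<sigma> l)) ` set (rule \<sigma> i)"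
proof -
  have "substitute \<sigma> (copy x v (proto \<sigma> i)) = copies x v (rho \<sigma> i)"
    unfolding substitute_def using copy_proto_inj[of x v i _ _ _] assms by blast
  then show ?thesis by (simp add: copies_def rho_def image_image copy_copy case_prod_unfold)
qed

lemma tessellation_substitute:
  assumes "i < ntypes \<sigma>" "x > 0"
  shows "tessellation (copy x v (proto \<sigma> i)) (substitute \<sigma> (copy x v (proto \<sigma> i)))"
proof -
  have eq: "substitute \<sigma> (copy x v (proto \<sigma> i)) = copy x v ` rho \<sigma> i"
    using substitute_eq[OF assms, of v] by (simp add: rho_def image_image copy_copy case_prod_unfold)
  have t: "tessellation (proto \<sigma> i) (rho \<sigma> i)" using tessellation_rho assms by blast
  show ?thesis unfolding tessellation_def eq
  proof (intro conjI)
    show "\<forall>T\<in>copy x v ` rho \<sigma> i. tile T" using t assms by (auto simp: tessellation_def tile_copy)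
    have "\<Union> (copy x v ` rho \<sigma> i) = copy x v (\<Union>(rho \<sigma> i))" by (simp add: copy_Union)
    then show "\<Union> (copy x v ` rho \<sigma> i) = copy x v (proto \<sigma> i)" using t by (simp add: tessellation_def)
    show "pairwise (\<lambda>X Y. disjnt (interior X) (interior Y)) (copy x v ` rho \<sigma> i)"
      using copies_disjoint[of "rho \<sigma> i" x v] t assms by (simp add: tessellation_def copies_def)
  qed
qed

text \<open>The volume of a prototile is 1 and the sum of the volumes of the tiles in its
  tessellation. This is what turns the numbers \<open>\<alpha> ^ DIM('a)\<close> into transition
  probabilities.\<close>

lemma rule_powers_sum:
  assumes "i < ntypes \<sigma>" shows "(\<Sum>(l, \<alpha>, w)\<in>set (rule \<sigma> i). \<alpha> ^ DIM('a)) = 1"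
proof -
  let ?f = "\<lambda>(l, \<alpha>, w). copy (1 * \<alpha>) (0 + 1 *\<^sub>R w) (proto \<sigma> l)"
  have t: "tessellation (proto \<sigma> i) (?f ` set (rule \<sigma> i))"
    using tessellation_substitute[OF assms, of 1 0] substitute_eq[OF assms, of 1 0] by simp
  have "1 = (\<Sum>X\<in>?f ` set (rule \<sigma> i). measure lebesgue X)"
    using tessellation_measure[OF t] measure_proto[OF assms] by simp
  also have "\<dots> = (\<Sum>e\<in>set (rule \<sigma> i). measure lebesgue (?f e))"
    by (rule sum.reindex[OF rule_tiles_inj[OF assms], unfolded o_def]) simp
  also have "\<dots> = (\<Sum>(l, \<alpha>, w)\<in>set (rule \<sigma> i). \<alpha> ^ DIM('a))"
    by (intro sum.cong refl) (auto simp: measure_copy_proto rule_entry[OF assms] abs_of_pos)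
  finally show ?thesis by simp
qed

lemma rule_nonempty: "i < ntypes \<sigma> \<Longrightarrow> set (rule \<sigma> i) \<noteq> {}"
  using rule_powers_sum by force

definition ratios :: "real set" where
  "ratios = (\<Union>i<ntypes \<sigma>. (\<lambda>(l, \<alpha>, w). \<alpha>) ` set (rule \<sigma> i))"

lemma finite_ratios: "finite ratios" by (simp add: ratios_def)

lemma ratios_nonempty: "ratios \<noteq> {}"
  using rule_nonempty[of 0] ntypes_pos unfolding ratios_def by force

lemma ratios_bounds: "\<alpha> \<in> ratios \<Longrightarrow> 0 < \<alpha> \<and> \<alpha> < 1"
  using rule_entry unfolding ratios_def by fastforce

lemma rule_ratio: "i < ntypes \<sigma> \<Longrightarrow> (l, \<alpha>, w) \<in> set (rule \<sigma> i) \<Longrightarrow> \<alpha> \<in> ratios"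
  unfolding ratios_def by force

definition min_ratio :: real where "min_ratio = Min ratios"

lemma min_ratio: "0 < min_ratio" "min_ratio < 1" "\<And>\<alpha>. \<alpha> \<in> ratios \<Longrightarrow> min_ratio \<le> \<alpha>"
  using ratios_bounds finite_ratios ratios_nonempty Min_in[OF finite_ratios ratios_nonempty]
  by (auto simp: min_ratio_def)

text \<open>Induction along the substitution process, which only substitutes tiles of scale \<open>x > 1\<close> and shrinks
  them by a factor bounded away from 1.\<close>

lemma tile_induct [consumes 2, case_names step]:
  assumes "i < ntypes \<sigma>" "x > 0"
    and step: "\<And>i x v. \<lbrakk>i < ntypes \<sigma>; x > 0;
       \<And>l \<alpha> w. x > 1 \<Longrightarrow> (l, \<alpha>, w) \<in> set (rule \<sigma> i) \<Longrightarrow> P l (x * \<alpha>) (v + x *\<^sub>R w)\<rbrakk> \<Longrightarrow> P i x v"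
  shows "P i x v"
proof -
  define r where "r = Max ratios"
  have r: "0 < r" "r < 1" "\<And>\<alpha>. \<alpha> \<in> ratios \<Longrightarrow> \<alpha> \<le> r"
    using ratios_bounds finite_ratios ratios_nonempty Max_in[OF finite_ratios ratios_nonempty]
    by (auto simp: r_def)
  have "\<forall>i x v. i < ntypes \<sigma> \<longrightarrow> x > 0 \<longrightarrow> x * r ^ m \<le> 1 \<longrightarrow> P i x v" for m
  proof (induction m)
    case 0
    show ?case by (intro allI impI, rule step) auto
  next
    case (Suc m)
    show ?case
    proof (intro allI impI)
      fix i and x :: real and v :: 'a
      assume i: "i < ntypes \<sigma>" and x: "x > 0" and r1: "x * r ^ Suc m \<le> 1"
      show "P i x v"
      proof (rule step[OF i x])
        fix l \<alpha> w assume e: "(l, \<alpha>, w) \<in> set (rule \<sigma> i)"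
        have "x * \<alpha> * r ^ m \<le> x * r * r ^ m"
          using r(3)[OF rule_ratio[OF i e]] x r(1) by (intro mult_right_mono mult_left_mono) auto
        then have "x * \<alpha> * r ^ m \<le> 1" using r1 by (simp add: mult.assoc)
        then show "P l (x * \<alpha>) (v + x *\<^sub>R w)"
          using rule_entry[OF i e] x Suc by simp
      qed
    qed
  qed
  moreover obtain m where "r ^ m < 1 / x" using real_arch_pow_inv[of "1 / x" r] r assms by auto
  then have "x * r ^ m \<le> 1" using assms by (simp add: field_simps)
  ultimately show ?thesis using assms by blast
qed

lemma measure_copy_gt_1_iff: "i < ntypes \<sigma> \<Longrightarrow> x > 0 \<Longrightarrow> measure lebesgue (copy x v (proto \<sigma> i)) > 1 \<longleftrightarrow> x > 1"
  using one_less_power[of x "DIM('a)"] power_le_one[of x "DIM('a)"]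
  by (cases "x > 1") (auto simp: measure_copy_proto abs_of_pos)

lemma subst_step_large:
  assumes "i < ntypes \<sigma>" "x > 1"
  shows "(subst_step \<sigma> ^^ Suc k) {copy x v (proto \<sigma> i)} =
    (\<Union>(l, \<alpha>, w)\<in>set (rule \<sigma> i). (subst_step \<sigma> ^^ k) {copy (x * \<alpha>) (v + x *\<^sub>R w) (proto \<sigma> l)})"
proof -
  have "subst_step \<sigma> {copy x v (proto \<sigma> i)} = (\<Union>e\<in>set (rule \<sigma> i). {(\<lambda>(l, \<alpha>, w). copy (x * \<alpha>) (v + x *\<^sub>R w) (proto \<sigma> l)) e})"
    using assms by (simp add: subst_step_def measure_copy_gt_1_iff substitute_eq UNION_singleton_eq_range)
  then show ?thesis unfolding funpow_Suc_right o_apply by (simp only: subst_step_UN case_prod_unfold)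
qed

lemma final_stabilizes:
  assumes "i < ntypes \<sigma>" "x > 0"
  shows "\<exists>k. \<forall>Z \<in> (subst_step \<sigma> ^^ k) {copy x v (proto \<sigma> i)}. measure lebesgue Z \<le> 1"
  using assms
proof (induction i x v rule: tile_induct)
  case (step i x v)
  show ?case
  proof (cases "x > 1")
    case False
    then show ?thesis using step measure_copy_gt_1_iff[of i x v] by (intro exI[of _ 0]) auto
  next
    case True
    define ch where "ch e = (case e of (l, \<alpha>, w) \<Rightarrow> copy (x * \<alpha>) (v + x *\<^sub>R w) (proto \<sigma> l))" for e
    have "\<forall>e\<in>set (rule \<sigma> i). \<exists>k. \<forall>Z \<in> (subst_step \<sigma> ^^ k) {ch e}. measure lebesgue Z \<le> 1"
      using step(3)[OF True] by (auto simp: ch_def)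
    then obtain k where k: "\<And>e. e \<in> set (rule \<sigma> i) \<Longrightarrow> \<forall>Z \<in> (subst_step \<sigma> ^^ k e) {ch e}. measure lebesgue Z \<le> 1" by metis
    define K where "K = (\<Sum>e\<in>set (rule \<sigma> i). k e)"
    have K: "k e \<le> K" if "e \<in> set (rule \<sigma> i)" for e unfolding K_def using that by (intro member_le_sum) auto
    have "\<forall>Z \<in> (subst_step \<sigma> ^^ K) {ch e}. measure lebesgue Z \<le> 1" if "e \<in> set (rule \<sigma> i)" for e
      using subst_step_stable[OF k[OF that] K[OF that]] k[OF that] by simp
    then have "\<forall>Z \<in> (subst_step \<sigma> ^^ Suc K) {copy x v (proto \<sigma> i)}. measure lebesgue Z \<le> 1"
      unfolding subst_step_large[OF step(1) True] by (auto simp: ch_def)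
    then show ?thesis by blast
  qed
qed

text \<open>\<open>FT i x v\<close> is the patch \<open>F\<^sub>t(T)\<close> of a tile \<open>T\<close> of type \<open>i\<close> with \<open>e\<^sup>t T = v + x T\<^sub>i\<close>.\<close>

definition FT :: "nat \<Rightarrow> real \<Rightarrow> 'a \<Rightarrow> 'a set set" where
  "FT i x v = final \<sigma> (copy x v (proto \<sigma> i))"

lemma FT_small: "i < ntypes \<sigma> \<Longrightarrow> x > 0 \<Longrightarrow> x \<le> 1 \<Longrightarrow> FT i x v = {copy x v (proto \<sigma> i)}"
  unfolding FT_def using measure_copy_gt_1_iff[of i x v] final_eq[where k = 0 and X = "copy x v (proto \<sigma> i)"] by auto

text \<open>If k steps finish the parent, so do k + 1 steps. These are one substitution followed by
  k steps on each child, so k steps finish every child as well. The renewal equation for counts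
  comes from this recursion.\<close>

lemma FT_large:
  assumes "i < ntypes \<sigma>" "x > 1"
  shows "FT i x v = (\<Union>(l, \<alpha>, w)\<in>set (rule \<sigma> i). FT l (x * \<alpha>) (v + x *\<^sub>R w))"
proof -
  obtain k where k: "\<forall>Z \<in> (subst_step \<sigma> ^^ k) {copy x v (proto \<sigma> i)}. measure lebesgue Z \<le> 1"
    using final_stabilizes assms by force
  then have k': "\<forall>Z \<in> (subst_step \<sigma> ^^ Suc k) {copy x v (proto \<sigma> i)}. measure lebesgue Z \<le> 1"
    using subst_step_stable[OF k, of "Suc k"] by simp
  have ch: "FT l (x * \<alpha>) (v + x *\<^sub>R w) = (subst_step \<sigma> ^^ k) {copy (x * \<alpha>) (v + x *\<^sub>R w) (proto \<sigma> l)}"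
    if "(l, \<alpha>, w) \<in> set (rule \<sigma> i)" for l \<alpha> w
    unfolding FT_def using k' that unfolding subst_step_large[OF assms] by (intro final_eq) blast
  show ?thesis unfolding FT_def[of i] final_eq[OF k'] subst_step_large[OF assms] using ch by auto
qed

lemma FT_large_memberE:
  assumes "Z \<in> FT i x v" "i < ntypes \<sigma>" "x > 1"
  obtains l \<alpha> w where "(l, \<alpha>, w) \<in> set (rule \<sigma> i)" "Z \<in> FT l (x * \<alpha>) (v + x *\<^sub>R w)"
  using assms(1) unfolding FT_large[OF assms(2,3)] by auto

lemma FT_large_memberI:
  assumes "(l, \<alpha>, w) \<in> set (rule \<sigma> i)" "Z \<in> FT l (x * \<alpha>) (v + x *\<^sub>R w)" "i < ntypes \<sigma>" "x > 1"
  shows "Z \<in> FT i x v"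
  unfolding FT_large[OF assms(3,4)] using assms(1,2) by auto

text \<open>Only tiles of scale above 1 are divided, so a tile created by a division has scale above
  \<open>min_ratio\<close>; the minimum with x covers a tile that is never divided.\<close>

lemma FT_tile_cases:
  assumes "i < ntypes \<sigma>" "x > 0" "Z \<in> FT i x v"
  obtains l y w where "l < ntypes \<sigma>" "0 < y" "y \<le> 1" "min x min_ratio \<le> y" "y \<le> x"
    "Z = copy y w (proto \<sigma> l)"
proof -
  have "\<forall>Z\<in>FT i x v. \<exists>l y w. l < ntypes \<sigma> \<and> 0 < y \<and> y \<le> 1 \<and> min x min_ratio \<le> y \<and> y \<le> x \<and> Z = copy y w (proto \<sigma> l)"
    using assms(1,2)
  proof (induction i x v rule: tile_induct)
    case (step i x v)
    show ?case
    proof (cases "x > 1")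
      case False
      then show ?thesis using step(1,2) by (auto simp: FT_small intro!: exI[of _ i] exI[of _ x] exI[of _ v])
    next
      case True
      show ?thesis
      proof
        fix Z assume "Z \<in> FT i x v"
        then obtain l \<alpha> w where e: "(l, \<alpha>, w) \<in> set (rule \<sigma> i)" "Z \<in> FT l (x * \<alpha>) (v + x *\<^sub>R w)"
          using FT_large_memberE step(1) True by metis
        then obtain l' y w' where y: "l' < ntypes \<sigma>" "0 < y" "y \<le> 1" "min (x * \<alpha>) min_ratio \<le> y" "y \<le> x * \<alpha>"
            "Z = copy y w' (proto \<sigma> l')"
          using step(3)[OF True e(1)] by blast
        have al: "min_ratio \<le> \<alpha>" "0 < \<alpha>" "\<alpha> < 1"
          using min_ratio(3) rule_ratio[OF step(1) e(1)] rule_entry[OF step(1) e(1)] by auto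
        then have "\<alpha> \<le> x * \<alpha>" "x * \<alpha> \<le> x" using True by (auto simp: mult_le_cancel_right1 mult_le_cancel_left1)
        then show "\<exists>l y w. l < ntypes \<sigma> \<and> 0 < y \<and> y \<le> 1 \<and> min x min_ratio \<le> y \<and> y \<le> x \<and> Z = copy y w (proto \<sigma> l)"
        proof -
          assume "\<alpha> \<le> x * \<alpha>" "x * \<alpha> \<le> x"
          moreover from this have "min_ratio \<le> x * \<alpha>" using al by linarith
          ultimately have "min x min_ratio \<le> y" "y \<le> x" using y by auto
          then show ?thesis using y by blast
        qed
      qed
    qed
  qed
  then show ?thesis using assms(3) that by blast
qed

lemma finite_FT: "i < ntypes \<sigma> \<Longrightarrow> x > 0 \<Longrightarrow> finite (FT i x v)"
proof (induction i x v rule: tile_induct)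
  case (step i x v)
  then show ?case by (cases "x > 1") (auto simp: FT_small FT_large)
qed

lemma FT_tessellation: "i < ntypes \<sigma> \<Longrightarrow> x > 0 \<Longrightarrow> tessellation (copy x v (proto \<sigma> i)) (FT i x v)"
proof (induction i x v rule: tile_induct)
  case (step i x v)
  show ?case
  proof (cases "x > 1")
    case False
    then show ?thesis using step tile_copy[OF tile_proto[OF step(1)] step(2)]
      by (simp add: FT_small tessellation_def)
  next
    case True
    define ch where "ch e = (case e of (l, \<alpha>, w) \<Rightarrow> copy (x * \<alpha>) (v + x *\<^sub>R w) (proto \<sigma> l))" for e
    define ft where "ft e = (case e of (l, \<alpha>, w) \<Rightarrow> FT l (x * \<alpha>) (v + x *\<^sub>R w))" for e
    have FT: "FT i x v = (\<Union>e\<in>set (rule \<sigma> i). ft e)"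
      using FT_large[OF step(1) True] by (simp add: ft_def)
    have parent: "tessellation (copy x v (proto \<sigma> i)) (ch ` set (rule \<sigma> i))"
      using tessellation_substitute[OF step(1,2)] substitute_eq[OF step(1,2)] by (simp add: ch_def)
    have child: "tessellation (ch e) (ft e)" if "e \<in> set (rule \<sigma> i)" for e
      using step(3)[OF True] that by (auto simp: ch_def ft_def split: prod.split)
    show ?thesis unfolding tessellation_def FT
    proof (intro conjI)
      show "\<forall>T\<in>\<Union> (ft ` set (rule \<sigma> i)). tile T" using child by (auto simp: tessellation_def)
      have "\<Union> (\<Union> (ft ` set (rule \<sigma> i))) = \<Union> (ch ` set (rule \<sigma> i))"
      proof -
        have "\<Union> (\<Union> (ft ` set (rule \<sigma> i))) = (\<Union>e\<in>set (rule \<sigma> i). \<Union> (ft e))" by blast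
        then show ?thesis using child by (simp add: tessellation_def)
      qed
      then show "\<Union> (\<Union> (ft ` set (rule \<sigma> i))) = copy x v (proto \<sigma> i)" using parent by (simp add: tessellation_def)
      show "pairwise (\<lambda>X Y. disjnt (interior X) (interior Y)) (\<Union> (ft ` set (rule \<sigma> i)))"
      proof (rule pairwiseI)
        fix A B assume "A \<in> \<Union> (ft ` set (rule \<sigma> i))" "B \<in> \<Union> (ft ` set (rule \<sigma> i))" and ne: "A \<noteq> B"
        then obtain e e' where e: "e \<in> set (rule \<sigma> i)" "A \<in> ft e" "e' \<in> set (rule \<sigma> i)" "B \<in> ft e'" by blast
        show "disjnt (interior A) (interior B)"
        proof (cases "ch e = ch e'")
          case True
          have "e = e'"
            using rule_tiles_inj[OF step(1,2), of v] True e unfolding inj_on_def ch_def by blast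
          then show ?thesis using child[OF e(1)] e ne by (auto simp: tessellation_def pairwise_def)
        next
          case False
          then have "disjnt (interior (ch e)) (interior (ch e'))"
            using parent e by (auto simp: tessellation_def pairwise_def)
          moreover have "interior A \<subseteq> interior (ch e)" "interior B \<subseteq> interior (ch e')"
            using child[OF e(1)] child[OF e(3)] e by (auto simp: tessellation_def intro!: interior_mono)
          ultimately show ?thesis unfolding disjnt_def by blast
        qed
      qed
    qed
  qed
qed

text \<open>Inflation by c >= 1 undoes no division: a tile divided at scale x is also divided at
  scale c x. The substitution of the inflated tile therefore passes through the inflated version of
  every tile of the original patch.\<close>

lemma FT_semiflow:
  assumes "i < ntypes \<sigma>" "x > 0" "c \<ge> 1" "l < ntypes \<sigma>" "y > 0" "copy y w (proto \<sigma> l) \<in> FT i x v"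
  shows "FT l (c * y) (c *\<^sub>R w) \<subseteq> FT i (c * x) (c *\<^sub>R v)"
  using assms(1,2,6)
proof (induction i x v rule: tile_induct)
  case (step i x v)
  show ?case
  proof (cases "x > 1")
    case False
    then have "copy y w (proto \<sigma> l) = copy x v (proto \<sigma> i)" using step by (simp add: FT_small)
    then show ?thesis using copy_proto_inj[of y w l x v i] step(1,2) assms by simp
  next
    case True
    then obtain l' \<alpha> w' where e: "(l', \<alpha>, w') \<in> set (rule \<sigma> i)" "copy y w (proto \<sigma> l) \<in> FT l' (x * \<alpha>) (v + x *\<^sub>R w')"
      using FT_large_memberE[OF step.prems step(1)] by metis
    have cx: "c * x > 1" using True assms(3) by (metis less_1_mult less_eq_real_def mult_1)
    have "FT l (c * y) (c *\<^sub>R w) \<subseteq> FT l' (c * (x * \<alpha>)) (c *\<^sub>R (v + x *\<^sub>R w'))"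
      using step(3)[OF True e(1) e(2)] .
    then have "FT l (c * y) (c *\<^sub>R w) \<subseteq> FT l' (c * x * \<alpha>) (c *\<^sub>R v + (c * x) *\<^sub>R w')"
      by (simp add: mult.assoc scaleR_add_right)
    then show ?thesis using FT_large_memberI[OF e(1) _ step(1) cx] by blast
  qed
qed

lemma count_FT_small:
  assumes "i < ntypes \<sigma>" "x > 0" "x \<le> 1"
  shows "count_tiles \<sigma> j a b (FT i x v) = (if i = j \<and> a \<le> x \<and> x \<le> b then 1 else 0)"
proof -
  have "{X \<in> FT i x v. \<exists>\<alpha>\<in>{a..b}. tile_of \<sigma> j \<alpha> X} = (if i = j \<and> a \<le> x \<and> x \<le> b then {copy x v (proto \<sigma> i)} else {})"
    using assms by (auto simp: FT_small tile_of_copy_iff)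
  then show ?thesis by (simp add: count_tiles_def)
qed

lemma count_FT_large:
  assumes "i < ntypes \<sigma>" "x > 1"
  shows "count_tiles \<sigma> j a b (FT i x v) =
    (\<Sum>(l, \<alpha>, w)\<in>set (rule \<sigma> i). count_tiles \<sigma> j a b (FT l (x * \<alpha>) (v + x *\<^sub>R w)))"
proof -
  define ft where "ft e = (case e of (l, \<alpha>, w) \<Rightarrow> FT l (x * \<alpha>) (v + x *\<^sub>R w))" for e
  define ch where "ch e = (case e of (l, \<alpha>, w) \<Rightarrow> copy (x * \<alpha>) (v + x *\<^sub>R w) (proto \<sigma> l))" for e
  have x0: "x > 0" using assms by simp
  have FT: "FT i x v = (\<Union>e\<in>set (rule \<sigma> i). ft e)"
    using FT_large[OF assms] by (simp add: ft_def)
  have child: "tessellation (ch e) (ft e)" "finite (ft e)" if "e \<in> set (rule \<sigma> i)" for e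
    using FT_tessellation finite_FT rule_entry[OF assms(1)] x0 that by (auto simp: ch_def ft_def split: prod.split)
  have parent: "tessellation (copy x v (proto \<sigma> i)) (ch ` set (rule \<sigma> i))"
    using tessellation_substitute[OF assms(1) x0] substitute_eq[OF assms(1) x0] by (simp add: ch_def)
  \<comment> \<open>Counts add up only if no tile is shared. A shared tile would have its nonempty
    interior inside two children whose interiors are disjoint.\<close>
  have disj: "ft e \<inter> ft e' = {}" if e: "e \<in> set (rule \<sigma> i)" "e' \<in> set (rule \<sigma> i)" "e \<noteq> e'" for e e'
  proof (rule ccontr)
    assume "ft e \<inter> ft e' \<noteq> {}"
    then obtain A where A: "A \<in> ft e" "A \<in> ft e'" by auto
    have "ch e \<noteq> ch e'"
      using inj_onD[OF rule_tiles_inj[OF assms(1) x0, of v], of e e'] e by (auto simp: ch_def)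
    then have "disjnt (interior (ch e)) (interior (ch e'))"
      using parent e by (auto simp: tessellation_def pairwise_def)
    moreover have "interior A \<subseteq> interior (ch e)" "interior A \<subseteq> interior (ch e')"
      using child(1)[OF e(1)] child(1)[OF e(2)] A by (auto simp: tessellation_def intro!: interior_mono)
    ultimately have "interior A = {}" unfolding disjnt_def by blast
    then show False using child(1)[OF e(1)] A tile_interior_nonempty by (auto simp: tessellation_def)
  qed
  have "count_tiles \<sigma> j a b (FT i x v) = card (\<Union>e\<in>set (rule \<sigma> i). {X \<in> ft e. \<exists>\<alpha>\<in>{a..b}. tile_of \<sigma> j \<alpha> X})"
    unfolding count_tiles_def FT by (rule arg_cong[where f = card]) auto
  also have "\<dots> = (\<Sum>e\<in>set (rule \<sigma> i). card {X \<in> ft e. \<exists>\<alpha>\<in>{a..b}. tile_of \<sigma> j \<alpha> X})"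
    using child(2) disj by (intro card_UN_disjoint) fastforce+
  finally show ?thesis by (simp add: ft_def count_tiles_def case_prod_unfold)
qed

definition cnt :: "nat \<Rightarrow> real \<Rightarrow> real \<Rightarrow> nat \<Rightarrow> real \<Rightarrow> nat" where
  "cnt j a b i x = count_tiles \<sigma> j a b (FT i x 0)"

lemma count_FT: "i < ntypes \<sigma> \<Longrightarrow> x > 0 \<Longrightarrow> count_tiles \<sigma> j a b (FT i x v) = cnt j a b i x"
proof -
  have "\<forall>v'. count_tiles \<sigma> j a b (FT i x v) = count_tiles \<sigma> j a b (FT i x v')" if "i < ntypes \<sigma>" "x > 0"
    using that
  proof (induction i x v rule: tile_induct)
    case (step i x v)
    show ?case
    proof (cases "x > 1")
      case False
      then show ?thesis using step by (simp add: count_FT_small)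
    next
      case True
      show ?thesis unfolding count_FT_large[OF step(1) True]
        using step(3)[OF True] by (intro allI sum.cong refl) auto
    qed
  qed
  then show "i < ntypes \<sigma> \<Longrightarrow> x > 0 \<Longrightarrow> ?thesis" unfolding cnt_def by blast
qed

lemma cnt_small: "i < ntypes \<sigma> \<Longrightarrow> x > 0 \<Longrightarrow> x \<le> 1 \<Longrightarrow> cnt j a b i x = (if i = j \<and> a \<le> x \<and> x \<le> b then 1 else 0)"
  by (simp add: cnt_def count_FT_small)

lemma cnt_large:
  assumes "i < ntypes \<sigma>" "x > 1"
  shows "cnt j a b i x = (\<Sum>(l, \<alpha>, w)\<in>set (rule \<sigma> i). cnt j a b l (x * \<alpha>))"
  unfolding cnt_def[of _ _ _ i] count_FT_large[OF assms]
  using assms rule_entry[OF assms(1)] by (intro sum.cong refl) (auto simp: count_FT split: prod.split)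

end

section \<open>The renewal process of a scheme\<close>

sublocale normalized_scheme \<subseteq> R: markov_renewal "ntypes \<sigma>" "\<lambda>i. set (rule \<sigma> i)" fst
    "\<lambda>(l, \<alpha>, w). \<alpha> ^ DIM('a)" "\<lambda>(l, \<alpha>, w). - ln \<alpha>"
proof unfold_locales
  show "1 \<le> ntypes \<sigma>" by (rule ntypes_pos)
next
  fix i assume i: "i < ntypes \<sigma>"
  show "finite (set (rule \<sigma> i))" by simp
  show "(\<Sum>e\<in>set (rule \<sigma> i). case e of (l, \<alpha>, w) \<Rightarrow> \<alpha> ^ DIM('a)) = 1"
    using rule_powers_sum[OF i] by simp
  fix e assume e: "e \<in> set (rule \<sigma> i)"
  obtain l \<alpha> w where lw: "e = (l, \<alpha>, w)" by (cases e)
  show "fst e < ntypes \<sigma>" "0 < (case e of (l, \<alpha>, w) \<Rightarrow> \<alpha> ^ DIM('a))" "0 < (case e of (l, \<alpha>, w) \<Rightarrow> - ln \<alpha>)"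
    using rule_entry[of i l \<alpha> w] i e lw by auto
qed

context normalized_scheme
begin

text \<open>Along the ancestors of a tile the scale is multiplied by one constant of substitution
  per division; logarithms turn the product into the total delay of a path.\<close>

lemma FT_path:
  assumes "i < ntypes \<sigma>" "x > 0" "l < ntypes \<sigma>" "y > 0" "copy y w (proto \<sigma> l) \<in> FT i x v"
  shows "R.path i (ln x - ln y) l"
  using assms(1,2,5)
proof (induction i x v rule: tile_induct)
  case (step i x v)
  show ?case
  proof (cases "x > 1")
    case False
    then have "copy y w (proto \<sigma> l) = copy x v (proto \<sigma> i)" using step by (simp add: FT_small)
    then show ?thesis using copy_proto_inj[of y w l x v i] step(1,2) assms R.path_refl by simp
  next
    case True
    then obtain l' \<alpha> w' where e: "(l', \<alpha>, w') \<in> set (rule \<sigma> i)" "copy y w (proto \<sigma> l) \<in> FT l' (x * \<alpha>) (v + x *\<^sub>R w')"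
      using FT_large_memberE[OF step.prems step(1)] by metis
    have "R.path l' (ln (x * \<alpha>) - ln y) l" using step(3)[OF True e] .
    then have "R.path i ((case (l', \<alpha>, w') of (l, \<alpha>, w) \<Rightarrow> - ln \<alpha>) + (ln (x * \<alpha>) - ln y)) l"
      using R.path_step[OF step(1) e(1)] by simp
    then show ?thesis using rule_entry[OF step(1) e(1)] True by (simp add: ln_mult)
  qed
qed

lemma flow_proto: "flow \<sigma> t (proto \<sigma> i) = FT i (exp t) 0"
  by (simp add: flow_eq_final FT_def)

text \<open>By normalization a tile of unit volume has scale 1, whose logarithm vanishes, so the
  closed path has length exactly t.\<close>

lemma return_time_path:
  assumes "return_time \<sigma> i t" "i < ntypes \<sigma>" shows "R.path i t i"
proof -
  obtain X where X: "X \<in> FT i (exp t) 0" "has_type \<sigma> i X" "measure lebesgue X = 1"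
    using assms(1) unfolding return_time_def flow_proto by blast
  obtain l y w where y: "l < ntypes \<sigma>" "0 < y" "X = copy y w (proto \<sigma> l)"
    by (rule FT_tile_cases[OF assms(2) _ X(1)]) auto
  have "l = i" using X(2) y by (simp add: has_type_copy_iff)
  moreover have "y ^ DIM('a) = 1" using X(3) y by (simp add: measure_copy_proto)
  then have "y = 1" using y(2) power_eq_iff_eq_base[of "DIM('a)" y 1] by simp
  ultimately show ?thesis using FT_path[of i "exp t" i 1 w 0] X(1) y by simp
qed

end

locale mixing_scheme = normalized_scheme +
  assumes irreducible_sch: "irreducible_scheme \<sigma>" and incommensurable_sch: "incommensurable \<sigma>"

sublocale mixing_scheme \<subseteq> R: nonlattice_renewal "ntypes \<sigma>" "\<lambda>i. set (rule \<sigma> i)" fst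
    "\<lambda>(l, \<alpha>, w). \<alpha> ^ DIM('a)" "\<lambda>(l, \<alpha>, w). - ln \<alpha>"
proof unfold_locales
  fix i l assume il: "i < ntypes \<sigma>" "l < ntypes \<sigma>"
  then obtain t X where X: "X \<in> FT i (exp t) 0" "has_type \<sigma> l X"
    using irreducible_sch unfolding irreducible_scheme_def flow_proto by blast
  obtain l' y w where y: "l' < ntypes \<sigma>" "0 < y" "X = copy y w (proto \<sigma> l')"
    by (rule FT_tile_cases[OF il(1) _ X(1)]) auto
  have "l' = l" using X(2) y by (simp add: has_type_copy_iff)
  then show "\<exists>x. R.path i x l" using FT_path[of i "exp t" l y w 0] X(1) y il by auto
next
  show "\<exists>i j t1 t2. R.path i t1 i \<and> R.path j t2 j \<and> 0 < t1 \<and> 0 < t2 \<and> t1 / t2 \<notin> \<rat>"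
  proof -
    obtain i j t1 t2 where *: "i < ntypes \<sigma>" "j < ntypes \<sigma>" "return_time \<sigma> i t1" "return_time \<sigma> j t2" "t1 / t2 \<notin> \<rat>"
      using incommensurable_sch unfolding incommensurable_def by blast
    then show ?thesis using return_time_path[OF *(3,1)] return_time_path[OF *(4,2)]
      unfolding return_time_def by blast
  qed
qed

context mixing_scheme
begin

definition mean_len :: "(nat \<Rightarrow> real) \<Rightarrow> real" where
  "mean_len u = (\<Sum>i<ntypes \<sigma>. u i * (\<Sum>(l, \<alpha>, w)\<in>set (rule \<sigma> i). \<alpha> ^ DIM('a) * - ln \<alpha>))"

text \<open>The normalized counts \<open>f i t = e\<^sup>-\<^sup>d\<^sup>t cnt j a b i (e\<^sup>t)\<close>, cut off to 0 for \<open>t \<le> 0\<close>, solve a renewal equation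
  in which \<open>g i t\<close> accounts for the children that are tiles of the final patch already.\<close>

lemma cnt_limit:
  fixes u :: "nat \<Rightarrow> real"
  assumes u: "\<And>l. l < ntypes \<sigma> \<Longrightarrow> (\<Sum>i<ntypes \<sigma>. u i * (\<Sum>(l', \<alpha>, w) | (l', \<alpha>, w) \<in> set (rule \<sigma> i) \<and> l' = l. \<alpha> ^ DIM('a))) = u l"
    and u0: "\<And>i. i < ntypes \<sigma> \<Longrightarrow> u i \<ge> 0" and mu: "mean_len u > 0"
    and ab: "0 \<le> a" "a < b" "b \<le> 1" and i: "i < ntypes \<sigma>"
  shows "((\<lambda>t. exp (- real DIM('a) * t) * real (cnt j a b i (exp t))) \<longlongrightarrow>
    (\<Sum>i<ntypes \<sigma>. u i * (1 / real DIM('a) * (\<Sum>(l, \<alpha>, w) | (l, \<alpha>, w) \<in> set (rule \<sigma> i) \<and> l = j.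
       \<alpha> ^ DIM('a) * (max a \<alpha> powi (- int DIM('a)) - max b \<alpha> powi (- int DIM('a)))))) / mean_len u) at_top"
proof -
  define d where "d = real DIM('a)"
  have d0: "d > 0" by (simp add: d_def)
  define n where "n = ntypes \<sigma>"
  define Ej where "Ej i = {(l, \<alpha>, w). (l, \<alpha>, w) \<in> set (rule \<sigma> i) \<and> l = j}" for i
  define rat :: "nat \<times> real \<times> 'a \<Rightarrow> real" where "rat = (\<lambda>(l, \<alpha>, w). \<alpha>)"
  \<comment> \<open>The times at which the parent has been divided while its child of ratio \<alpha>
    has scale in {a..b}. As b <= 1, such a child is not divided.\<close>
  define S where "S \<alpha> = {t. t > 0 \<and> a \<le> exp t * \<alpha> \<and> exp t * \<alpha> \<le> b}" for \<alpha>
  define k where "k t = exp (- d * t)" for t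
  define f where "f i t = (if t \<le> 0 then 0 else k t * real (cnt j a b i (exp t)))" for i t
  define g where "g i t = (\<Sum>e\<in>Ej i. k t * indicator (S (rat e)) t)" for i t
  have rat: "0 < rat e" "rat e < 1" "- ln (rat e) \<le> R.lmax" if "e \<in> Ej i" "i < n" for e i
    using that rule_entry[of i] R.lmax_ge[of i e] by (auto simp: Ej_def rat_def n_def)
  have finE: "finite (Ej i)" for i
    by (rule finite_subset[of _ "set (rule \<sigma> i)"]) (auto simp: Ej_def)
  have sol: "R.solution 0 g f"
    unfolding R.solution_def unfolding n_def[symmetric]
  proof (intro allI impI conjI)
    fix i t assume i: "i < n"
    show "f i t = 0" if "t < 0" using that by (simp add: f_def)
    show "f i t = g i t + (\<Sum>e\<in>set (rule \<sigma> i). (case e of (l, \<alpha>, w) \<Rightarrow> \<alpha> ^ DIM('a)) * f (fst e) (t - (case e of (l, \<alpha>, w) \<Rightarrow> - ln \<alpha>)))"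
    proof (cases "t \<le> 0")
      case True
      have "f (fst e) (t - (case e of (l, \<alpha>, w) \<Rightarrow> - ln \<alpha>)) = 0" if "e \<in> set (rule \<sigma> i)" for e
        using R.len_pos[of i e] True i that by (simp add: f_def n_def)
      moreover have "g i t = 0" using True by (auto simp: g_def S_def)
      ultimately show ?thesis using True by (simp add: f_def)
    next
      case False
      then have t: "exp t > 1" "t > 0" by auto
      \<comment> \<open>Exactly one of two terms can contribute. A child of scale at most 1 is a
        final tile, counted by the indicator, and \<open>f l\<close> is cut off there; a child of
        larger scale lies outside \<open>S \<alpha>\<close> and is counted by \<open>f l\<close> at
        its own, delayed time. The value 0 of f at time 0 avoids counting a child of scale exactly 1
        twice.\<close>
      have count_child: "k t * real (cnt j a b l (exp t * \<alpha>)) =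
          (if l = j then k t * indicator (S \<alpha>) t else 0) + \<alpha> ^ DIM('a) * f l (t + ln \<alpha>)"
        if e: "(l, \<alpha>, w) \<in> set (rule \<sigma> i)" for l \<alpha> w
      proof -
        have \<alpha>: "0 < \<alpha>" "\<alpha> < 1" and l: "l < ntypes \<sigma>" using rule_entry[OF i[unfolded n_def] e] by auto
        have ex: "exp (t + ln \<alpha>) = exp t * \<alpha>" using \<alpha> by (simp add: exp_add)
        show ?thesis
        proof (cases "t + ln \<alpha> \<le> 0")
          case True
          then have le1: "exp t * \<alpha> \<le> 1" using ex by (metis exp_le_one_iff)
          have "indicator (S \<alpha>) t = (if a \<le> exp t * \<alpha> \<and> exp t * \<alpha> \<le> b then 1 else (0::real))"
            using t by (simp add: S_def indicator_def)
          then show ?thesis using True le1 cnt_small[OF l _ le1, of j a b] \<alpha> by (auto simp: f_def)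
        next
          case False
          then have "exp t * \<alpha> > 1" using ex by (metis not_le one_less_exp_iff)
          then have "indicator (S \<alpha>) t = (0::real)" using ab by (auto simp: S_def)
          moreover have "k (t + ln \<alpha>) * \<alpha> ^ DIM('a) = k t"
          proof -
            have "\<alpha> ^ DIM('a) = exp (d * ln \<alpha>)" using \<alpha> by (simp add: d_def exp_of_nat_mult)
            then show ?thesis by (simp add: k_def algebra_simps flip: exp_add)
          qed
          ultimately show ?thesis using False by (simp add: f_def ex mult_ac)
        qed
      qed
      have "f i t = (\<Sum>(l, \<alpha>, w)\<in>set (rule \<sigma> i). k t * real (cnt j a b l (exp t * \<alpha>)))"
        using t cnt_large[OF i[unfolded n_def] t(1), of j a b] by (simp add: f_def sum_distrib_left case_prod_unfold)
      also have "\<dots> = (\<Sum>(l, \<alpha>, w)\<in>set (rule \<sigma> i). (if l = j then k t * indicator (S \<alpha>) t else 0) + \<alpha> ^ DIM('a) * f l (t + ln \<alpha>))"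
        using count_child by (intro sum.cong refl) (auto split: prod.split)
      also have "\<dots> = (\<Sum>(l, \<alpha>, w)\<in>set (rule \<sigma> i). (if l = j then k t * indicator (S \<alpha>) t else 0)) + 
          (\<Sum>(l, \<alpha>, w)\<in>set (rule \<sigma> i). \<alpha> ^ DIM('a) * f l (t + ln \<alpha>))"
        by (simp add: sum.distrib case_prod_unfold)
      also have "(\<Sum>(l, \<alpha>, w)\<in>set (rule \<sigma> i). (if l = j then k t * indicator (S \<alpha>) t else 0)) = g i t"
        unfolding g_def by (rule sum.mono_neutral_cong_right) (auto simp: Ej_def rat_def split: if_splits)
      finally show ?thesis by (simp add: case_prod_unfold)
    qed
  qed
  \<comment> \<open>A and B are the times at which the growing scale \<open>exp t * \<alpha>\<close>
    reaches a and b. Since t > 0 forces this scale above \<alpha>, the interval is cut at \<alpha>: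
    this is the source of the maxima in \<open>phi\<close>.\<close>
  define A where "A \<alpha> = ln (max a \<alpha> / \<alpha>)" for \<alpha>
  define B where "B \<alpha> = ln (max b \<alpha> / \<alpha>)" for \<alpha>
  have AB: "0 \<le> A \<alpha>" "A \<alpha> \<le> B \<alpha>" "B \<alpha> \<le> - ln \<alpha>" "{A \<alpha><..<B \<alpha>} \<subseteq> S \<alpha>" "S \<alpha> \<subseteq> {A \<alpha>..B \<alpha>}" if \<alpha>: "0 < \<alpha>" "\<alpha> < 1" for \<alpha>
  proof -
    have eA: "exp (A \<alpha>) * \<alpha> = max a \<alpha>" "exp (B \<alpha>) * \<alpha> = max b \<alpha>" using \<alpha> by (auto simp: A_def B_def max_def)
    show A0: "0 \<le> A \<alpha>" unfolding A_def using \<alpha> by (intro ln_ge_zero) (auto simp: field_simps)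
    show "A \<alpha> \<le> B \<alpha>" unfolding A_def B_def using \<alpha> ab by (intro ln_mono divide_right_mono) (auto simp: max_def)
    have "B \<alpha> \<le> ln (1 / \<alpha>)" unfolding B_def using \<alpha> ab by (intro ln_mono divide_right_mono) (auto simp: max_def)
    then show "B \<alpha> \<le> - ln \<alpha>" using \<alpha> by (simp add: ln_div)
    show "{A \<alpha><..<B \<alpha>} \<subseteq> S \<alpha>"
    proof
      fix t assume t: "t \<in> {A \<alpha><..<B \<alpha>}"
      then have "exp (A \<alpha>) * \<alpha> < exp t * \<alpha>" "exp t * \<alpha> < exp (B \<alpha>) * \<alpha>" using \<alpha> by auto
      then have "max a \<alpha> < exp t * \<alpha>" "exp t * \<alpha> < max b \<alpha>" using eA by simp_all
      then show "t \<in> S \<alpha>" using t A0 by (auto simp: S_def max_def split: if_splits)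
    qed
    show "S \<alpha> \<subseteq> {A \<alpha>..B \<alpha>}"
    proof
      fix t assume t: "t \<in> S \<alpha>"
      have "\<alpha> \<le> exp t * \<alpha>" using t \<alpha> by (auto simp: S_def)
      then have "exp (A \<alpha>) * \<alpha> \<le> exp t * \<alpha>" "exp t * \<alpha> \<le> exp (B \<alpha>) * \<alpha>"
        unfolding eA using t by (auto simp: S_def)
      then show "t \<in> {A \<alpha>..B \<alpha>}" using \<alpha> by simp
    qed
  qed
  define I where "I = (\<Sum>i<n. u i * (\<Sum>e\<in>Ej i. integral {A (rat e)..B (rat e)} k))"
  have contk: "continuous_on UNIV k" unfolding k_def by (intro continuous_intros)
  have "(f i \<longlongrightarrow> I / (\<Sum>i<ntypes \<sigma>. u i * (\<Sum>e\<in>set (rule \<sigma> i). (case e of (l, \<alpha>, w) \<Rightarrow> \<alpha> ^ DIM('a)) * (case e of (l, \<alpha>, w) \<Rightarrow> - ln \<alpha>)))) at_top"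
  proof (rule R.renewal_limit[OF sol _ _ _ i])
    show "(\<Sum>i<ntypes \<sigma>. u i * (\<Sum>e | e \<in> set (rule \<sigma> i) \<and> fst e = l. case e of (l, \<alpha>, w) \<Rightarrow> \<alpha> ^ DIM('a))) = u l"
      if "l < ntypes \<sigma>" for l
      using u[OF that] by (simp add: case_prod_unfold)
    show "0 < (\<Sum>i<ntypes \<sigma>. u i * (\<Sum>e\<in>set (rule \<sigma> i). (case e of (l, \<alpha>, w) \<Rightarrow> \<alpha> ^ DIM('a)) * (case e of (l, \<alpha>, w) \<Rightarrow> - ln \<alpha>)))"
      using mu by (simp add: mean_len_def case_prod_unfold)
  next
    fix \<epsilon> :: real assume eps: "\<epsilon> > 0"
    define W where "W = (\<Sum>i<n. u i * real (card (Ej i)))"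
    have W0: "W \<ge> 0" unfolding W_def using u0 by (intro sum_nonneg) (auto simp: n_def)
    \<comment> \<open>W is the u-weighted number of edges among which \<epsilon> is shared; adding 1
      covers W = 0.\<close>
    define \<eta> where "\<eta> = \<epsilon> / (W + 1)"
    have eta: "\<eta> > 0" "W * \<eta> \<le> \<epsilon>" using eps W0 by (auto simp: \<eta>_def field_simps)
    \<comment> \<open>All intervals from \<open>A\<close> to \<open>B\<close> lie in
      {0..\<open>R.lmax\<close>}; a margin of 1 on both sides leaves room for the ramps.\<close>
    define c where "c = (-1::real)" define G where "G = R.lmax + 1"
    define P where "P e kl ku \<longleftrightarrow> continuous_on UNIV kl \<and> continuous_on UNIV ku \<and>
     (\<forall>t. t \<notin> {c..G} \<longrightarrow> kl t = 0 \<and> ku t = 0) \<and>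
     (\<forall>t. kl t \<le> k t * indicator (S (rat e)) t \<and> k t * indicator (S (rat e)) t \<le> ku t) \<and>
     integral {A (rat e)..B (rat e)} k - \<eta> \<le> integral {c..G} kl \<and> integral {c..G} ku \<le> integral {A (rat e)..B (rat e)} k + \<eta>" for e kl ku
    have "\<exists>kl ku. P e kl ku" if "e \<in> Ej i" "i < n" for e i
    proof -
      note r = rat[OF that]
      show ?thesis unfolding P_def
        by (rule interval_indicator_sandwich[OF contk _ AB(2)[OF r(1,2)] _ _ AB(4,5)[OF r(1,2)] eta(1)])
          (use AB(1,3)[OF r(1,2)] r(3) in \<open>auto simp: k_def c_def G_def\<close>)
    qed
    then have "\<forall>e. \<exists>kl ku. (\<exists>i<n. e \<in> Ej i) \<longrightarrow> P e kl ku" by blast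
    then obtain kl where "\<forall>e. \<exists>ku. (\<exists>i<n. e \<in> Ej i) \<longrightarrow> P e (kl e) ku" by metis
    then obtain ku where "\<forall>e. (\<exists>i<n. e \<in> Ej i) \<longrightarrow> P e (kl e) (ku e)" by metis
    then have P: "P e (kl e) (ku e)" if "e \<in> Ej i" "i < n" for e i using that by blast
    note PD = P[unfolded P_def]
    define gl where "gl i t = (\<Sum>e\<in>Ej i. kl e t)" for i t
    define gu where "gu i t = (\<Sum>e\<in>Ej i. ku e t)" for i t
    have cont: "continuous_on UNIV (gl i)" "continuous_on UNIV (gu i)" if "i < n" for i
      unfolding gl_def gu_def using PD that by (auto intro!: continuous_on_sum)
    have zero: "gl i t = 0 \<and> gu i t = 0" if "i < n" "t \<notin> {c..G}" for i t
      unfolding gl_def gu_def using PD that by (auto intro!: sum.neutral)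
    have le: "gl i t \<le> g i t \<and> g i t \<le> gu i t" if "i < n" for i t
      unfolding gl_def gu_def g_def using PD that by (auto intro!: sum_mono)
    have ki: "kl e integrable_on {c..G}" "ku e integrable_on {c..G}" if "e \<in> Ej i" "i < n" for e i
      using PD[OF that] by (auto intro!: integrable_continuous_interval intro: continuous_on_subset)
    have il: "(\<Sum>e\<in>Ej i. integral {A (rat e)..B (rat e)} k) - real (card (Ej i)) * \<eta> \<le> integral {c..G} (gl i)" if i: "i < n" for i
    proof -
      have "(\<Sum>e\<in>Ej i. integral {A (rat e)..B (rat e)} k) - real (card (Ej i)) * \<eta> = (\<Sum>e\<in>Ej i. integral {A (rat e)..B (rat e)} k - \<eta>)"
        by (simp add: sum_subtractf)
      also have "\<dots> \<le> (\<Sum>e\<in>Ej i. integral {c..G} (kl e))" using PD i by (intro sum_mono) blast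
      also have "\<dots> = integral {c..G} (gl i)" unfolding gl_def using ki i finE by (intro integral_sum[symmetric]) auto
      finally show ?thesis .
    qed
    have iu: "integral {c..G} (gu i) \<le> (\<Sum>e\<in>Ej i. integral {A (rat e)..B (rat e)} k) + real (card (Ej i)) * \<eta>" if i: "i < n" for i
    proof -
      have "integral {c..G} (gu i) = (\<Sum>e\<in>Ej i. integral {c..G} (ku e))" unfolding gu_def using ki i finE by (intro integral_sum) auto
      also have "\<dots> \<le> (\<Sum>e\<in>Ej i. integral {A (rat e)..B (rat e)} k + \<eta>)" using PD i by (intro sum_mono) blast
      also have "\<dots> = (\<Sum>e\<in>Ej i. integral {A (rat e)..B (rat e)} k) + real (card (Ej i)) * \<eta>"
        by (simp add: sum.distrib)
      finally show ?thesis .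
    qed
    have "I - \<epsilon> \<le> I - W * \<eta>" using eta by simp
    also have "\<dots> = (\<Sum>i<n. u i * ((\<Sum>e\<in>Ej i. integral {A (rat e)..B (rat e)} k) - real (card (Ej i)) * \<eta>))"
      by (simp add: I_def W_def right_diff_distrib sum_subtractf sum_distrib_right mult.assoc)
    also have "\<dots> \<le> (\<Sum>i<n. u i * integral {c..G} (gl i))"
      using il u0 by (intro sum_mono mult_left_mono) (auto simp: n_def)
    finally have low: "I - \<epsilon> \<le> (\<Sum>i<n. u i * integral {c..G} (gl i))" .
    have "(\<Sum>i<n. u i * integral {c..G} (gu i)) \<le> (\<Sum>i<n. u i * ((\<Sum>e\<in>Ej i. integral {A (rat e)..B (rat e)} k) + real (card (Ej i)) * \<eta>))"
      using iu u0 by (intro sum_mono mult_left_mono) (auto simp: n_def)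
    also have "\<dots> = I + W * \<eta>"
      by (simp add: I_def W_def distrib_left sum.distrib sum_distrib_right mult.assoc)
    also have "\<dots> \<le> I + \<epsilon>" using eta by simp
    finally have up: "(\<Sum>i<n. u i * integral {c..G} (gu i)) \<le> I + \<epsilon>" .
    show "\<exists>gl gu c' G'. (\<forall>i<ntypes \<sigma>. continuous_on UNIV (gl i) \<and> continuous_on UNIV (gu i) \<and>
          (\<forall>t. t \<notin> {c'..G'} \<longrightarrow> gl i t = 0 \<and> gu i t = 0) \<and> (\<forall>t. gl i t \<le> g i t \<and> g i t \<le> gu i t)) \<and>
          I - \<epsilon> \<le> (\<Sum>i<ntypes \<sigma>. u i * integral {c'..G'} (gl i)) \<and> (\<Sum>i<ntypes \<sigma>. u i * integral {c'..G'} (gu i)) \<le> I + \<epsilon>"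
      unfolding n_def[symmetric]
      by (rule exI[of _ gl], rule exI[of _ gu], rule exI[of _ c], rule exI[of _ G], intro conjI allI impI)
        (use cont zero le low up in blast)+
  qed
  moreover have "(\<Sum>i<ntypes \<sigma>. u i * (\<Sum>e\<in>set (rule \<sigma> i). (case e of (l, \<alpha>, w) \<Rightarrow> \<alpha> ^ DIM('a)) * (case e of (l, \<alpha>, w) \<Rightarrow> - ln \<alpha>))) = mean_len u"
    by (simp add: mean_len_def case_prod_unfold)
  \<comment> \<open>The primitive of \<open>exp (- d * t)\<close> supplies the factor 1 / d, and its
    values at the logarithms A and B are the powers of the maxima in \<open>phi\<close>.\<close>
  moreover have "integral {A \<alpha>..B \<alpha>} k = 1 / d * (\<alpha> ^ DIM('a) * (max a \<alpha> powi (- int DIM('a)) - max b \<alpha> powi (- int DIM('a))))"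
    if \<alpha>: "0 < \<alpha>" "\<alpha> < 1" for \<alpha>
  proof -
    have "(k has_integral (- exp (- d * B \<alpha>) / d - - exp (- d * A \<alpha>) / d)) {A \<alpha>..B \<alpha>}"
      unfolding k_def using d0 AB(2)[OF \<alpha>]
      by (intro fundamental_theorem_of_calculus)
        (auto intro!: derivative_eq_intros simp flip: has_real_derivative_iff_has_vector_derivative)
    moreover have "exp (- d * ln (y / \<alpha>)) = \<alpha> ^ DIM('a) * y powi (- int DIM('a))" if "y > 0" for y
    proof -
      have "exp (- d * ln (y / \<alpha>)) = inverse (exp (ln (y / \<alpha>)) ^ DIM('a))"
        by (simp add: d_def exp_minus exp_of_nat_mult)
      also have "exp (ln (y / \<alpha>)) = y / \<alpha>" using that \<alpha> by (intro exp_ln) auto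
      also have "inverse ((y / \<alpha>) ^ DIM('a)) = \<alpha> ^ DIM('a) * y powi (- int DIM('a))"
        by (simp add: power_int_minus power_mult_distrib power_inverse divide_inverse)
      finally show ?thesis .
    qed
    from this[of "max a \<alpha>"] this[of "max b \<alpha>"]
    have "exp (- d * A \<alpha>) = \<alpha> ^ DIM('a) * max a \<alpha> powi (- int DIM('a))" "exp (- d * B \<alpha>) = \<alpha> ^ DIM('a) * max b \<alpha> powi (- int DIM('a))"
      using \<alpha> by (auto simp: A_def B_def)
    ultimately show ?thesis by (simp add: integral_unique algebra_simps diff_divide_distrib)
  qed
  then have "I = (\<Sum>i<ntypes \<sigma>. u i * (1 / real DIM('a) * (\<Sum>(l, \<alpha>, w) | (l, \<alpha>, w) \<in> set (rule \<sigma> i) \<and> l = j.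
       \<alpha> ^ DIM('a) * (max a \<alpha> powi (- int DIM('a)) - max b \<alpha> powi (- int DIM('a))))))"
    unfolding I_def n_def[symmetric] sum_distrib_left[of "1 / _"] Ej_def[symmetric] 
    using rat by (intro sum.cong refl arg_cong2[where f = "(*)"]) (auto simp: d_def rat_def split: prod.split)
  moreover have "\<forall>\<^sub>F t in at_top. f i t = exp (- real DIM('a) * t) * real (cnt j a b i (exp t))"
    using eventually_gt_at_top[of 0] by eventually_elim (simp add: f_def k_def d_def)
  ultimately show ?thesis using tendsto_cong by force
qed

end

section \<open>The adjugate of the substitution matrix\<close>

lemma has_derivative_sum_list_powr:
  fixes xs :: "real list"
  assumes "\<And>x. x \<in> set xs \<Longrightarrow> x > 0"
  shows "((\<lambda>s. \<Sum>x\<leftarrow>xs. x powr s) has_real_derivative (\<Sum>x\<leftarrow>xs. x powr s * ln x)) (at s)"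
  using assms
proof (induction xs)
  case (Cons x xs)
  have "((\<lambda>s. x powr s) has_real_derivative x powr s * ln x) (at s)"
    using Cons.prems by (auto intro!: derivative_eq_intros)
  then show ?case using Cons by (auto intro!: DERIV_add)
qed simp

lemma mat_mult_entry:
  assumes "A \<in> carrier_mat n n" "B \<in> carrier_mat n n" "i < n" "l < n"
  shows "(A * B) $$ (i, l) = (\<Sum>k<n. A $$ (i, k) * B $$ (k, l))"
  using assms carrier_matD[OF assms(1)] carrier_matD[OF assms(2)]
  by (simp add: scalar_prod_def atLeast0LessThan)

lemma mat_vec_entry:
  assumes "A \<in> carrier_mat n n" "v \<in> carrier_vec n" "i < n"
  shows "vec_index (A *\<^sub>v v) i = (\<Sum>k<n. A $$ (i, k) * vec_index v k)"
  using assms carrier_matD[OF assms(1)] carrier_vecD[OF assms(2)]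
  by (simp add: scalar_prod_def atLeast0LessThan)

context mixing_scheme
begin

text \<open>The transition matrix of the Markov chain of types, which is \<open>subst_matrix\<close>
  at the dimension.\<close>

definition trans_prob :: "nat \<Rightarrow> nat \<Rightarrow> real" where
  "trans_prob i l = (\<Sum>(l', \<alpha>, w) | (l', \<alpha>, w) \<in> set (rule \<sigma> i) \<and> l' = l. \<alpha> ^ DIM('a))"

text \<open>Equal constants belonging to different tiles count with multiplicity, so the list of
  constants corresponds to the set of rule entries rather than to a set of constants. Entries do not
  repeat because the rule is distinct.\<close>

lemma sum_list_consts:
  assumes "i < ntypes \<sigma>"
  shows "(\<Sum>\<alpha>\<leftarrow>consts_of_subst \<sigma> i l. h \<alpha>) = (\<Sum>(l', \<alpha>, w) | (l', \<alpha>, w) \<in> set (rule \<sigma> i) \<and> l' = l. (h \<alpha> :: real))"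
proof -
  have "(\<Sum>\<alpha>\<leftarrow>consts_of_subst \<sigma> i l. h \<alpha>) = (\<Sum>e\<leftarrow>filter (\<lambda>(l', \<alpha>, w). l' = l) (rule \<sigma> i). h (case e of (l', \<alpha>, w) \<Rightarrow> \<alpha>))"
    by (simp add: consts_of_subst_def o_def case_prod_unfold)
  also have "\<dots> = (\<Sum>e\<in>set (filter (\<lambda>(l', \<alpha>, w). l' = l) (rule \<sigma> i)). h (case e of (l', \<alpha>, w) \<Rightarrow> \<alpha>))"
    by (rule sum_list_distinct_conv_sum_set) (simp add: distinct_rule assms)
  also have "\<dots> = (\<Sum>(l', \<alpha>, w) | (l', \<alpha>, w) \<in> set (rule \<sigma> i) \<and> l' = l. h \<alpha>)"
    by (intro sum.cong) auto
  finally show ?thesis .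
qed

lemma sum_rule_by_type:
  assumes "i < ntypes \<sigma>"
  shows "(\<Sum>(l, \<alpha>, w)\<in>set (rule \<sigma> i). h \<alpha> * y l) = 
    (\<Sum>l<ntypes \<sigma>. (\<Sum>(l', \<alpha>, w) | (l', \<alpha>, w) \<in> set (rule \<sigma> i) \<and> l' = l. h \<alpha>) * (y l :: real))"
proof -
  have "(\<Sum>(l, \<alpha>, w)\<in>set (rule \<sigma> i). h \<alpha> * y l) = 
    (\<Sum>l<ntypes \<sigma>. \<Sum>e | e \<in> set (rule \<sigma> i) \<and> fst e = l. case e of (l, \<alpha>, w) \<Rightarrow> h \<alpha> * y l)"
    by (rule sum.group[symmetric]) (use rule_entry[OF assms] in auto)
  also have "\<dots> = (\<Sum>l<ntypes \<sigma>. (\<Sum>(l', \<alpha>, w) | (l', \<alpha>, w) \<in> set (rule \<sigma> i) \<and> l' = l. h \<alpha>) * y l)"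
    unfolding sum_distrib_right by (intro sum.cong refl) auto
  finally show ?thesis .
qed

lemma sum_trans_prob:
  assumes "i < ntypes \<sigma>" shows "(\<Sum>l<ntypes \<sigma>. trans_prob i l) = 1"
  using sum_rule_by_type[OF assms, of "\<lambda>\<alpha>. \<alpha> ^ DIM('a)" "\<lambda>_. 1"] rule_powers_sum[OF assms]
  by (simp add: trans_prob_def)

lemma trans_prob_nonneg: "i < ntypes \<sigma> \<Longrightarrow> trans_prob i l \<ge> 0"
  unfolding trans_prob_def using rule_entry[of i] by (intro sum_nonneg) (auto intro: less_imp_le)

lemma trans_prob_pos:
  assumes "i < ntypes \<sigma>" "e \<in> set (rule \<sigma> i)" shows "trans_prob i (fst e) > 0"
proof -
  have fin: "finite {(l', \<alpha>, w). (l', \<alpha>, w) \<in> set (rule \<sigma> i) \<and> l' = fst e}"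
    by (rule finite_subset[of _ "set (rule \<sigma> i)"]) auto
  have "e \<in> {(l', \<alpha>, w). (l', \<alpha>, w) \<in> set (rule \<sigma> i) \<and> l' = fst e}" using assms(2) by (cases e) auto
  then have "{(l', \<alpha>, w). (l', \<alpha>, w) \<in> set (rule \<sigma> i) \<and> l' = fst e} \<noteq> {}" by blast
  then show ?thesis unfolding trans_prob_def
    using rule_entry[OF assms(1)] by (intro sum_pos[OF fin]) auto
qed

lemma subst_matrix_entry:
  assumes "i < ntypes \<sigma>" "l < ntypes \<sigma>"
  shows "subst_matrix \<sigma> (real DIM('a)) $$ (i, l) = trans_prob i l"
proof -
  have "subst_matrix \<sigma> (real DIM('a)) $$ (i, l) = (\<Sum>\<alpha>\<leftarrow>consts_of_subst \<sigma> i l. \<alpha> powr real DIM('a))"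
    using assms by (simp add: subst_matrix_def)
  also have "\<dots> = trans_prob i l" unfolding sum_list_consts[OF assms(1)] trans_prob_def
    using rule_entry[OF assms(1)] by (intro sum.cong refl) (auto simp: powr_realpow)
  finally show ?thesis .
qed

lemma subst_matrix_deriv_entry:
  assumes "i < ntypes \<sigma>" "l < ntypes \<sigma>"
  shows "subst_matrix_deriv \<sigma> (real DIM('a)) $$ (i, l) =
    (\<Sum>(l', \<alpha>, w) | (l', \<alpha>, w) \<in> set (rule \<sigma> i) \<and> l' = l. \<alpha> ^ DIM('a) * ln \<alpha>)"
proof -
  have "x > 0" if "x \<in> set (consts_of_subst \<sigma> i l)" for x
    using that rule_entry[OF assms(1)] by (auto simp: consts_of_subst_def)
  then have "((\<lambda>u. \<Sum>\<alpha>\<leftarrow>consts_of_subst \<sigma> i l. \<alpha> powr u) has_real_derivative 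
     (\<Sum>\<alpha>\<leftarrow>consts_of_subst \<sigma> i l. \<alpha> powr real DIM('a) * ln \<alpha>)) (at (real DIM('a)))"
    by (rule has_derivative_sum_list_powr)
  moreover have "(\<lambda>u. subst_matrix \<sigma> u $$ (i, l)) = (\<lambda>u. \<Sum>\<alpha>\<leftarrow>consts_of_subst \<sigma> i l. \<alpha> powr u)"
    using assms by (simp add: subst_matrix_def)
  ultimately have "subst_matrix_deriv \<sigma> (real DIM('a)) $$ (i, l) = (\<Sum>\<alpha>\<leftarrow>consts_of_subst \<sigma> i l. \<alpha> powr real DIM('a) * ln \<alpha>)"
    using assms by (simp add: subst_matrix_deriv_def DERIV_imp_deriv)
  also have "\<dots> = (\<Sum>(l', \<alpha>, w) | (l', \<alpha>, w) \<in> set (rule \<sigma> i) \<and> l' = l. \<alpha> ^ DIM('a) * ln \<alpha>)"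
    unfolding sum_list_consts[OF assms(1)]
    using rule_entry[OF assms(1)] by (intro sum.cong refl) (auto simp: powr_realpow)
  finally show ?thesis .
qed

text \<open>A value that attains the maximum m and is at most an average of values bounded by m
  forces every value in that average to equal m. Equality spreads along edges, hence to all states
  by irreducibility.\<close>

lemma max_principle:
  fixes y :: "nat \<Rightarrow> real"
  assumes le: "\<And>i. i < ntypes \<sigma> \<Longrightarrow> y i \<le> m"
    and sub: "\<And>i. i < ntypes \<sigma> \<Longrightarrow> y i = m \<Longrightarrow> m \<le> (\<Sum>l<ntypes \<sigma>. trans_prob i l * y l)"
    and i0: "i0 < ntypes \<sigma>" "y i0 = m" and l: "l < ntypes \<sigma>"
  shows "y l = m"
proof -
  obtain x where "R.path i0 x l" using R.irreducible[OF i0(1) l] by blast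
  then show ?thesis using i0(2)
  proof (induction rule: R.path.induct)
    case (path_step i e x l)
    let ?p = "\<lambda>(l, \<alpha>, w). \<alpha> ^ DIM('a)"
    have "m \<le> (\<Sum>e\<in>set (rule \<sigma> i). ?p e * y (fst e))"
      using sub[OF path_step(1) path_step.prems] sum_rule_by_type[OF path_step(1), of "\<lambda>\<alpha>. \<alpha> ^ DIM('a)" y]
      by (simp add: trans_prob_def case_prod_unfold)
    also have "\<dots> \<le> m - ?p e * (m - y (fst e))"
      using le R.tgt_less[OF path_step(1)] by (intro R.average_split path_step(1,2)) auto
    finally have "?p e * (m - y (fst e)) \<le> 0" by simp
    then have "m \<le> y (fst e)" using R.p_pos[OF path_step(1,2)] by (simp add: mult_le_0_iff)
    then show ?case using path_step le[OF R.tgt_less[OF path_step(1,2)]] by simp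
  qed simp
qed

text \<open>Positivity spreads along edges, since by invariance and nonnegativity the value at the
  target is at least the value at the source times a positive probability.\<close>

lemma left_invariant_pos:
  fixes v :: "nat \<Rightarrow> real"
  assumes inv: "\<And>l. l < ntypes \<sigma> \<Longrightarrow> (\<Sum>i<ntypes \<sigma>. v i * trans_prob i l) = v l"
    and nonneg: "\<And>i. i < ntypes \<sigma> \<Longrightarrow> v i \<ge> 0" and i0: "i0 < ntypes \<sigma>" "v i0 > 0" and l: "l < ntypes \<sigma>"
  shows "v l > 0"
proof -
  obtain x where "R.path i0 x l" using R.irreducible[OF i0(1) l] by blast
  then show ?thesis using i0(2)
  proof (induction rule: R.path.induct)
    case (path_step i e x l)
    have e: "fst e < ntypes \<sigma>" using R.tgt_less[OF path_step(1,2)] .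
    have "0 < v i * trans_prob i (fst e)" using path_step trans_prob_pos[OF path_step(1,2)] by simp
    also have "\<dots> \<le> (\<Sum>i<ntypes \<sigma>. v i * trans_prob i (fst e))"
      using path_step(1) nonneg trans_prob_nonneg by (intro member_le_sum) auto
    finally show ?case using path_step.IH inv[OF e] by simp
  qed simp
qed

text \<open>The triangle inequality gives \<open>\<bar>u l\<bar>\<close> as a lower bound for each
  l. Both sides have the same sum over l because rows sum to 1, so no inequality can be
  strict.\<close>

lemma abs_left_invariant:
  fixes u :: "nat \<Rightarrow> real"
  assumes inv: "\<And>l. l < ntypes \<sigma> \<Longrightarrow> (\<Sum>i<ntypes \<sigma>. u i * trans_prob i l) = u l" and l: "l < ntypes \<sigma>"
  shows "(\<Sum>i<ntypes \<sigma>. \<bar>u i\<bar> * trans_prob i l) = \<bar>u l\<bar>"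
proof -
  have ge: "\<bar>u l\<bar> \<le> (\<Sum>i<ntypes \<sigma>. \<bar>u i\<bar> * trans_prob i l)" if "l < ntypes \<sigma>" for l
  proof -
    have "\<bar>u l\<bar> \<le> (\<Sum>i<ntypes \<sigma>. \<bar>u i * trans_prob i l\<bar>)"
      unfolding inv[OF that, symmetric] by (rule sum_abs)
    then show ?thesis using trans_prob_nonneg by (simp add: abs_mult)
  qed
  have "(\<Sum>l<ntypes \<sigma>. (\<Sum>i<ntypes \<sigma>. \<bar>u i\<bar> * trans_prob i l)) = (\<Sum>i<ntypes \<sigma>. \<Sum>l<ntypes \<sigma>. \<bar>u i\<bar> * trans_prob i l)"
    by (rule sum.swap)
  also have "\<dots> = (\<Sum>i<ntypes \<sigma>. \<bar>u i\<bar>)" by (simp add: sum_trans_prob flip: sum_distrib_left)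
  finally have "(\<Sum>l<ntypes \<sigma>. (\<Sum>i<ntypes \<sigma>. \<bar>u i\<bar> * trans_prob i l) - \<bar>u l\<bar>) = 0"
    by (simp add: sum_subtractf)
  then have "\<forall>l\<in>{..<ntypes \<sigma>}. (\<Sum>i<ntypes \<sigma>. \<bar>u i\<bar> * trans_prob i l) - \<bar>u l\<bar> = 0"
    using ge by (subst (asm) sum_nonneg_eq_0_iff) auto
  then show ?thesis using l by simp
qed

abbreviation gen_mat :: "real Matrix.mat" where
  "gen_mat \<equiv> 1\<^sub>m (ntypes \<sigma>) - subst_matrix \<sigma> (real DIM('a))"

lemma gen_mat_carrier: "gen_mat \<in> carrier_mat (ntypes \<sigma>) (ntypes \<sigma>)"
  by (rule minus_carrier_mat) (simp add: subst_matrix_def)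

lemma gen_mat_entry:
  "i < ntypes \<sigma> \<Longrightarrow> l < ntypes \<sigma> \<Longrightarrow> gen_mat $$ (i, l) = (if i = l then 1 else 0) - trans_prob i l"
  using subst_matrix_entry[of i l] by (simp add: subst_matrix_def)

text \<open>The rows of M(d) sum to 1, so the vector of ones is in the kernel of I - M(d).\<close>

lemma det_gen_mat: "det gen_mat = 0"
proof -
  let ?one = "Matrix.vec (ntypes \<sigma>) (\<lambda>_. 1 :: real)"
  have "gen_mat *\<^sub>v ?one = 0\<^sub>v (ntypes \<sigma>)"
  proof (rule eq_vecI)
    fix i assume "i < dim_vec (0\<^sub>v (ntypes \<sigma>) :: real Matrix.vec)"
    then have i: "i < ntypes \<sigma>" by simp
    have "vec_index (gen_mat *\<^sub>v ?one) i = (\<Sum>l<ntypes \<sigma>. gen_mat $$ (i, l))"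
      using mat_vec_entry[OF gen_mat_carrier _ i, of ?one] by simp
    also have "\<dots> = (\<Sum>l<ntypes \<sigma>. (if i = l then 1 else 0) - trans_prob i l)"
      using gen_mat_entry[OF i] by (intro sum.cong) auto
    also have "\<dots> = 0" using i sum_trans_prob[OF i] by (simp add: sum_subtractf)
    finally show "vec_index (gen_mat *\<^sub>v ?one) i = vec_index (0\<^sub>v (ntypes \<sigma>)) i" using i by simp
  qed (simp add: subst_matrix_def)
  moreover have "vec_index ?one 0 \<noteq> vec_index (0\<^sub>v (ntypes \<sigma>)) 0" using ntypes_pos by simp
  then have "?one \<noteq> 0\<^sub>v (ntypes \<sigma>)" by metis
  moreover have "?one \<in> carrier_vec (ntypes \<sigma>)" by simp
  ultimately show ?thesis using det_0_iff_vec_prod_zero[OF gen_mat_carrier] by blast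
qed

text \<open>This shows that the adjugate is not zero. A kernel vector of the minor, extended by 0 at
  state 0, is harmonic at all other states. Its absolute value has a positive maximum, is
  subharmonic wherever the maximum is attained, and would be constant by the maximum principle,
  against its value 0 at state 0.\<close>

lemma minor_gen_mat: "det (mat_delete gen_mat 0 0) \<noteq> 0"
proof
  let ?n = "ntypes \<sigma>" let ?D = "mat_delete gen_mat 0 0"
  assume "det ?D = 0"
  moreover have D: "?D \<in> carrier_mat (?n - 1) (?n - 1)"
    using mat_delete_carrier[OF gen_mat_carrier] .
  ultimately obtain v where v: "v \<in> carrier_vec (?n - 1)" "v \<noteq> 0\<^sub>v (?n - 1)" "?D *\<^sub>v v = 0\<^sub>v (?n - 1)"
    using det_0_iff_vec_prod_zero[OF D] by blast
  have Suc: "?n = Suc (?n - 1)" using ntypes_pos by simp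
  have entry: "?D $$ (i, k) = (if i = k then 1 else 0) - trans_prob (Suc i) (Suc k)" if "i < ?n - 1" "k < ?n - 1" for i k
  proof -
    have "?D $$ (i, k) = gen_mat $$ (Suc i, Suc k)"
      using mat_delete_index[of gen_mat "?n - 1" 0 0 i k] gen_mat_carrier Suc that by (simp add: insert_index_def)
    then show ?thesis using gen_mat_entry[of "Suc i" "Suc k"] that by simp
  qed
  have vi: "vec_index v i = (\<Sum>k<?n - 1. trans_prob (Suc i) (Suc k) * vec_index v k)" if i: "i < ?n - 1" for i
  proof -
    have "0 = vec_index (?D *\<^sub>v v) i" using v(3) i by simp
    also have "\<dots> = (\<Sum>k<?n - 1. ?D $$ (i, k) * vec_index v k)"
      by (rule mat_vec_entry[OF D v(1) i])
    also have "\<dots> = (\<Sum>k<?n - 1. ((if i = k then 1 else 0) - trans_prob (Suc i) (Suc k)) * vec_index v k)"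
      using entry[OF i] by (intro sum.cong) auto
    also have "\<dots> = vec_index v i - (\<Sum>k<?n - 1. trans_prob (Suc i) (Suc k) * vec_index v k)"
      using i by (simp add: left_diff_distrib sum_subtractf if_distrib[of "\<lambda>c. c * _"] cong: if_cong)
    finally show ?thesis by simp
  qed
  define y where "y i = (case i of 0 \<Rightarrow> 0 | Suc k \<Rightarrow> \<bar>vec_index v k\<bar>)" for i
  define m where "m = Max (y ` {..<?n})"
  have le: "y i \<le> m" if "i < ?n" for i unfolding m_def using that by (intro Max_ge) auto
  have "\<exists>k<?n - 1. vec_index v k \<noteq> 0"
  proof (rule ccontr)
    assume "\<not> ?thesis"
    then have "v = 0\<^sub>v (?n - 1)" using v(1) by (intro eq_vecI) auto
    then show False using v(2) by simp
  qed
  then obtain k where k: "k < ?n - 1" "vec_index v k \<noteq> 0" by blast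
  have "0 < y (Suc k)" using k by (simp add: y_def)
  also have "\<dots> \<le> m" using k by (intro le) auto
  finally have m0: "m > 0" .
  have "m \<in> y ` {..<?n}" unfolding m_def using ntypes_pos by (intro Max_in) (auto simp: lessThan_empty_iff)
  then obtain i0 where i0: "i0 < ?n" "y i0 = m" by auto
  have sub: "m \<le> (\<Sum>l<?n. trans_prob i l * y l)" if i: "i < ?n" "y i = m" for i
  proof -
    obtain i' where i': "i = Suc i'" using i m0 by (cases i) (auto simp: y_def)
    then have "m = \<bar>vec_index v i'\<bar>" using i by (simp add: y_def)
    also have "\<dots> \<le> (\<Sum>k<?n - 1. \<bar>trans_prob i (Suc k) * vec_index v k\<bar>)"
      using vi[of i'] i i' sum_abs[of "\<lambda>k. trans_prob i (Suc k) * vec_index v k" "{..<?n - 1}"] by simp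
    also have "\<dots> = (\<Sum>k<?n - 1. trans_prob i (Suc k) * y (Suc k))"
      using trans_prob_nonneg[OF i(1)] by (simp add: abs_mult y_def)
    also have "\<dots> = (\<Sum>l<Suc (?n - 1). trans_prob i l * y l)"
      by (subst sum.lessThan_Suc_shift) (simp add: y_def)
    finally show ?thesis using Suc by simp
  qed
  have "y 0 = m" by (rule max_principle[OF le sub i0]) (use ntypes_pos in auto)
  then show False using m0 by (simp add: y_def)
qed

text \<open>The adjugate of the singular matrix \<open>I - M\<close> is annihilated by \<open>I - M\<close> on both sides, so its columns
  are harmonic, hence constant, and its rows are left invariant.\<close>

lemma adj_gen_mat:
  obtains u :: "nat \<Rightarrow> real" where "\<And>i l. i < ntypes \<sigma> \<Longrightarrow> l < ntypes \<sigma> \<Longrightarrow> adj_mat gen_mat $$ (i, l) = u l"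
    "\<And>l. l < ntypes \<sigma> \<Longrightarrow> (\<Sum>i<ntypes \<sigma>. u i * trans_prob i l) = u l" "u 0 \<noteq> 0"
proof -
  let ?n = "ntypes \<sigma>" let ?B = "adj_mat gen_mat"
  note adj = adj_mat[OF gen_mat_carrier, unfolded det_gen_mat]
  have B: "?B \<in> carrier_mat ?n ?n" by (rule adj(1))
  have AB: "(\<Sum>k<?n. gen_mat $$ (i, k) * ?B $$ (k, l)) = 0" if "i < ?n" "l < ?n" for i l
  proof -
    have "(gen_mat * ?B) $$ (i, l) = (\<Sum>k<?n. gen_mat $$ (i, k) * ?B $$ (k, l))"
      by (rule mat_mult_entry[OF gen_mat_carrier B that])
    then show ?thesis using adj(2) that by simp
  qed
  have BA: "(\<Sum>k<?n. ?B $$ (i, k) * gen_mat $$ (k, l)) = 0" if "i < ?n" "l < ?n" for i l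
  proof -
    have "(?B * gen_mat) $$ (i, l) = (\<Sum>k<?n. ?B $$ (i, k) * gen_mat $$ (k, l))"
      by (rule mat_mult_entry[OF B gen_mat_carrier that])
    then show ?thesis using adj(3) that by simp
  qed
  have harm: "?B $$ (i, l) = (\<Sum>k<?n. trans_prob i k * ?B $$ (k, l))" if il: "i < ?n" "l < ?n" for i l
  proof -
    have "0 = (\<Sum>k<?n. gen_mat $$ (i, k) * ?B $$ (k, l))" using AB[OF il] by (rule sym)
    also have "\<dots> = (\<Sum>k<?n. ((if i = k then 1 else 0) - trans_prob i k) * ?B $$ (k, l))"
      using gen_mat_entry[OF il(1)] by (intro sum.cong) auto
    also have "\<dots> = ?B $$ (i, l) - (\<Sum>k<?n. trans_prob i k * ?B $$ (k, l))"
      using il by (simp add: left_diff_distrib sum_subtractf if_distrib[of "\<lambda>c. c * _"] cong: if_cong)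
    finally show ?thesis by simp
  qed
  have inv: "?B $$ (i, l) = (\<Sum>k<?n. ?B $$ (i, k) * trans_prob k l)" if il: "i < ?n" "l < ?n" for i l
  proof -
    have "0 = (\<Sum>k<?n. ?B $$ (i, k) * gen_mat $$ (k, l))" using BA[OF il] by (rule sym)
    also have "\<dots> = (\<Sum>k<?n. ?B $$ (i, k) * ((if k = l then 1 else 0) - trans_prob k l))"
      using gen_mat_entry[OF _ il(2)] by (intro sum.cong) auto
    also have "\<dots> = ?B $$ (i, l) - (\<Sum>k<?n. ?B $$ (i, k) * trans_prob k l)"
      using il by (simp add: right_diff_distrib sum_subtractf if_distrib[of "\<lambda>c. _ * c"] cong: if_cong)
    finally show ?thesis by simp
  qed
  have const: "?B $$ (i, l) = ?B $$ (0, l)" if il: "i < ?n" "l < ?n" for i l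
  proof -
    define m where "m = Max ((\<lambda>i. ?B $$ (i, l)) ` {..<?n})"
    have le: "?B $$ (i, l) \<le> m" if "i < ?n" for i unfolding m_def using that by (intro Max_ge) auto
    have "m \<in> (\<lambda>i. ?B $$ (i, l)) ` {..<?n}" unfolding m_def using ntypes_pos by (intro Max_in) (auto simp: lessThan_empty_iff)
    then obtain i0 where i0: "i0 < ?n" "?B $$ (i0, l) = m" by auto
    have eq: "?B $$ (i, l) = m" if "i < ?n" for i
      by (rule max_principle[of "\<lambda>i. ?B $$ (i, l)", OF le _ i0 that]) (use harm il in auto)
    show ?thesis using eq[OF il(1)] eq[of 0] ntypes_pos by simp
  qed
  \<comment> \<open>Constant columns and invariant rows would also allow the zero matrix; this entry
    excludes it.\<close>
  have "?B $$ (0, 0) = det (mat_delete gen_mat 0 0)"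
    using ntypes_pos gen_mat_carrier by (simp add: adj_mat_def cofactor_def subst_matrix_def)
  then have B00: "?B $$ (0, 0) \<noteq> 0" using minor_gen_mat by simp
  have n0: "0 < ?n" using ntypes_pos by simp
  show ?thesis
    by (rule that[of "\<lambda>l. ?B $$ (0, l)", OF const inv[OF n0, symmetric] B00])
qed

lemma mean_len_scale: "mean_len (\<lambda>i. c * u i) = c * mean_len u"
  by (simp add: mean_len_def sum_distrib_left mult.assoc)

lemma mean_len_pos:
  assumes "\<And>i. i < ntypes \<sigma> \<Longrightarrow> u i > 0" shows "mean_len u > 0"
proof -
  have "(\<Sum>(l, \<alpha>, w)\<in>set (rule \<sigma> i). \<alpha> ^ DIM('a) * - ln \<alpha>) > 0" if i: "i < ntypes \<sigma>" for i
  proof (rule sum_pos)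
    show "finite (set (rule \<sigma> i))" "set (rule \<sigma> i) \<noteq> {}" using rule_nonempty[OF i] by auto
    fix e assume e: "e \<in> set (rule \<sigma> i)"
    obtain l \<alpha> w where lw: "e = (l, \<alpha>, w)" by (cases e)
    then have "\<alpha> ^ DIM('a) > 0" "- ln \<alpha> > 0" using rule_entry[OF i, of l \<alpha> w] e by auto
    then have "0 < \<alpha> ^ DIM('a) * - ln \<alpha>" by (rule mult_pos_pos)
    then show "0 < (case e of (l, \<alpha>, w) \<Rightarrow> \<alpha> ^ DIM('a) * - ln \<alpha>)" by (simp add: lw)
  qed
  then show ?thesis unfolding mean_len_def using assms ntypes_pos by (intro sum_pos) (auto intro: mult_pos_pos simp: lessThan_empty_iff)
qed

text \<open>The denominator of \<open>Q_matrix\<close> is the mean delay under u, up to a sign that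
  cancels one minus: the delay is -ln \<alpha>, while the derivative of M contributes
  \<open>ln \<alpha>\<close>. The quotient \<open>u h / mean_len u\<close> is unchanged when u
  changes sign, so u may be taken positive.\<close>

lemma q_col_eq:
  obtains u :: "nat \<Rightarrow> real" where "\<And>i. i < ntypes \<sigma> \<Longrightarrow> u i > 0"
    "\<And>l. l < ntypes \<sigma> \<Longrightarrow> (\<Sum>i<ntypes \<sigma>. u i * trans_prob i l) = u l"
    "\<And>h. h < ntypes \<sigma> \<Longrightarrow> q_col \<sigma> h = u h / mean_len u"
proof -
  let ?n = "ntypes \<sigma>" let ?B = "adj_mat gen_mat" let ?M = "subst_matrix_deriv \<sigma> (real DIM('a))"
  obtain u where u: "\<And>i l. i < ?n \<Longrightarrow> l < ?n \<Longrightarrow> ?B $$ (i, l) = u l"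
    "\<And>l. l < ?n \<Longrightarrow> (\<Sum>i<?n. u i * trans_prob i l) = u l" "u 0 \<noteq> 0" by (rule adj_gen_mat) blast
  have n0: "0 < ?n" using ntypes_pos by simp
  have B: "?B \<in> carrier_mat ?n ?n" using adj_mat(1)[OF gen_mat_carrier] .
  have M: "?M \<in> carrier_mat ?n ?n" by (simp add: subst_matrix_deriv_def)
  define s where "s = sgn (u 0)"
  \<comment> \<open>Twice the positive part of s u. It is nonnegative, left invariant and positive
    at 0, hence positive everywhere; so all entries of u share the sign s.\<close>
  define v where "v i = \<bar>u i\<bar> + s * u i" for i
  have s: "s = 1 \<or> s = -1" "s * u 0 > 0" using u(3) by (auto simp: s_def sgn_if)
  have vinv: "(\<Sum>i<?n. v i * trans_prob i l) = v l" if "l < ?n" for l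
    using u(2)[OF that] abs_left_invariant[OF u(2) that]
    by (simp add: v_def distrib_right sum.distrib mult.assoc flip: sum_distrib_left)
  have vpos: "v l > 0" if "l < ?n" for l
    by (rule left_invariant_pos[OF vinv _ n0 _ that]) (use s in \<open>auto simp: v_def\<close>)
  have pos: "s * u l > 0" if "l < ?n" for l
    using vpos[OF that] s(1) by (auto simp: v_def abs_if split: if_splits)
  have tr: "mat_trace (?B * ?M) = - mean_len u"
  proof -
    have "mat_trace (?B * ?M) = (\<Sum>i<?n. (?B * ?M) $$ (i, i))"
      using B M by (simp add: mat_trace_def diag_mat_def interv_sum_list_conv_sum_set_nat atLeast0LessThan)
    also have "\<dots> = (\<Sum>i<?n. \<Sum>k<?n. u k * ?M $$ (k, i))"
      using u(1) by (intro sum.cong refl) (simp add: mat_mult_entry[OF B M])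
    also have "\<dots> = (\<Sum>k<?n. u k * (\<Sum>i<?n. ?M $$ (k, i)))"
      by (subst sum.swap) (simp add: sum_distrib_left)
    also have "\<dots> = (\<Sum>k<?n. u k * (\<Sum>(l, \<alpha>, w)\<in>set (rule \<sigma> k). \<alpha> ^ DIM('a) * ln \<alpha>))"
    proof (intro sum.cong refl arg_cong2[where f = "(*)"])
      fix k assume "k \<in> {..<?n}"
      then have k: "k < ?n" by simp
      show "(\<Sum>i<?n. ?M $$ (k, i)) = (\<Sum>(l, \<alpha>, w)\<in>set (rule \<sigma> k). \<alpha> ^ DIM('a) * ln \<alpha>)"
        using sum_rule_by_type[OF k, of "\<lambda>\<alpha>. \<alpha> ^ DIM('a) * ln \<alpha>" "\<lambda>_. 1"] subst_matrix_deriv_entry[OF k] by simp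
    qed
    also have "\<dots> = - mean_len u" by (simp add: mean_len_def sum_negf case_prod_unfold)
    finally show ?thesis .
  qed
  have Q: "Q_matrix \<sigma> = (1 / mean_len u) \<cdot>\<^sub>m ?B"
    unfolding Q_matrix_def Let_def using tr by simp
  have q: "q_col \<sigma> h = u h / mean_len u" if h: "h < ?n" for h
    unfolding q_col_def
  proof (rule the_equality)
    show "Matrix.col (Q_matrix \<sigma>) h = (u h / mean_len u) \<cdot>\<^sub>v Matrix.vec ?n (\<lambda>_. 1)"
      unfolding Q using B h u(1) by (intro eq_vecI) auto
  next
    fix q assume "Matrix.col (Q_matrix \<sigma>) h = q \<cdot>\<^sub>v Matrix.vec ?n (\<lambda>_. 1)"
    then have "vec_index (Matrix.col (Q_matrix \<sigma>) h) 0 = vec_index (q \<cdot>\<^sub>v Matrix.vec ?n (\<lambda>_. 1)) 0" by simp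
    then show "q = u h / mean_len u" unfolding Q using B h u(1)[OF n0 h] n0 by simp
  qed
  show ?thesis
  proof (rule that[of "\<lambda>i. s * u i"])
    show "(\<Sum>i<?n. s * u i * trans_prob i l) = s * u l" if "l < ?n" for l
      using u(2)[OF that] by (simp add: mult.assoc flip: sum_distrib_left)
    show "q_col \<sigma> h = s * u h / mean_len (\<lambda>i. s * u i)" if "h < ?n" for h
      using q[OF that] s(1) by (auto simp: mean_len_scale)
  qed (rule pos)
qed

theorem cnt_tendsto_phi:
  assumes ab: "0 \<le> a" "a < b" "b \<le> 1" and i: "i < ntypes \<sigma>"
  shows "((\<lambda>t. exp (- real DIM('a) * t) * real (cnt j a b i (exp t))) \<longlongrightarrow> phi \<sigma> j a b) at_top"
proof -
  obtain u where u: "\<And>i. i < ntypes \<sigma> \<Longrightarrow> u i > 0"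
    "\<And>l. l < ntypes \<sigma> \<Longrightarrow> (\<Sum>i<ntypes \<sigma>. u i * trans_prob i l) = u l"
    "\<And>h. h < ntypes \<sigma> \<Longrightarrow> q_col \<sigma> h = u h / mean_len u" by (rule q_col_eq) blast
  have "phi \<sigma> j a b = (\<Sum>i<ntypes \<sigma>. u i * (1 / real DIM('a) * (\<Sum>(l, \<alpha>, w) | (l, \<alpha>, w) \<in> set (rule \<sigma> i) \<and> l = j.
       \<alpha> ^ DIM('a) * (max a \<alpha> powi (- int DIM('a)) - max b \<alpha> powi (- int DIM('a)))))) / mean_len u"
    unfolding phi_def sum_divide_distrib using u(3) by (intro sum.cong refl) (simp add: sum_list_consts)
  then show ?thesis
    using cnt_limit[OF u(2)[unfolded trans_prob_def] _ mean_len_pos ab i, of j] u(1) by (simp add: less_imp_le)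
qed

end

section \<open>Convergence of tiles\<close>

lemma mem_nbhd: "x \<in> nbhd r A \<longleftrightarrow> (\<exists>a\<in>A. dist a x < r)"
  by (auto simp: nbhd_def)

lemma D_dist_less:
  assumes "D_dist A B < r" "r \<le> 1"
  obtains r0 where "0 < r0" "r0 < r" "A \<inter> ball 0 (1 / r0) \<subseteq> nbhd r0 B" "B \<inter> ball 0 (1 / r0) \<subseteq> nbhd r0 A"
proof -
  let ?S = "{r. r > 0 \<and> A \<inter> ball 0 (1 / r) \<subseteq> nbhd r B \<and> B \<inter> ball 0 (1 / r) \<subseteq> nbhd r A}"
  have "Inf (?S \<union> {1}) < r" using assms(1) by (simp add: D_dist_def)
  then obtain s where "s \<in> ?S \<union> {1}" "s < r" using cInf_lessD[of "?S \<union> {1}" r] by blast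
  then show ?thesis using assms(2) by (intro that[of s]) auto
qed

text \<open>\<open>D_dist\<close> compares sets only inside a large ball about the origin. The
  bounded limit lies in that ball, some point of \<open>As n\<close> is close to it, and the bound
  on diameters then places all of \<open>As n\<close> in the ball.\<close>

lemma D_lim_Hausdorff:
  fixes As :: "nat \<Rightarrow> 'a::euclidean_space set"
  assumes lim: "D_lim As A" and A: "bounded A" "A \<noteq> {}"
    and diam: "\<forall>\<^sub>F n in sequentially. \<forall>x\<in>As n. \<forall>y\<in>As n. dist x y \<le> B" and r: "r > 0"
  shows "\<forall>\<^sub>F n in sequentially. As n \<subseteq> nbhd r A \<and> A \<subseteq> nbhd r (As n)"
proof -
  obtain R where R: "\<And>x. x \<in> A \<Longrightarrow> norm x \<le> R" using A(1) by (auto simp: bounded_iff)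
  \<comment> \<open>A point of \<open>As n\<close> has norm at most R + 1 + B: reach of A, distance
    to A, diameter of \<open>As n\<close>.\<close>
  define Q where "Q = \<bar>R\<bar> + 2 + \<bar>B\<bar>"
  have Q: "Q > 0" by (simp add: Q_def)
  define r1 where "r1 = min r (min 1 (1 / Q))"
  have r1: "r1 > 0" "r1 \<le> 1" "r1 \<le> r" "r1 \<le> 1 / Q" using r Q by (auto simp: r1_def)
  have "\<forall>\<^sub>F n in sequentially. D_dist (As n) A < r1"
    using lim r1(1) unfolding D_lim_def by (rule order_tendstoD)
  then show ?thesis using diam
  proof eventually_elim
    case (elim n)
    obtain r0 where r0: "0 < r0" "r0 < r1" "As n \<inter> ball 0 (1 / r0) \<subseteq> nbhd r0 A" "A \<inter> ball 0 (1 / r0) \<subseteq> nbhd r0 (As n)"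
      by (rule D_dist_less[OF elim(1) r1(2)]) blast
    have "r0 < 1 / Q" using r0(2) r1(4) by linarith
    then have big: "Q < 1 / r0" using r0(1) Q by (simp add: field_simps)
    have "A \<subseteq> ball 0 (1 / r0)"
    proof
      fix x assume "x \<in> A"
      then have "norm x < 1 / r0" using R[of x] big by (simp add: Q_def)
      then show "x \<in> ball 0 (1 / r0)" by simp
    qed
    then have 1: "A \<subseteq> nbhd r0 (As n)" using r0(4) by blast
    obtain a where a: "a \<in> A" using A(2) by blast
    then have "a \<in> nbhd r0 (As n)" using 1 by blast
    then obtain y where y: "y \<in> As n" "dist y a < r0" by (auto simp: mem_nbhd)
    have "As n \<subseteq> ball 0 (1 / r0)"
    proof
      fix x assume x: "x \<in> As n"
      have "norm x \<le> norm a + dist y a + dist x y"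
        by (smt (verit) dist_norm norm_triangle_sub dist_triangle dist_commute)
      moreover have "dist x y \<le> B" using elim(2) x y(1) by blast
      ultimately have "norm x < 1 / r0" using R[OF a] y(2) r0(2) r1(2) big by (simp add: Q_def)
      then show "x \<in> ball 0 (1 / r0)" by simp
    qed
    then have 2: "As n \<subseteq> nbhd r0 A" using r0(3) by blast
    have "nbhd r0 X \<subseteq> nbhd r X" for X :: "'a set" 
    proof
      fix x assume "x \<in> nbhd r0 X"
      then obtain a where "a \<in> X" "dist a x < r0" by (auto simp: mem_nbhd)
      then show "x \<in> nbhd r X" using r0(2) r1(3) unfolding mem_nbhd by (intro bexI[of _ a]) auto
    qed
    then show ?case using 1 2 by blast
  qed
qed

text \<open>The supremum of a set in direction b, its support function, moves by at most r when the
  set moves by r in Hausdorff distance. For a copy of C it is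
  \<open>\<alpha> * inner x b + inner w b\<close>, with x a maximizer on C.\<close>

lemma copies_lim_direction:
  fixes C :: "'a::euclidean_space set"
  assumes haus: "\<And>r. r > 0 \<Longrightarrow> \<forall>\<^sub>F n in sequentially. copy (\<alpha>s n) (ws n) C \<subseteq> nbhd r (copy \<alpha> w C) \<and> copy \<alpha> w C \<subseteq> nbhd r (copy (\<alpha>s n) (ws n) C)"
    and pos: "\<forall>\<^sub>F n in sequentially. \<alpha>s n > 0" "\<alpha> > 0"
    and x: "x \<in> C" "\<And>y. y \<in> C \<Longrightarrow> inner y b \<le> inner x b" and b: "norm b = 1"
  shows "(\<lambda>n. \<alpha>s n * (inner x b) + inner (ws n) b) \<longlonglongrightarrow> \<alpha> * (inner x b) + inner w b"
proof (rule tendstoI)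
  fix \<epsilon> :: real assume eps: "\<epsilon> > 0"
  have step: "\<alpha>1 * (inner x b) + inner w1 b \<le> \<alpha>2 * (inner x b) + inner w2 b + \<epsilon> / 2"
    if "copy \<alpha>1 w1 C \<subseteq> nbhd (\<epsilon> / 2) (copy \<alpha>2 w2 C)" "\<alpha>2 > 0" for \<alpha>1 \<alpha>2 w1 w2
  proof -
    have "w1 + \<alpha>1 *\<^sub>R x \<in> nbhd (\<epsilon> / 2) (copy \<alpha>2 w2 C)" using that(1) x(1) by (auto simp: copy_def)
    then obtain c where c: "c \<in> C" "dist (w2 + \<alpha>2 *\<^sub>R c) (w1 + \<alpha>1 *\<^sub>R x) < \<epsilon> / 2" by (auto simp: mem_nbhd copy_def)
    have "inner (w1 + \<alpha>1 *\<^sub>R x - (w2 + \<alpha>2 *\<^sub>R c)) b \<le> norm (w1 + \<alpha>1 *\<^sub>R x - (w2 + \<alpha>2 *\<^sub>R c)) * norm b"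
      by (rule norm_cauchy_schwarz)
    also have "\<dots> \<le> \<epsilon> / 2" using c(2) b by (simp add: dist_norm norm_minus_commute)
    finally have "\<alpha>1 * (inner x b) + inner w1 b \<le> \<alpha>2 * (inner c b) + inner w2 b + \<epsilon> / 2"
      by (simp add: inner_diff_left inner_add_left)
    moreover have "\<alpha>2 * (inner c b) \<le> \<alpha>2 * (inner x b)" using x(2)[OF c(1)] that(2) by simp
    ultimately show ?thesis by linarith
  qed
  have "\<forall>\<^sub>F n in sequentially. copy (\<alpha>s n) (ws n) C \<subseteq> nbhd (\<epsilon> / 2) (copy \<alpha> w C) \<and> copy \<alpha> w C \<subseteq> nbhd (\<epsilon> / 2) (copy (\<alpha>s n) (ws n) C)"
    using eps by (intro haus) simp
  then show "\<forall>\<^sub>F n in sequentially. dist (\<alpha>s n * (inner x b) + inner (ws n) b) (\<alpha> * (inner x b) + inner w b) < \<epsilon>"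
    using pos(1)
  proof eventually_elim
    case (elim n)
    have "\<alpha>s n * (inner x b) + inner (ws n) b \<le> \<alpha> * (inner x b) + inner w b + \<epsilon> / 2"
      using elim pos(2) by (intro step) auto
    moreover have "\<alpha> * (inner x b) + inner w b \<le> \<alpha>s n * (inner x b) + inner (ws n) b + \<epsilon> / 2"
      using elim by (intro step) auto
    ultimately show ?case using eps by (simp add: dist_real_def abs_less_iff)
  qed
qed

text \<open>Adding the support functions in directions b and -b eliminates the position and leaves
  the scale times the width of C in direction b. Two distinct points of C give a coordinate
  direction of positive width. With the scale known, each coordinate of the position
  follows.\<close>

lemma copies_lim_params:
  fixes C :: "'a::euclidean_space set"
  assumes lim: "D_lim (\<lambda>n. copy (\<alpha>s n) (ws n) C) (copy \<alpha> w C)" and \<alpha>: "\<alpha> > 0"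
    and bd: "\<forall>\<^sub>F n in sequentially. 0 < \<alpha>s n \<and> \<alpha>s n \<le> hi"
    and C: "compact C" "x0 \<in> C" "y0 \<in> C" "x0 \<noteq> y0"
  shows "\<alpha>s \<longlonglongrightarrow> \<alpha>" "ws \<longlonglongrightarrow> w"
proof -
  obtain B where B: "\<And>x y. x \<in> C \<Longrightarrow> y \<in> C \<Longrightarrow> dist x y \<le> B"
    using compact_imp_bounded[OF C(1)] bounded_two_points by metis
  have B0: "B \<ge> 0" using B[OF C(2,2)] by simp
  have diam: "\<forall>\<^sub>F n in sequentially. \<forall>x\<in>copy (\<alpha>s n) (ws n) C. \<forall>y\<in>copy (\<alpha>s n) (ws n) C. dist x y \<le> hi * B"
    using bd
  proof eventually_elim
    case (elim n)
    show ?case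
    proof (intro ballI)
      fix x y assume "x \<in> copy (\<alpha>s n) (ws n) C" "y \<in> copy (\<alpha>s n) (ws n) C"
      then obtain x' y' where xy: "x' \<in> C" "y' \<in> C" "x = ws n + \<alpha>s n *\<^sub>R x'" "y = ws n + \<alpha>s n *\<^sub>R y'"
        by (auto simp: copy_def)
      then have "dist x y = \<alpha>s n * dist x' y'"
        using elim by (simp add: dist_norm flip: scaleR_diff_right)
      also have "\<dots> \<le> hi * B" using elim B[OF xy(1,2)] by (intro mult_mono) auto
      finally show "dist x y \<le> hi * B" .
    qed
  qed
  have haus: "\<forall>\<^sub>F n in sequentially. copy (\<alpha>s n) (ws n) C \<subseteq> nbhd r (copy \<alpha> w C) \<and> copy \<alpha> w C \<subseteq> nbhd r (copy (\<alpha>s n) (ws n) C)"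
    if "r > 0" for r
    by (rule D_lim_Hausdorff[OF lim _ _ diam that]) (use compact_imp_bounded[OF C(1)] C(2) in \<open>auto simp: copy_def intro: bounded_copy[unfolded copy_def]\<close>)
  have pos: "\<forall>\<^sub>F n in sequentially. \<alpha>s n > 0" using bd by eventually_elim auto
  have dir: "\<exists>x\<in>C. (\<forall>y\<in>C. inner y b \<le> inner x b) \<and> (\<lambda>n. \<alpha>s n * (inner x b) + inner (ws n) b) \<longlonglongrightarrow> \<alpha> * (inner x b) + inner w b"
    if "norm b = 1" for b :: 'a
  proof -
    obtain x where x: "x \<in> C" "\<forall>y\<in>C. inner y b \<le> inner x b"
    proof -
      have "C \<noteq> {}" "continuous_on C (\<lambda>y. inner y b)" using C(2) by (auto intro!: continuous_intros)
      then show ?thesis using continuous_attains_sup[OF C(1)] that by blast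
    qed
    then show ?thesis using copies_lim_direction[OF haus pos \<alpha> x(1) _ that] by blast
  qed
  obtain b where b: "b \<in> Basis" "inner x0 b \<noteq> inner y0 b" using C(4) euclidean_eq_iff by blast
  then have nb: "norm b = 1" by simp
  obtain x1 where x1: "x1 \<in> C" "\<forall>y\<in>C. inner y b \<le> inner x1 b" "(\<lambda>n. \<alpha>s n * (inner x1 b) + inner (ws n) b) \<longlonglongrightarrow> \<alpha> * (inner x1 b) + inner w b"
    using dir[OF nb] by blast
  obtain x2 where x2: "x2 \<in> C" "\<forall>y\<in>C. inner y (- b) \<le> inner x2 (- b)" "(\<lambda>n. \<alpha>s n * (inner x2 (- b)) + inner (ws n) (- b)) \<longlonglongrightarrow> \<alpha> * (inner x2 (- b)) + inner w (- b)"
    using dir[of "- b"] nb by auto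
  have ne: "inner x1 b - inner x2 b \<noteq> 0"
    using x1(2) x2(2) b(2) C(2,3) by (smt (verit) inner_minus_right)
  have "(\<lambda>n. ((\<alpha>s n * (inner x1 b) + inner (ws n) b) + (\<alpha>s n * (inner x2 (- b)) + inner (ws n) (- b))) / (inner x1 b - inner x2 b))
     \<longlonglongrightarrow> ((\<alpha> * (inner x1 b) + inner w b) + (\<alpha> * (inner x2 (- b)) + inner w (- b))) / (inner x1 b - inner x2 b)"
    by (intro tendsto_intros x1(3) x2(3) ne)
  moreover have "((c * (inner x1 b) + inner z b) + (c * (inner x2 (- b)) + inner z (- b))) / (inner x1 b - inner x2 b) = c" for c z
  proof -
    have "(c * (inner x1 b) + inner z b) + (c * (inner x2 (- b)) + inner z (- b)) = c * (inner x1 b - inner x2 b)"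
      by (simp add: right_diff_distrib)
    then show ?thesis using ne by simp
  qed
  ultimately show al: "\<alpha>s \<longlonglongrightarrow> \<alpha>" by simp
  show "ws \<longlonglongrightarrow> w"
  proof (subst tendsto_componentwise_iff, intro ballI)
    fix b :: 'a assume "b \<in> Basis"
    then obtain x where x: "(\<lambda>n. \<alpha>s n * (inner x b) + inner (ws n) b) \<longlonglongrightarrow> \<alpha> * (inner x b) + inner w b" using dir[of b] by auto
    have "(\<lambda>n. (\<alpha>s n * (inner x b) + inner (ws n) b) - \<alpha>s n * (inner x b)) \<longlonglongrightarrow> (\<alpha> * (inner x b) + inner w b) - \<alpha> * (inner x b)"
      by (intro tendsto_intros x al)
    then show "(\<lambda>n. inner (ws n) b) \<longlonglongrightarrow> inner w b" by simp
  qed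
qed

text \<open>A ray from an interior point z distinct from c, pointing away from c, leaves the bounded
  set X and so crosses its frontier at a point other than c. Used twice, this gives the two boundary
  points needed to recover a scale.\<close>

lemma frontier_not_singleton:
  fixes X :: "'a::euclidean_space set"
  assumes "bounded X" "interior X \<noteq> {}" shows "\<exists>q\<in>frontier X. q \<noteq> c"
proof -
  have "infinite (interior X)" using assms(2) open_interior[of X] finite_imp_not_open by blast
  then have "interior X - {c} \<noteq> {}" by (metis finite.emptyI finite_Diff_insert infinite_remove)
  then obtain z where z: "z \<in> interior X" "z \<noteq> c" by blast
  define L where "L = (\<lambda>t::real. z + t *\<^sub>R (z - c)) ` {0..}"
  have "connected L" unfolding L_def by (intro connected_continuous_image continuous_intros) auto
  moreover have "z \<in> L" unfolding L_def by (intro image_eqI[of _ _ 0]) auto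
  then have "L \<inter> X \<noteq> {}" using z interior_subset by blast
  moreover have "L - X \<noteq> {}"
  proof
    assume "L - X = {}"
    then have "L \<subseteq> X" by blast
    then have "bounded L" using assms(1) bounded_subset by blast
    then obtain B where B: "\<And>y. y \<in> L \<Longrightarrow> norm y \<le> B" by (auto simp: bounded_iff)
    define t where "t = (\<bar>B\<bar> + norm z + 1) / norm (z - c)"
    have "norm (t *\<^sub>R (z - c)) = \<bar>B\<bar> + norm z + 1" using z(2) by (simp add: t_def)
    moreover have "norm (t *\<^sub>R (z - c)) \<le> norm (z + t *\<^sub>R (z - c)) + norm z"
      by (metis add_diff_cancel_left' norm_triangle_ineq4 add.commute)
    moreover have "t \<ge> 0" by (simp add: t_def)
    then have "norm (z + t *\<^sub>R (z - c)) \<le> B" by (intro B) (auto simp: L_def)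
    ultimately show False by linarith
  qed
  ultimately have "L \<inter> frontier X \<noteq> {}" by (rule connected_Int_frontier)
  then obtain t where t: "t \<ge> 0" "z + t *\<^sub>R (z - c) \<in> frontier X" by (auto simp: L_def)
  have "z + t *\<^sub>R (z - c) \<noteq> c"
  proof
    assume "z + t *\<^sub>R (z - c) = c"
    then have "(1 + t) *\<^sub>R (z - c) = 0" by (simp add: algebra_simps)
    then show False using t z by simp
  qed
  then show ?thesis using t by blast
qed

text \<open>The inverse affine maps converge uniformly on K, and the image of K under the limit map
  keeps a positive distance \<delta> from the complement of the interior of X.\<close>

lemma copies_converge_inside:
  fixes X :: "'a::euclidean_space set"
  assumes "\<alpha>s \<longlonglongrightarrow> \<alpha>" "ws \<longlonglongrightarrow> w" "\<alpha> > 0" "compact K" "K \<subseteq> interior (copy \<alpha> w X)"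
  shows "\<forall>\<^sub>F n in sequentially. K \<subseteq> interior (copy (\<alpha>s n) (ws n) X)"
proof -
  define f where "f c z x = (1 / c) *\<^sub>R (x - z)" for c :: real and z x :: 'a
  have "continuous_on K (f \<alpha> w)" unfolding f_def by (intro continuous_intros)
  then have K': "compact (f \<alpha> w ` K)" using assms(4) compact_continuous_image by blast
  have sub: "f \<alpha> w ` K \<subseteq> interior X"
  proof
    fix y assume "y \<in> f \<alpha> w ` K"
    then obtain x where x: "x \<in> K" "y = f \<alpha> w x" by blast
    then have "x \<in> copy \<alpha> w (interior X)" using assms(3,5) interior_copy[of \<alpha> w X] by auto
    then show "y \<in> interior X" using assms(3) by (auto simp: x(2) f_def copy_def)
  qed
  obtain \<delta> where \<delta>: "\<delta> > 0" "(\<Union>x\<in>f \<alpha> w ` K. ball x \<delta>) \<subseteq> interior X"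
    using compact_subset_open_imp_ball_epsilon_subset[OF K' open_interior sub] by blast
  obtain B where B: "\<And>x. x \<in> K \<Longrightarrow> norm x \<le> B" using compact_imp_bounded[OF assms(4)] by (auto simp: bounded_iff)
  have "(\<lambda>n. \<bar>1 / \<alpha>s n - 1 / \<alpha>\<bar> * \<bar>B\<bar> + norm ((1 / \<alpha>s n) *\<^sub>R ws n - (1 / \<alpha>) *\<^sub>R w)) \<longlonglongrightarrow> 
      \<bar>1 / \<alpha> - 1 / \<alpha>\<bar> * \<bar>B\<bar> + norm ((1 / \<alpha>) *\<^sub>R w - (1 / \<alpha>) *\<^sub>R w)"
    using assms(3) by (intro tendsto_intros assms(1,2)) auto
  then have "\<forall>\<^sub>F n in sequentially. \<bar>1 / \<alpha>s n - 1 / \<alpha>\<bar> * \<bar>B\<bar> + norm ((1 / \<alpha>s n) *\<^sub>R ws n - (1 / \<alpha>) *\<^sub>R w) < \<delta>"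
    by (rule order_tendstoD) (use \<delta> in simp)
  moreover have "\<forall>\<^sub>F n in sequentially. \<alpha>s n > 0" using assms(1,3) order_tendstoD by blast
  ultimately show ?thesis
  proof eventually_elim
    case (elim n)
    show ?case
    proof
      fix x assume x: "x \<in> K"
      have "f (\<alpha>s n) (ws n) x - f \<alpha> w x = (1 / \<alpha>s n - 1 / \<alpha>) *\<^sub>R x - ((1 / \<alpha>s n) *\<^sub>R ws n - (1 / \<alpha>) *\<^sub>R w)"
        by (simp add: f_def scaleR_diff_right scaleR_diff_left)
      then have "norm (f (\<alpha>s n) (ws n) x - f \<alpha> w x) \<le> \<bar>1 / \<alpha>s n - 1 / \<alpha>\<bar> * norm x + norm ((1 / \<alpha>s n) *\<^sub>R ws n - (1 / \<alpha>) *\<^sub>R w)"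
        using norm_triangle_ineq4 by (metis norm_scaleR real_norm_def)
      also have "\<dots> \<le> \<bar>1 / \<alpha>s n - 1 / \<alpha>\<bar> * \<bar>B\<bar> + norm ((1 / \<alpha>s n) *\<^sub>R ws n - (1 / \<alpha>) *\<^sub>R w)"
        using B[OF x] by (intro add_right_mono mult_left_mono) auto
      also have "\<dots> < \<delta>" by (rule elim(1))
      finally have "f (\<alpha>s n) (ws n) x \<in> ball (f \<alpha> w x) \<delta>" by (simp add: dist_norm norm_minus_commute)
      then have "f (\<alpha>s n) (ws n) x \<in> interior X" using \<delta>(2) x by blast
      moreover have "x = ws n + \<alpha>s n *\<^sub>R f (\<alpha>s n) (ws n) x" using elim(2) by (simp add: f_def)
      ultimately show "x \<in> interior (copy (\<alpha>s n) (ws n) X)"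
        using elim(2) interior_copy[of "\<alpha>s n" "ws n" X] unfolding copy_def by (metis image_eqI less_irrefl)
    qed
  qed
qed

lemma copies_converge_pointwise:
  fixes X :: "'a::euclidean_space set"
  assumes "\<alpha>s \<longlonglongrightarrow> \<alpha>" "ws \<longlonglongrightarrow> w" "bounded X" "r > 0"
  shows "\<forall>\<^sub>F n in sequentially. \<forall>x\<in>X. dist (ws n + \<alpha>s n *\<^sub>R x) (w + \<alpha> *\<^sub>R x) < r"
proof -
  obtain B where B: "\<And>x. x \<in> X \<Longrightarrow> norm x \<le> B" using assms(3) by (auto simp: bounded_iff)
  have "(\<lambda>n. norm (ws n - w) + \<bar>\<alpha>s n - \<alpha>\<bar> * \<bar>B\<bar>) \<longlonglongrightarrow> norm (w - w) + \<bar>\<alpha> - \<alpha>\<bar> * \<bar>B\<bar>"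
    by (intro tendsto_intros assms(1,2))
  then have "\<forall>\<^sub>F n in sequentially. norm (ws n - w) + \<bar>\<alpha>s n - \<alpha>\<bar> * \<bar>B\<bar> < r"
    by (rule order_tendstoD) (use assms in simp)
  then show ?thesis
  proof eventually_elim
    case (elim n)
    show ?case
    proof
      fix x assume x: "x \<in> X"
      have "(ws n + \<alpha>s n *\<^sub>R x) - (w + \<alpha> *\<^sub>R x) = (ws n - w) + (\<alpha>s n - \<alpha>) *\<^sub>R x" by (simp add: algebra_simps)
      then have "dist (ws n + \<alpha>s n *\<^sub>R x) (w + \<alpha> *\<^sub>R x) \<le> norm (ws n - w) + \<bar>\<alpha>s n - \<alpha>\<bar> * norm x"
        unfolding dist_norm by (metis norm_triangle_ineq norm_scaleR real_norm_def)
      also have "\<dots> \<le> norm (ws n - w) + \<bar>\<alpha>s n - \<alpha>\<bar> * \<bar>B\<bar>"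
        using B[OF x] by (intro add_left_mono mult_left_mono) auto
      finally show "dist (ws n + \<alpha>s n *\<^sub>R x) (w + \<alpha> *\<^sub>R x) < r" using elim by linarith
    qed
  qed
qed

lemma tile_inner_compact:
  assumes "tile X" "e > 0"
  obtains K where "compact K" "K \<subseteq> interior X" "X - K \<in> lmeasurable" "measure lebesgue (X - K) < e"
proof -
  have "interior X \<in> sets lebesgue" by simp
  then obtain K where K: "closed K" "K \<subseteq> interior X" "interior X - K \<in> lmeasurable" "emeasure lebesgue (interior X - K) < ennreal e"
    using sets_lebesgue_inner_closed[OF _ assms(2)] by metis
  have bX: "bounded X" using assms by (simp add: tile_def)
  then have "bounded K" using K(2) interior_subset bounded_subset by (meson subset_trans)
  then have cK: "compact K" using K(1) by (simp add: compact_eq_bounded_closed)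
  have XK: "X - K \<in> lmeasurable" using tile_lmeasurable[OF assms(1)] cK by (intro fmeasurable.Diff) (auto intro: lmeasurable_compact)
  have N: "frontier X \<in> null_sets lebesgue" using assms(1) by (simp add: tile_def)
  have "emeasure lebesgue (X - K) \<le> emeasure lebesgue ((interior X - K) \<union> frontier X)"
    using K(3) N closure_subset[of X] by (intro emeasure_mono) (auto simp: frontier_def)
  also have "\<dots> = emeasure lebesgue (interior X - K)"
    using K(3) N by (intro emeasure_Un_null_set) auto
  also have "\<dots> < ennreal e" by (rule K(4))
  finally have "emeasure lebesgue (X - K) < ennreal e" .
  then have "measure lebesgue (X - K) < e"
    using XK assms(2) by (simp add: emeasure_eq_measure2 ennreal_less_iff)
  then show ?thesis using that cK K(2) XK by blast
qed

text \<open>Volumes of tiles with disjoint interiors add up inside U. The bound is uniform over the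
  finite subfamilies of P, so P is itself finite.\<close>

lemma disjoint_tiles_card_bound:
  assumes tiles: "\<And>X. X \<in> P \<Longrightarrow> tile X" and disj: "pairwise (\<lambda>X Y. disjnt (interior X) (interior Y)) P"
    and big: "\<And>X. X \<in> P \<Longrightarrow> c0 \<le> measure lebesgue X" and c0: "c0 > 0"
    and U: "U \<in> lmeasurable" "\<And>X. X \<in> P \<Longrightarrow> X \<subseteq> U"
  shows "finite P" "real (card P) * c0 \<le> measure lebesgue U"
proof -
  have bound: "real (card F) * c0 \<le> measure lebesgue U" if F: "F \<subseteq> P" "finite F" for F
  proof -
    have t: "tessellation (\<Union>F) F"
      using F tiles pairwise_subset[OF disj F(1)] by (auto simp: tessellation_def)
    have "real (card F) * c0 = (\<Sum>X\<in>F. c0)" by simp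
    also have "\<dots> \<le> (\<Sum>X\<in>F. measure lebesgue X)" using big F by (intro sum_mono) auto
    also have "\<dots> = measure lebesgue (\<Union>F)" using tessellation_measure[OF t F(2)] by simp
    also have "\<dots> \<le> measure lebesgue U"
      using U F tiles by (intro measure_mono_fmeasurable) (auto intro!: sets.finite_Union simp: tile_def)
    finally show ?thesis .
  qed
  have "card F \<le> nat \<lfloor>measure lebesgue U / c0\<rfloor>" if "F \<subseteq> P" "finite F" for F
    using bound[OF that] c0 by (simp add: le_nat_floor field_simps)
  then show fin: "finite P" using finite_if_finite_subsets_card_bdd by blast
  show "real (card P) * c0 \<le> measure lebesgue U" by (rule bound[OF subset_refl fin])
qed

text \<open>A collar of fixed width around the boundary of a large supertile is a rescaled thin
  collar around the boundary of a prototile, so its relative volume tends to 0.\<close>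

lemma copy_nbhd:
  fixes C :: "'a::euclidean_space set"
  assumes "\<gamma> > 0" shows "nbhd r (copy \<gamma> z C) = copy \<gamma> z (nbhd (r / \<gamma>) C)"
proof (rule Set.set_eqI)
  fix x
  define x' where "x' = (1 / \<gamma>) *\<^sub>R (x - z)"
  have x: "x = z + \<gamma> *\<^sub>R x'" using assms by (simp add: x'_def)
  have d: "dist (z + \<gamma> *\<^sub>R c) (z + \<gamma> *\<^sub>R y) = \<gamma> * dist c y" for c y
    using assms by (simp add: dist_norm flip: scaleR_diff_right)
  have "x \<in> nbhd r (copy \<gamma> z C) \<longleftrightarrow> (\<exists>c\<in>C. \<gamma> * dist c x' < r)"
    unfolding x mem_nbhd copy_def bex_simps d ..
  also have "\<dots> \<longleftrightarrow> x' \<in> nbhd (r / \<gamma>) C" using assms by (simp add: mem_nbhd field_simps)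
  also have "\<dots> \<longleftrightarrow> x \<in> copy \<gamma> z (nbhd (r / \<gamma>) C)" using assms unfolding x copy_def by auto
  finally show "x \<in> nbhd r (copy \<gamma> z C) \<longleftrightarrow> x \<in> copy \<gamma> z (nbhd (r / \<gamma>) C)" .
qed

lemma open_nbhd: "open (nbhd r A)" unfolding nbhd_def by (intro open_UN ballI open_ball)

lemma bounded_nbhd:
  assumes "bounded A" shows "bounded (nbhd r A)"
proof -
  obtain B where B: "\<And>x. x \<in> A \<Longrightarrow> norm x \<le> B" using assms by (auto simp: bounded_iff)
  have "norm y \<le> B + \<bar>r\<bar>" if y: "y \<in> nbhd r A" for y
  proof -
    obtain a where a: "a \<in> A" "dist a y < r" using y by (auto simp: mem_nbhd)
    then have "norm y \<le> norm a + dist a y" by (metis dist_norm norm_triangle_sub dist_commute)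
    then show ?thesis using a B[OF a(1)] by linarith
  qed
  then show ?thesis by (auto simp: bounded_iff)
qed

lemma lmeasurable_nbhd: "bounded A \<Longrightarrow> nbhd r A \<in> lmeasurable"
  by (intro lmeasurable_open bounded_nbhd open_nbhd)

text \<open>Outer regularity encloses the null set in an open set of small measure, which by
  compactness contains a whole neighborhood of positive radius.\<close>

lemma measure_nbhd_null_small:
  fixes C :: "'a::euclidean_space set"
  assumes "compact C" "negligible C" "e > 0"
  obtains \<delta> where "\<delta> > 0" "\<And>r. r \<le> \<delta> \<Longrightarrow> measure lebesgue (nbhd r C) \<le> e"
proof -
  have "C \<in> sets lebesgue" using assms negligible_imp_sets by blast
  then obtain U where U: "open U" "C \<subseteq> U" "U - C \<in> lmeasurable" "emeasure lebesgue (U - C) < ennreal e"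
    using sets_lebesgue_outer_open[OF _ assms(3)] by metis
  obtain \<delta> where \<delta>: "\<delta> > 0" "(\<Union>x\<in>C. ball x \<delta>) \<subseteq> U"
    using compact_subset_open_imp_ball_epsilon_subset[OF assms(1) U(1,2)] by blast
  have UC: "(U - C) \<union> C = U" using U(2) by blast
  have Um: "U \<in> lmeasurable" using U(3) negligible_imp_measurable[OF assms(2)] fmeasurable.Un UC by metis
  have "measure lebesgue U = measure lebesgue (U - C)"
    using measure_Un_null_set[of "U - C" lebesgue C] U(3) assms(2) UC by (auto simp: negligible_iff_null_sets)
  also have "\<dots> < e" using U(3,4) assms(3) by (simp add: emeasure_eq_measure2 ennreal_less_iff)
  finally have mU: "measure lebesgue U < e" .
  have "measure lebesgue (nbhd r C) \<le> e" if "r \<le> \<delta>" for r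
  proof -
    have "nbhd r C \<subseteq> U" using \<delta>(2) that by (fastforce simp: nbhd_def)
    then have "measure lebesgue (nbhd r C) \<le> measure lebesgue U"
      using Um lmeasurable_nbhd[OF compact_imp_bounded[OF assms(1)], of r] by (intro measure_mono_fmeasurable) auto
    then show ?thesis using mU by simp
  qed
  then show ?thesis using that \<delta>(1) by blast
qed

lemma ball_subset_of_far_frontier:
  fixes X :: "'a::euclidean_space set"
  assumes "x \<in> X" "x \<notin> nbhd r (frontier X)" "r > 0" shows "ball x r \<subseteq> X"
proof (rule ccontr)
  assume "\<not> ball x r \<subseteq> X"
  moreover have "x \<in> ball x r \<inter> X" using assms by simp
  ultimately have "ball x r \<inter> X \<noteq> {}" "ball x r - X \<noteq> {}" by blast+
  then have "ball x r \<inter> frontier X \<noteq> {}"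
    by (intro connected_Int_frontier connected_ball)
  then show False using assms(2) by (auto simp: mem_nbhd dist_commute)
qed

section \<open>Scales of the tiles of a stationary tiling, and its supertiles\<close>

context normalized_scheme
begin

lemma FT_translate:
  assumes "i < ntypes \<sigma>" "x > 0" shows "copies 1 u (FT i x v) = FT i x (u + v)"
  using assms
proof (induction i x v rule: tile_induct)
  case (step i x v)
  show ?case
  proof (cases "x > 1")
    case False
    then show ?thesis using step by (simp add: FT_small copies_def copy_copy)
  next
    case True
    have "copies 1 u (FT i x v) = (\<Union>(l, \<alpha>, w)\<in>set (rule \<sigma> i). copies 1 u (FT l (x * \<alpha>) (v + x *\<^sub>R w)))"
      unfolding FT_large[OF step(1) True] copies_def by auto
    also have "\<dots> = (\<Union>(l, \<alpha>, w)\<in>set (rule \<sigma> i). FT l (x * \<alpha>) (u + (v + x *\<^sub>R w)))"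
      using step(3)[OF True] by auto
    finally show ?thesis unfolding FT_large[OF step(1) True] by (simp add: add.assoc)
  qed
qed

lemma stationary_tiling: "stationary \<sigma> s S \<Longrightarrow> tiling S"
  by (auto simp: stationary_def tiling_space_def)

lemma stationary_pos: "stationary \<sigma> s S \<Longrightarrow> s > 0"
  by (auto simp: stationary_def return_time_def)

lemma stationary_cases:
  assumes "stationary \<sigma> s S" "Z \<in> S"
  obtains l y w where "l < ntypes \<sigma>" "min_ratio \<le> y" "y \<le> 1" "Z = copy y w (proto \<sigma> l)"
proof -
  obtain i a k where k: "i < ntypes \<sigma>" "a \<ge> 0" "Z \<in> FT i (exp (a + real k * s)) 0"
    using assms unfolding stationary_def flow_proto by auto
  have "exp (a + real k * s) \<ge> 1" using k(2) stationary_pos[OF assms(1)] by simp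
  then have m: "min (exp (a + real k * s)) min_ratio = min_ratio" using min_ratio(2) by (intro min_absorb2) linarith
  show ?thesis by (rule FT_tile_cases[OF k(1) _ k(3)]) (use that m in auto)
qed

text \<open>The semiflow property with factor \<open>exp (real m * s)\<close> carries the k-th patch
  of the nested union into the (m + k)-th. Every supertile of the stationary tiling is thus
  subdivided inside it exactly as the flow prescribes.\<close>

lemma stationary_supertile:
  assumes "stationary \<sigma> s S" "copy y w (proto \<sigma> l) \<in> S" "l < ntypes \<sigma>" "y > 0"
  shows "FT l (exp (real m * s) * y) (exp (real m * s) *\<^sub>R w) \<subseteq> S"
proof -
  obtain i a where ia: "i < ntypes \<sigma>" "S = (\<Union>k::nat. FT i (exp (a + real k * s)) 0)"
    using assms(1) unfolding stationary_def flow_proto by auto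
  then obtain k where k: "copy y w (proto \<sigma> l) \<in> FT i (exp (a + real k * s)) 0" using assms(2) by auto
  have "exp (real m * s) \<ge> 1" using stationary_pos[OF assms(1)] by simp
  then have "FT l (exp (real m * s) * y) (exp (real m * s) *\<^sub>R w) \<subseteq> FT i (exp (real m * s) * exp (a + real k * s)) (exp (real m * s) *\<^sub>R 0)"
    by (intro FT_semiflow[OF ia(1) _ _ assms(3,4) k]) auto
  also have "\<dots> = FT i (exp (a + real (m + k) * s)) 0" by (simp add: algebra_simps flip: exp_add)
  also have "\<dots> \<subseteq> S" unfolding ia(2) by blast
  finally show ?thesis .
qed

lemma proto_bound:
  obtains B where "B > 0" "\<And>l x. l < ntypes \<sigma> \<Longrightarrow> x \<in> proto \<sigma> l \<Longrightarrow> norm x \<le> B"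
proof -
  have "bounded (\<Union>l<ntypes \<sigma>. proto \<sigma> l)"
    using tile_proto by (auto simp: tile_def)
  then obtain B where "B > 0" "\<And>x. x \<in> (\<Union>l<ntypes \<sigma>. proto \<sigma> l) \<Longrightarrow> norm x \<le> B" by (auto simp: bounded_pos)
  then show ?thesis using that by blast
qed

end

section \<open>Supertiles\<close>

text \<open>A tile of S outside F can meet the interior of Y only in frontiers of tiles of F, up to
  its own boundary; but a nonempty open set is not contained in a null set.\<close>

lemma tile_mem_tessellation:
  assumes disj: "pairwise (\<lambda>X Y. disjnt (interior X) (interior Y)) S" and F: "F \<subseteq> S" "finite F" "tessellation Y F"
    and Z: "Z \<in> S" "interior Z \<inter> interior Y \<noteq> {}"
  shows "Z \<in> F"
proof (rule ccontr)
  assume ZF: "Z \<notin> F"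
  have "interior Z \<inter> interior Y \<subseteq> (\<Union>A\<in>F. frontier A)"
  proof
    fix x assume x: "x \<in> interior Z \<inter> interior Y"
    then have "x \<in> Y" using interior_subset by blast
    then obtain A where A: "A \<in> F" "x \<in> A" using F(3) by (auto simp: tessellation_def)
    have "A \<in> S" "Z \<noteq> A" using A(1) F(1) ZF by auto
    then have "disjnt (interior Z) (interior A)" by (rule pairwiseD[OF disj Z(1)])
    then have "x \<notin> interior A" using x by (auto simp: disjnt_def)
    then have "x \<in> frontier A" using A(2) closure_subset by (auto simp: frontier_def)
    then show "x \<in> (\<Union>A\<in>F. frontier A)" using A(1) by blast
  qed
  moreover have "negligible (\<Union>A\<in>F. frontier A)"
    using F(2,3) by (intro negligible_Union finite_imageI) (auto simp: tessellation_def tile_def negligible_iff_null_sets)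
  ultimately have "negligible (interior Z \<inter> interior Y)" using negligible_subset by blast
  then show False using open_not_negligible[of "interior Z \<inter> interior Y"] Z(2) by auto
qed

text \<open>If the tiles \<open>ap X n\<close> of \<open>Ss n\<close> approximate the tiles \<open>X \<in> G\<close>, then for large \<open>n\<close> they leave too little
  volume in \<open>U\<close> for any other tile of \<open>Ss n\<close>.\<close>

lemma tiling_coverage:
  fixes G :: "'a::euclidean_space set set" and ap :: "'a set \<Rightarrow> nat \<Rightarrow> 'a set"
  assumes G: "finite G" "\<And>X. X \<in> G \<Longrightarrow> tile X"
    and ap: "\<And>X. X \<in> G \<Longrightarrow> \<forall>\<^sub>F n in sequentially. ap X n \<in> Ss n"
    and inside: "\<And>X K. X \<in> G \<Longrightarrow> compact K \<Longrightarrow> K \<subseteq> interior X \<Longrightarrow> \<forall>\<^sub>F n in sequentially. K \<subseteq> interior (ap X n)"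
    and disj: "\<And>n. pairwise (\<lambda>X Y. disjnt (interior X) (interior Y)) (Ss n)"
    and big: "\<And>n Y. Y \<in> Ss n \<Longrightarrow> tile Y \<and> c0 \<le> measure lebesgue Y" and c0: "c0 > 0"
    and U: "U \<subseteq> \<Union>G"
  shows "\<forall>\<^sub>F n in sequentially. \<forall>Y\<in>Ss n. Y \<subseteq> U \<longrightarrow> (\<exists>X\<in>G. Y = ap X n)"
proof -
  \<comment> \<open>The parts of the tiles of G outside the compact cores have total volume below
    \<open>c0\<close>, the least volume of a tile of \<open>Ss n\<close>.\<close>
  define e where "e = c0 / (real (card G) + 1)"
  have e: "e > 0" "real (card G) * e < c0" using c0 by (auto simp: e_def field_simps)
  have "\<forall>X\<in>G. \<exists>K. compact K \<and> K \<subseteq> interior X \<and> X - K \<in> lmeasurable \<and> measure lebesgue (X - K) < e"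
    using tile_inner_compact[OF G(2) e(1)] by metis
  then obtain K where K: "\<And>X. X \<in> G \<Longrightarrow> compact (K X)" "\<And>X. X \<in> G \<Longrightarrow> K X \<subseteq> interior X"
    "\<And>X. X \<in> G \<Longrightarrow> X - K X \<in> lmeasurable" "\<And>X. X \<in> G \<Longrightarrow> measure lebesgue (X - K X) < e" by metis
  have "\<forall>\<^sub>F n in sequentially. \<forall>X\<in>G. ap X n \<in> Ss n \<and> K X \<subseteq> interior (ap X n)"
    using G(1) ap inside K by (intro eventually_ball_finite ballI eventually_conj) auto
  then show ?thesis
  proof eventually_elim
    case (elim n)
    show ?case
    proof (intro ballI impI, rule ccontr)
      fix Y assume Y: "Y \<in> Ss n" "Y \<subseteq> U" "\<not> (\<exists>X\<in>G. Y = ap X n)"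
      have "interior Y \<subseteq> (\<Union>X\<in>G. X - K X)"
      proof
        fix x assume x: "x \<in> interior Y"
        then have "x \<in> \<Union>G" using Y(2) U interior_subset by blast
        then obtain X where X: "X \<in> G" "x \<in> X" by blast
        have "ap X n \<in> Ss n" "Y \<noteq> ap X n" using elim X(1) Y(3) by auto
        then have "disjnt (interior Y) (interior (ap X n))" by (rule pairwiseD[OF disj Y(1)])
        then have "x \<notin> K X" using x elim X(1) by (auto simp: disjnt_def)
        then show "x \<in> (\<Union>X\<in>G. X - K X)" using X by blast
      qed
      moreover have Un: "(\<Union>X\<in>G. X - K X) \<in> lmeasurable" using G(1) K(3) by (intro fmeasurable.finite_UN) auto
      ultimately have "measure lebesgue (interior Y) \<le> measure lebesgue (\<Union>X\<in>G. X - K X)"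
        by (intro measure_mono_fmeasurable) auto
      also have "\<dots> \<le> (\<Sum>X\<in>G. measure lebesgue (X - K X))"
        using G(1) K(3) by (intro measure_UNION_le) auto
      also have "\<dots> \<le> (\<Sum>X\<in>G. e)" using K(4) by (intro sum_mono) (auto intro: less_imp_le)
      also have "\<dots> < c0" using e(2) by simp
      finally have "measure lebesgue (interior Y) < c0" .
      moreover have "measure lebesgue (interior Y) = measure lebesgue Y"
        using big[OF Y(1)] by (intro measure_interior) (auto simp: tile_def negligible_iff_null_sets)
      ultimately show False using big[OF Y(1)] by simp
    qed
  qed
qed

context normalized_scheme
begin

text \<open>Convergence of a tile means convergence of the frontiers of tiles of the same type, that
  is, of copies of one compact set. The bound \<open>lo\<close> keeps the scales positive and
  \<open>hi\<close> bounds the diameters, as the recovery of the parameters requires.\<close>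

lemma tiling_lim_params:
  assumes lim: "tiling_lim \<sigma> Ss \<T>"
    and cases: "\<And>n Z. Z \<in> Ss n \<Longrightarrow> \<exists>l y w. l < ntypes \<sigma> \<and> lo \<le> y \<and> y \<le> hi \<and> Z = copy y w (proto \<sigma> l)"
    and lo: "lo > 0" and X: "copy \<alpha> w (proto \<sigma> j) \<in> \<T>" "j < ntypes \<sigma>" "\<alpha> > 0"
  shows "\<exists>\<alpha>s ws. \<alpha>s \<longlonglongrightarrow> \<alpha> \<and> ws \<longlonglongrightarrow> w \<and>
    (\<forall>\<^sub>F n in sequentially. copy (\<alpha>s n) (ws n) (proto \<sigma> j) \<in> Ss n \<and> lo \<le> \<alpha>s n \<and> \<alpha>s n \<le> hi)"
proof -
  let ?C = "frontier (proto \<sigma> j)"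
  have "has_type \<sigma> j (copy \<alpha> w (proto \<sigma> j))" using X by (simp add: has_type_copy_iff)
  then obtain Xs where Xs: "\<forall>\<^sub>F n in sequentially. Xs n \<in> Ss n \<and> has_type \<sigma> j (Xs n)"
    "D_lim (\<lambda>n. frontier (Xs n)) (frontier (copy \<alpha> w (proto \<sigma> j)))"
    using lim X(1) unfolding tiling_lim_def by blast
  have "\<exists>y u. Xs n \<in> Ss n \<and> has_type \<sigma> j (Xs n) \<longrightarrow> lo \<le> y \<and> y \<le> hi \<and> Xs n = copy y u (proto \<sigma> j)" for n
  proof (cases "Xs n \<in> Ss n \<and> has_type \<sigma> j (Xs n)")
    case True
    then obtain l y u where lyu: "l < ntypes \<sigma>" "lo \<le> y" "y \<le> hi" "Xs n = copy y u (proto \<sigma> l)" using cases by metis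
    then have "l = j" using True lo has_type_copy_iff[of l y j u] by simp
    then show ?thesis using lyu by blast
  qed auto
  then obtain \<alpha>s ws where aw: "\<And>n. Xs n \<in> Ss n \<and> has_type \<sigma> j (Xs n) \<Longrightarrow>
      lo \<le> \<alpha>s n \<and> \<alpha>s n \<le> hi \<and> Xs n = copy (\<alpha>s n) (ws n) (proto \<sigma> j)" by metis
  have ev: "\<forall>\<^sub>F n in sequentially. copy (\<alpha>s n) (ws n) (proto \<sigma> j) \<in> Ss n \<and> lo \<le> \<alpha>s n \<and> \<alpha>s n \<le> hi"
    using Xs(1) by eventually_elim (use aw in force)
  have "\<forall>\<^sub>F n in sequentially. D_dist (frontier (Xs n)) (frontier (copy \<alpha> w (proto \<sigma> j))) = D_dist (copy (\<alpha>s n) (ws n) ?C) (copy \<alpha> w ?C)"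
    using Xs(1)
  proof eventually_elim
    case (elim n)
    have "\<alpha>s n > 0" using aw[OF elim] lo by linarith
    then show ?case using aw[OF elim] X(3) by (simp add: frontier_copy)
  qed
  then have lim': "D_lim (\<lambda>n. copy (\<alpha>s n) (ws n) ?C) (copy \<alpha> w ?C)"
    using Xs(2) tendsto_cong unfolding D_lim_def by fast
  have bd: "\<forall>\<^sub>F n in sequentially. 0 < \<alpha>s n \<and> \<alpha>s n \<le> hi" using ev by eventually_elim (use lo in linarith)
  have b: "bounded (proto \<sigma> j)" and ne: "interior (proto \<sigma> j) \<noteq> {}"
    using tile_proto[OF X(2)] tile_interior_nonempty by (auto simp: tile_def)
  obtain x0 where x0: "x0 \<in> ?C" using frontier_not_singleton[OF b ne] by blast
  obtain y0 where y0: "y0 \<in> ?C" "y0 \<noteq> x0" using frontier_not_singleton[OF b ne] by blast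
  have "compact ?C" using b by (simp add: compact_frontier_bounded)
  then show ?thesis
    using copies_lim_params[OF lim' X(3) bd _ x0 y0(1) y0(2)[symmetric]] ev by blast
qed

text \<open>The supertile is an inflated tile of S. Uniqueness of type, scale and position
  identifies it with the given copy, and its subdivision then lies in the translated tiling.\<close>

lemma supertile_cases:
  assumes "stationary \<sigma> s S" "copy x z (proto \<sigma> i) \<in> copies 1 u (copies (exp (real m * s)) 0 S)" "i < ntypes \<sigma>" "x > 0"
  shows "FT i x z \<subseteq> copies 1 u S"
proof -
  obtain Z where Z: "Z \<in> S" "copy x z (proto \<sigma> i) = copy 1 u (copy (exp (real m * s)) 0 Z)"
    using assms(2) by (auto simp: copies_def)
  obtain l y w where Zc: "l < ntypes \<sigma>" "min_ratio \<le> y" "y \<le> 1" "Z = copy y w (proto \<sigma> l)"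
    by (rule stationary_cases[OF assms(1) Z(1)]) blast
  have y0: "y > 0" using Zc min_ratio(1) by linarith
  have "copy x z (proto \<sigma> i) = copy (exp (real m * s) * y) (u + exp (real m * s) *\<^sub>R w) (proto \<sigma> l)"
    using Z Zc by (simp add: copy_copy)
  from copy_proto_inj[OF this assms(3) Zc(1) assms(4)]
  have eq: "i = l" "x = exp (real m * s) * y" "z = u + exp (real m * s) *\<^sub>R w" using y0 by auto
  have "FT l (exp (real m * s) * y) (exp (real m * s) *\<^sub>R w) \<subseteq> S"
    using stationary_supertile[OF assms(1) _ Zc(1) y0] Z Zc by simp
  then have "copies 1 u (FT l (exp (real m * s) * y) (exp (real m * s) *\<^sub>R w)) \<subseteq> copies 1 u S"
    unfolding copies_def by blast
  then show ?thesis using FT_translate[of l "exp (real m * s) * y" u] Zc y0 eq by simp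
qed

text \<open>The tiles of \<open>\<T>\<close> in \<open>Tm\<close> are compared with those of an approximating supertile of a translate of \<open>S\<close>,
  whose tiles are known exactly. Scales change by less than \<open>\<epsilon>\<close> in the limit, so the interval is widened or
  narrowed by \<open>\<epsilon>\<close>; \<open>M\<close> is the number of tiles of \<open>\<T>\<close> close to the boundary of \<open>Tm\<close>.\<close>

lemma supertile_approx:
  assumes st: "stationary \<sigma> s S" and T: "\<T> \<in> tiling_space \<sigma>" and sup: "supertile_tilings \<sigma> s S v \<T> \<T>sup"
    and Tm: "Tm \<in> \<T>sup m" and eps: "\<epsilon> > 0"
    and B: "B > 0" "\<forall>l<ntypes \<sigma>. \<forall>x\<in>proto \<sigma> l. norm x \<le> B"
  shows "\<exists>i x \<gamma> z. \<exists>M::real. i < ntypes \<sigma> \<and> Tm = copy \<gamma> z (proto \<sigma> i) \<and>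
     exp (real m * s) * min_ratio \<le> \<gamma> \<and> exp (real m * s) * min_ratio \<le> x \<and>
     \<bar>x ^ DIM('a) / \<gamma> ^ DIM('a) - 1\<bar> \<le> \<epsilon> \<and>
     M * min_ratio ^ DIM('a) \<le> measure lebesgue (nbhd (4 * B + 1) (frontier Tm)) \<and>
     real (count_tiles \<sigma> j a b (touching Tm \<T>)) \<le> real (cnt j (max 0 (a - \<epsilon>)) (min 1 (b + \<epsilon>)) i x) + M \<and>
     real (cnt j (a + \<epsilon>) (b - \<epsilon>) i x) \<le> real (count_tiles \<sigma> j a b (touching Tm \<T>)) + M"
proof -
  \<comment> \<open>A diameter bound for all tiles of scale at most 1.\<close>
  define D where "D = 2 * B"
  define E where "E = exp (real m * s)"
  define c0 where "c0 = min_ratio ^ DIM('a)"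
  define Ss where "Ss n = copies 1 (v n) S" for n
  define Sp where "Sp n = copies 1 (v n) (copies E 0 S)" for n
  have E0: "E > 0" by (simp add: E_def)
  have c0: "c0 > 0" using min_ratio(1) by (simp add: c0_def)
  have limT: "tiling_lim \<sigma> Ss \<T>" and limM: "tiling_lim \<sigma> Sp (\<T>sup m)"
    and typM: "\<exists>i. has_type \<sigma> i Tm"
    using sup Tm unfolding supertile_tilings_def Ss_def Sp_def E_def by blast+
  have casesS: "\<exists>l y w. l < ntypes \<sigma> \<and> min_ratio \<le> y \<and> y \<le> 1 \<and> Z = copy y w (proto \<sigma> l)" if Z: "Z \<in> Ss n" for n Z
  proof -
    obtain Z' where Z': "Z' \<in> S" "Z = copy 1 (v n) Z'" using Z by (auto simp: Ss_def copies_def)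
    obtain l y w where "l < ntypes \<sigma>" "min_ratio \<le> y" "y \<le> 1" "Z' = copy y w (proto \<sigma> l)"
      by (rule stationary_cases[OF st Z'(1)]) blast
    then show ?thesis unfolding Z'(2) by (intro exI[of _ l] exI[of _ y] exI[of _ "v n + w"]) (simp add: copy_copy)
  qed
  have casesM: "\<exists>l y w. l < ntypes \<sigma> \<and> E * min_ratio \<le> y \<and> y \<le> E \<and> Z = copy y w (proto \<sigma> l)" if Z: "Z \<in> Sp n" for n Z
  proof -
    obtain Z' where Z': "Z' \<in> S" "Z = copy 1 (v n) (copy E 0 Z')" using Z by (auto simp: Sp_def copies_def)
    obtain l y w where "l < ntypes \<sigma>" "min_ratio \<le> y" "y \<le> 1" "Z' = copy y w (proto \<sigma> l)"
      by (rule stationary_cases[OF st Z'(1)]) blast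
    then show ?thesis unfolding Z'(2) using E0
      by (intro exI[of _ l] exI[of _ "E * y"] exI[of _ "v n + E *\<^sub>R w"]) (simp add: copy_copy)
  qed
  have tileS: "tile Z \<and> c0 \<le> measure lebesgue Z" if Z: "Z \<in> Ss n" for n Z
  proof -
    obtain l y w where lyw: "l < ntypes \<sigma>" "min_ratio \<le> y" "Z = copy y w (proto \<sigma> l)" using casesS[OF Z] by blast
    then have "y > 0" using min_ratio(1) by linarith
    moreover have "min_ratio ^ DIM('a) \<le> y ^ DIM('a)" using lyw min_ratio(1) by (intro power_mono) auto
    ultimately show ?thesis using lyw tile_copy[OF tile_proto] by (simp add: measure_copy_proto c0_def)
  qed
  have disjS: "pairwise (\<lambda>X Y. disjnt (interior X) (interior Y)) (Ss n)" for n
    unfolding Ss_def using stationary_tiling[OF st] by (intro copies_disjoint) (auto simp: tiling_def tessellation_def)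
  obtain i \<gamma> z where Tmc: "i < ntypes \<sigma>" "\<gamma> > 0" "Tm = copy \<gamma> z (proto \<sigma> i)"
    using typM by (auto simp: has_type_def tile_of_def)
  have Emin: "E * min_ratio > 0" using E0 min_ratio(1) by simp
  have "\<exists>\<gamma>s zs. \<gamma>s \<longlonglongrightarrow> \<gamma> \<and> zs \<longlonglongrightarrow> z \<and>
    (\<forall>\<^sub>F n in sequentially. copy (\<gamma>s n) (zs n) (proto \<sigma> i) \<in> Sp n \<and> E * min_ratio \<le> \<gamma>s n \<and> \<gamma>s n \<le> E)"
    by (rule tiling_lim_params[OF limM _ Emin Tm[unfolded Tmc(3)] Tmc(1,2)]) (rule casesM)
  then obtain \<gamma>s zs where \<gamma>s: "\<gamma>s \<longlonglongrightarrow> \<gamma>" "zs \<longlonglongrightarrow> z"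
    "\<forall>\<^sub>F n in sequentially. copy (\<gamma>s n) (zs n) (proto \<sigma> i) \<in> Sp n \<and> E * min_ratio \<le> \<gamma>s n \<and> \<gamma>s n \<le> E"
    by blast
  have \<gamma>low: "E * min_ratio \<le> \<gamma>"
    by (rule tendsto_lowerbound[OF \<gamma>s(1)]) (use \<gamma>s(3) in \<open>auto elim: eventually_mono\<close>)
  have tilT: "tiling \<T>" using T by (simp add: tiling_space_def)
  have disjT: "pairwise (\<lambda>X Y. disjnt (interior X) (interior Y)) \<T>" and covT: "\<Union>\<T> = UNIV"
    using tilT by (auto simp: tiling_def tessellation_def)
  have "\<forall>X\<in>\<T>. \<exists>q. fst q < ntypes \<sigma> \<and> 0 < fst (snd q) \<and> fst (snd q) \<le> 1 \<and>
      copy (fst (snd q)) (snd (snd q)) (proto \<sigma> (fst q)) = X"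
  proof
    fix X assume "X \<in> \<T>"
    then obtain j \<alpha> where "\<alpha> \<le> 1" "tile_of \<sigma> j \<alpha> X" using T unfolding tiling_space_def by blast
    then obtain w where "j < ntypes \<sigma>" "0 < \<alpha>" "\<alpha> \<le> 1" "X = copy \<alpha> w (proto \<sigma> j)" unfolding tile_of_def by blast
    then show "\<exists>q. fst q < ntypes \<sigma> \<and> 0 < fst (snd q) \<and> fst (snd q) \<le> 1 \<and>
      copy (fst (snd q)) (snd (snd q)) (proto \<sigma> (fst q)) = X" by (intro exI[of _ "(j, \<alpha>, w)"]) simp
  qed
  from bchoice[OF this] obtain q where q: "\<forall>X\<in>\<T>. fst (q X) < ntypes \<sigma> \<and> 0 < fst (snd (q X)) \<and> fst (snd (q X)) \<le> 1 \<and>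
      copy (fst (snd (q X))) (snd (snd (q X))) (proto \<sigma> (fst (q X))) = X" ..
  define ty where "ty X = fst (q X)" for X
  define al where "al X = fst (snd (q X))" for X
  define ve where "ve X = snd (snd (q X))" for X
  have rep: "ty X < ntypes \<sigma>" "0 < al X" "al X \<le> 1" "copy (al X) (ve X) (proto \<sigma> (ty X)) = X" if "X \<in> \<T>" for X
    using q that by (auto simp: ty_def al_def ve_def)
  have "\<exists>\<alpha>s ws. \<alpha>s \<longlonglongrightarrow> al X \<and> ws \<longlonglongrightarrow> ve X \<and>
     (\<forall>\<^sub>F n in sequentially. copy (\<alpha>s n) (ws n) (proto \<sigma> (ty X)) \<in> Ss n \<and> min_ratio \<le> \<alpha>s n \<and> \<alpha>s n \<le> 1)" if X: "X \<in> \<T>" for X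
  proof (rule tiling_lim_params[OF limT _ min_ratio(1) _ rep(1,2)[OF X]])
    show "copy (al X) (ve X) (proto \<sigma> (ty X)) \<in> \<T>" using X rep(4)[OF X] by simp
  qed (rule casesS)
  then have "\<forall>X\<in>\<T>. \<exists>r. (\<lambda>n. fst (r n)) \<longlonglongrightarrow> al X \<and> (\<lambda>n. snd (r n)) \<longlonglongrightarrow> ve X \<and>
     (\<forall>\<^sub>F n in sequentially. copy (fst (r n)) (snd (r n)) (proto \<sigma> (ty X)) \<in> Ss n \<and> min_ratio \<le> fst (r n) \<and> fst (r n) \<le> 1)"
  proof -
    assume *: "\<And>X. X \<in> \<T> \<Longrightarrow> \<exists>\<alpha>s ws. \<alpha>s \<longlonglongrightarrow> al X \<and> ws \<longlonglongrightarrow> ve X \<and>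
     (\<forall>\<^sub>F n in sequentially. copy (\<alpha>s n) (ws n) (proto \<sigma> (ty X)) \<in> Ss n \<and> min_ratio \<le> \<alpha>s n \<and> \<alpha>s n \<le> 1)"
    show ?thesis
    proof
      fix X assume "X \<in> \<T>"
      then obtain \<alpha>s ws where "\<alpha>s \<longlonglongrightarrow> al X \<and> ws \<longlonglongrightarrow> ve X \<and>
       (\<forall>\<^sub>F n in sequentially. copy (\<alpha>s n) (ws n) (proto \<sigma> (ty X)) \<in> Ss n \<and> min_ratio \<le> \<alpha>s n \<and> \<alpha>s n \<le> 1)"
        using * by blast
      then show "\<exists>r. (\<lambda>n. fst (r n)) \<longlonglongrightarrow> al X \<and> (\<lambda>n. snd (r n)) \<longlonglongrightarrow> ve X \<and>
       (\<forall>\<^sub>F n in sequentially. copy (fst (r n)) (snd (r n)) (proto \<sigma> (ty X)) \<in> Ss n \<and> min_ratio \<le> fst (r n) \<and> fst (r n) \<le> 1)"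
        by (intro exI[of _ "\<lambda>n. (\<alpha>s n, ws n)"]) simp
    qed
  qed
  from bchoice[OF this] obtain r where r: "\<forall>X\<in>\<T>. (\<lambda>n. fst (r X n)) \<longlonglongrightarrow> al X \<and> (\<lambda>n. snd (r X n)) \<longlonglongrightarrow> ve X \<and>
     (\<forall>\<^sub>F n in sequentially. copy (fst (r X n)) (snd (r X n)) (proto \<sigma> (ty X)) \<in> Ss n \<and> min_ratio \<le> fst (r X n) \<and> fst (r X n) \<le> 1)"
    ..
  define \<alpha>s where "\<alpha>s X n = fst (r X n)" for X n
  define ws where "ws X n = snd (r X n)" for X n
  have lims: "\<alpha>s X \<longlonglongrightarrow> al X" "ws X \<longlonglongrightarrow> ve X"
    "\<forall>\<^sub>F n in sequentially. copy (\<alpha>s X n) (ws X n) (proto \<sigma> (ty X)) \<in> Ss n \<and> min_ratio \<le> \<alpha>s X n \<and> \<alpha>s X n \<le> 1" if "X \<in> \<T>" for X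
    using r that unfolding \<alpha>s_def[abs_def] ws_def[abs_def] by auto
  define ap where "ap X n = copy (\<alpha>s X n) (ws X n) (proto \<sigma> (ty X))" for X n
  \<comment> \<open>The lower bound on scales passes to the limit. It gives the tiles of \<T> the
    minimal volume \<open>c0\<close>, on which the counting by volume relies.\<close>
  have al_low: "min_ratio \<le> al X" if X: "X \<in> \<T>" for X
    by (rule tendsto_lowerbound[OF lims(1)[OF X]]) (use lims(3)[OF X] in \<open>auto elim: eventually_mono\<close>)
  have tileT: "tile X" "c0 \<le> measure lebesgue X" if X: "X \<in> \<T>" for X
  proof -
    show "tile X" using tilT X by (auto simp: tiling_def tessellation_def)
    have "measure lebesgue X = al X ^ DIM('a)"
      using measure_copy_proto[OF rep(1)[OF X], of "al X" "ve X"] rep(2,4)[OF X] by simp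
    then show "c0 \<le> measure lebesgue X" unfolding c0_def using al_low[OF X] min_ratio(1) by (simp add: power_mono)
  qed
  have diam: "dist x y \<le> D" if X: "X \<in> \<T>" "x \<in> X" "y \<in> X" for X x y
  proof -
    obtain x' y' where xy: "x' \<in> proto \<sigma> (ty X)" "y' \<in> proto \<sigma> (ty X)" "x = ve X + al X *\<^sub>R x'" "y = ve X + al X *\<^sub>R y'"
    proof -
      have "x \<in> copy (al X) (ve X) (proto \<sigma> (ty X))" "y \<in> copy (al X) (ve X) (proto \<sigma> (ty X))"
        using X(2,3) rep(4)[OF X(1)] by simp_all
      then show ?thesis using that unfolding copy_def by blast
    qed
    have "dist x y = al X * norm (x' - y')"
      using rep(2)[OF X(1)] by (simp add: xy dist_norm flip: scaleR_diff_right)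
    also have "\<dots> \<le> 1 * norm (x' - y')" using rep(3)[OF X(1)] by (intro mult_right_mono) auto
    also have "\<dots> \<le> norm x' + norm y'" by (simp add: norm_triangle_ineq4)
    also have "\<dots> \<le> D" using B(2)[rule_format, OF rep(1)[OF X(1)] xy(1)] B(2)[rule_format, OF rep(1)[OF X(1)] xy(2)] by (simp add: D_def)
    finally show ?thesis .
  qed
  have D0: "D > 0" using B by (simp add: D_def)
  have bTm: "bounded Tm" "bounded (frontier Tm)"
    using tile_copy[OF tile_proto[OF Tmc(1)] Tmc(2)] unfolding Tmc(3) by (auto simp: tile_def intro: compact_imp_bounded compact_frontier_bounded)
  \<comment> \<open>A tile outside this set that meets \<open>Tm\<close> lies inside
    \<open>Tm\<close>. A tile in it stays within (D + 1) + D = 4 B + 1 of the frontier.\<close>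
  define \<B> where "\<B> = {X \<in> \<T>. X \<inter> nbhd (D + 1) (frontier Tm) \<noteq> {}}"
  have \<B>sub: "X \<subseteq> nbhd (4 * B + 1) (frontier Tm)" if X: "X \<in> \<B>" for X
  proof
    fix y assume y: "y \<in> X"
    obtain x c where xc: "x \<in> X" "c \<in> frontier Tm" "dist c x < D + 1" using X by (auto simp: \<B>_def mem_nbhd)
    have "dist c y \<le> dist c x + dist x y" by (rule dist_triangle)
    also have "\<dots> < 4 * B + 1" using diam[of X x y] X xc y by (simp add: \<B>_def D_def)
    finally show "y \<in> nbhd (4 * B + 1) (frontier Tm)" using xc(2) by (auto simp: mem_nbhd)
  qed
  have \<B>: "finite \<B>" "real (card \<B>) * c0 \<le> measure lebesgue (nbhd (4 * B + 1) (frontier Tm))"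
  proof -
    have "\<B> \<subseteq> \<T>" by (auto simp: \<B>_def)
    then have t: "\<And>X. X \<in> \<B> \<Longrightarrow> tile X" "\<And>X. X \<in> \<B> \<Longrightarrow> c0 \<le> measure lebesgue X"
      "pairwise (\<lambda>X Y. disjnt (interior X) (interior Y)) \<B>"
      using tileT pairwise_subset[OF disjT] by blast+
    note bound = disjoint_tiles_card_bound[OF t(1,3,2) c0 lmeasurable_nbhd[OF bTm(2)] \<B>sub]
    show "finite \<B>" by (rule bound(1))
    show "real (card \<B>) * c0 \<le> measure lebesgue (nbhd (4 * B + 1) (frontier Tm))" by (rule bound(2))
  qed
  obtain R where R: "\<And>x. x \<in> Tm \<Longrightarrow> norm x \<le> R" using bTm(1) by (auto simp: bounded_iff)
  \<comment> \<open>The margin 1 makes room for the approximating supertile, which lies within 1 / 2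
    of \<open>Tm\<close>. Only the finitely many tiles meeting U matter, so finitely many limits
    hold simultaneously at one n.\<close>
  define U :: "'a set" where "U = cball 0 (R + 1)"
  define G where "G = {X \<in> \<T>. X \<inter> U \<noteq> {}}"
  have Gsub: "X \<subseteq> cball 0 (R + 1 + D)" if X: "X \<in> G" for X
  proof
    fix y assume y: "y \<in> X"
    obtain x where x: "x \<in> X" "norm x \<le> R + 1" using X by (auto simp: G_def U_def)
    have "norm y \<le> norm x + dist x y" by (metis dist_norm norm_triangle_sub dist_commute)
    also have "\<dots> \<le> R + 1 + D" using diam[of X x y] X x y by (simp add: G_def)
    finally show "y \<in> cball 0 (R + 1 + D)" by simp
  qed
  have finG: "finite G"
    using tileT Gsub c0 pairwise_subset[OF disjT, of G]
    by (intro disjoint_tiles_card_bound(1)[where P = G and ?c0.0 = c0 and U = "cball 0 (R + 1 + D)"]) (auto simp: G_def)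
  have GT: "X \<in> \<T>" if "X \<in> G" for X using that by (simp add: G_def)
  have UG: "U \<subseteq> \<Union>G" using covT by (auto simp: G_def)
  have ap_inside: "\<forall>\<^sub>F n in sequentially. K \<subseteq> interior (ap X n)" if X: "X \<in> G" and K: "compact K" "K \<subseteq> interior X" for X K
    unfolding ap_def using rep(4)[OF GT[OF X]] K(2)
    by (intro copies_converge_inside[OF lims(1,2)[OF GT[OF X]] rep(2)[OF GT[OF X]] K(1)]) simp
  have ev_in: "\<forall>\<^sub>F n in sequentially. ap X n \<in> Ss n" if "X \<in> G" for X
    using lims(3)[OF GT[OF that]] unfolding ap_def by eventually_elim simp
  have ev_cov: "\<forall>\<^sub>F n in sequentially. \<forall>Y\<in>Ss n. Y \<subseteq> U \<longrightarrow> (\<exists>X\<in>G. Y = ap X n)"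
    by (rule tiling_coverage[OF finG tileT(1)[OF GT] ev_in ap_inside disjS tileS c0 UG])
  have ev_ap: "\<forall>\<^sub>F n in sequentially. \<forall>X\<in>G. (ap X n \<in> Ss n \<and> \<alpha>s X n > 0 \<and> \<alpha>s X n \<le> 1) \<and> \<bar>\<alpha>s X n - al X\<bar> < \<epsilon> \<and>
      (\<forall>x\<in>proto \<sigma> (ty X). dist (ws X n + \<alpha>s X n *\<^sub>R x) (ve X + al X *\<^sub>R x) < 1 / 2)"
  proof (intro eventually_ball_finite[OF finG] ballI eventually_conj)
    fix X assume X: "X \<in> G"
    show "\<forall>\<^sub>F n in sequentially. ap X n \<in> Ss n" "\<forall>\<^sub>F n in sequentially. \<alpha>s X n \<le> 1"
      using lims(3)[OF GT[OF X]] by (auto simp: ap_def elim: eventually_mono)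
    show "\<forall>\<^sub>F n in sequentially. \<alpha>s X n > 0" using lims(3)[OF GT[OF X]] by eventually_elim (use min_ratio(1) in linarith)
    show "\<forall>\<^sub>F n in sequentially. \<bar>\<alpha>s X n - al X\<bar> < \<epsilon>"
      using tendstoD[OF lims(1)[OF GT[OF X]] eps] by (simp add: dist_real_def)
    show "\<forall>\<^sub>F n in sequentially. \<forall>x\<in>proto \<sigma> (ty X). dist (ws X n + \<alpha>s X n *\<^sub>R x) (ve X + al X *\<^sub>R x) < 1 / 2"
      using tile_proto[OF rep(1)[OF GT[OF X]]]
      by (intro copies_converge_pointwise[OF lims(1,2)[OF GT[OF X]]]) (auto simp: tile_def)
  qed
  \<comment> \<open>Different tiles of the limit must not share an approximating tile. If their
    types agree, their scales or positions differ in the limit, hence also for large n.\<close>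
  have ev_inj: "\<forall>\<^sub>F n in sequentially. \<forall>X\<in>G. \<forall>X'\<in>G. X \<noteq> X' \<longrightarrow> (ty X = ty X' \<longrightarrow> \<alpha>s X n \<noteq> \<alpha>s X' n \<or> ws X n \<noteq> ws X' n)"
  proof (intro eventually_ball_finite[OF finG] ballI)
    fix X X' assume X: "X \<in> G" "X' \<in> G"
    show "\<forall>\<^sub>F n in sequentially. X \<noteq> X' \<longrightarrow> (ty X = ty X' \<longrightarrow> \<alpha>s X n \<noteq> \<alpha>s X' n \<or> ws X n \<noteq> ws X' n)"
    proof (cases "X \<noteq> X' \<and> ty X = ty X'")
      case True
      then have "al X \<noteq> al X' \<or> ve X \<noteq> ve X'" using rep(4)[OF GT[OF X(1)]] rep(4)[OF GT[OF X(2)]] by metis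
      then show ?thesis
      proof
        assume "al X \<noteq> al X'"
        then have "\<forall>\<^sub>F n in sequentially. \<alpha>s X n - \<alpha>s X' n \<noteq> 0"
          by (intro tendsto_imp_eventually_ne[OF tendsto_diff[OF lims(1)[OF GT[OF X(1)]] lims(1)[OF GT[OF X(2)]]]]) simp
        then show ?thesis by eventually_elim auto
      next
        assume "ve X \<noteq> ve X'"
        then have "\<forall>\<^sub>F n in sequentially. ws X n - ws X' n \<noteq> 0"
          by (intro tendsto_imp_eventually_ne[OF tendsto_diff[OF lims(2)[OF GT[OF X(1)]] lims(2)[OF GT[OF X(2)]]]]) simp
        then show ?thesis by eventually_elim auto
      qed
    qed auto
  qed
  \<comment> \<open>One interior witness per tile. For X inside \<open>Tm\<close> it ends up
    interior to both \<open>ap X n\<close> and the approximating supertile, which forces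
    \<open>ap X n\<close> into the patch F.\<close>
  define pt where "pt X = (SOME x. x \<in> interior X)" for X :: "'a set"
  have pt: "pt X \<in> interior X" if "X \<in> G" for X
    using tile_interior_nonempty[OF tileT(1)[OF GT[OF that]]] unfolding pt_def by (simp add: some_in_eq)
  have ev_pt: "\<forall>\<^sub>F n in sequentially. \<forall>X\<in>G. pt X \<in> interior (ap X n) \<and>
      (pt X \<in> interior Tm \<longrightarrow> pt X \<in> interior (copy (\<gamma>s n) (zs n) (proto \<sigma> i)))"
  proof (intro eventually_ball_finite[OF finG] ballI eventually_conj)
    fix X assume X: "X \<in> G"
    show "\<forall>\<^sub>F n in sequentially. pt X \<in> interior (ap X n)"
      using ap_inside[OF X, of "{pt X}"] pt[OF X] by simp
    show "\<forall>\<^sub>F n in sequentially. pt X \<in> interior Tm \<longrightarrow> pt X \<in> interior (copy (\<gamma>s n) (zs n) (proto \<sigma> i))"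
    proof (cases "pt X \<in> interior Tm")
      case True
      then show ?thesis using copies_converge_inside[OF \<gamma>s(1,2) Tmc(2), of "{pt X}" "proto \<sigma> i"] by (simp add: Tmc(3))
    qed auto
  qed
  have "(\<lambda>n. \<gamma>s n ^ DIM('a) / \<gamma> ^ DIM('a)) \<longlonglongrightarrow> \<gamma> ^ DIM('a) / \<gamma> ^ DIM('a)"
    using Tmc(2) by (intro tendsto_intros \<gamma>s(1)) auto
  then have "(\<lambda>n. \<gamma>s n ^ DIM('a) / \<gamma> ^ DIM('a)) \<longlonglongrightarrow> 1" using Tmc(2) by simp
  from tendstoD[OF this eps]
  have ev_vol: "\<forall>\<^sub>F n in sequentially. \<bar>\<gamma>s n ^ DIM('a) / \<gamma> ^ DIM('a) - 1\<bar> < \<epsilon>" by (simp add: dist_real_def)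
  have ev_Y: "\<forall>\<^sub>F n in sequentially. \<forall>x\<in>proto \<sigma> i. dist (zs n + \<gamma>s n *\<^sub>R x) (z + \<gamma> *\<^sub>R x) < 1 / 2"
    using tile_proto[OF Tmc(1)] by (intro copies_converge_pointwise[OF \<gamma>s(1,2)]) (auto simp: tile_def)
  have "\<forall>\<^sub>F n in sequentially. (\<forall>Y\<in>Ss n. Y \<subseteq> U \<longrightarrow> (\<exists>X\<in>G. Y = ap X n)) \<and>
     (\<forall>X\<in>G. (ap X n \<in> Ss n \<and> \<alpha>s X n > 0 \<and> \<alpha>s X n \<le> 1) \<and> \<bar>\<alpha>s X n - al X\<bar> < \<epsilon> \<and>
      (\<forall>x\<in>proto \<sigma> (ty X). dist (ws X n + \<alpha>s X n *\<^sub>R x) (ve X + al X *\<^sub>R x) < 1 / 2)) \<and>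
     (\<forall>X\<in>G. \<forall>X'\<in>G. X \<noteq> X' \<longrightarrow> (ty X = ty X' \<longrightarrow> \<alpha>s X n \<noteq> \<alpha>s X' n \<or> ws X n \<noteq> ws X' n)) \<and>
     (\<forall>X\<in>G. pt X \<in> interior (ap X n) \<and> (pt X \<in> interior Tm \<longrightarrow> pt X \<in> interior (copy (\<gamma>s n) (zs n) (proto \<sigma> i)))) \<and>
     \<bar>\<gamma>s n ^ DIM('a) / \<gamma> ^ DIM('a) - 1\<bar> < \<epsilon> \<and>
     (\<forall>x\<in>proto \<sigma> i. dist (zs n + \<gamma>s n *\<^sub>R x) (z + \<gamma> *\<^sub>R x) < 1 / 2) \<and>
     (copy (\<gamma>s n) (zs n) (proto \<sigma> i) \<in> Sp n \<and> E * min_ratio \<le> \<gamma>s n \<and> \<gamma>s n \<le> E)"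
    by (intro eventually_conj ev_cov ev_ap ev_inj ev_pt ev_vol ev_Y \<gamma>s(3))
  then obtain n where n_cov: "\<And>Y. Y \<in> Ss n \<Longrightarrow> Y \<subseteq> U \<Longrightarrow> \<exists>X\<in>G. Y = ap X n"
    and n_ap: "\<And>X. X \<in> G \<Longrightarrow> ap X n \<in> Ss n" "\<And>X. X \<in> G \<Longrightarrow> \<alpha>s X n > 0" "\<And>X. X \<in> G \<Longrightarrow> \<alpha>s X n \<le> 1"
      "\<And>X. X \<in> G \<Longrightarrow> \<bar>\<alpha>s X n - al X\<bar> < \<epsilon>"
      "\<And>X x. X \<in> G \<Longrightarrow> x \<in> proto \<sigma> (ty X) \<Longrightarrow> dist (ws X n + \<alpha>s X n *\<^sub>R x) (ve X + al X *\<^sub>R x) < 1 / 2"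
    and n_inj: "\<And>X X'. X \<in> G \<Longrightarrow> X' \<in> G \<Longrightarrow> X \<noteq> X' \<Longrightarrow> ty X = ty X' \<Longrightarrow> \<alpha>s X n \<noteq> \<alpha>s X' n \<or> ws X n \<noteq> ws X' n"
    and n_pt: "\<And>X. X \<in> G \<Longrightarrow> pt X \<in> interior (ap X n)"
      "\<And>X. X \<in> G \<Longrightarrow> pt X \<in> interior Tm \<Longrightarrow> pt X \<in> interior (copy (\<gamma>s n) (zs n) (proto \<sigma> i))"
    and n_vol: "\<bar>\<gamma>s n ^ DIM('a) / \<gamma> ^ DIM('a) - 1\<bar> < \<epsilon>"
    and n_Y: "\<And>x. x \<in> proto \<sigma> i \<Longrightarrow> dist (zs n + \<gamma>s n *\<^sub>R x) (z + \<gamma> *\<^sub>R x) < 1 / 2"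
    and n_\<gamma>: "copy (\<gamma>s n) (zs n) (proto \<sigma> i) \<in> Sp n" "E * min_ratio \<le> \<gamma>s n"
    using eventually_happens'[OF sequentially_bot] by (smt (verit, best))
  define x where "x = \<gamma>s n"
  define Y where "Y = copy x (zs n) (proto \<sigma> i)"
  define F where "F = FT i x (zs n)"
  have x0: "x > 0" using n_\<gamma>(2) Emin by (simp add: x_def)
  have FS: "F \<subseteq> Ss n" unfolding F_def Ss_def
    by (rule supertile_cases[OF st _ Tmc(1) x0]) (use n_\<gamma>(1) in \<open>simp add: x_def Sp_def E_def\<close>)
  have tessF: "tessellation Y F" unfolding Y_def F_def by (rule FT_tessellation[OF Tmc(1) x0])
  have finF: "finite F" unfolding F_def by (rule finite_FT[OF Tmc(1) x0])
  have cntF: "count_tiles \<sigma> j a' b' F = cnt j a' b' i x" for a' b' unfolding F_def by (rule count_FT[OF Tmc(1) x0])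
  have ap_type: "tile_of \<sigma> j \<alpha> (ap X n) \<longleftrightarrow> ty X = j \<and> \<alpha> = \<alpha>s X n" if X: "X \<in> G" for X \<alpha>
    unfolding ap_def by (rule tile_of_copy_iff[OF rep(1)[OF GT[OF X]] n_ap(2)[OF X]])
  have X_type: "tile_of \<sigma> j \<alpha> X \<longleftrightarrow> ty X = j \<and> \<alpha> = al X" if X: "X \<in> G" for X \<alpha>
    using tile_of_copy_iff[OF rep(1)[OF GT[OF X]] rep(2)[OF GT[OF X]], of j \<alpha> "ve X"] rep(4)[OF GT[OF X]] by simp
  have ap_inj: "inj_on (\<lambda>X. ap X n) G"
  proof (rule inj_onI, rule ccontr)
    fix X X' assume X: "X \<in> G" "X' \<in> G" "ap X n = ap X' n" "X \<noteq> X'"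
    have "ty X = ty X' \<and> \<alpha>s X n = \<alpha>s X' n \<and> ws X n = ws X' n"
      by (rule copy_proto_inj[OF X(3)[unfolded ap_def]]) (use rep(1)[OF GT] n_ap(2) X in auto)
    then show False using n_inj[OF X(1,2,4)] by blast
  qed
  define Aab where "Aab = {X \<in> touching Tm \<T>. \<exists>\<alpha>\<in>{a..b}. tile_of \<sigma> j \<alpha> X}"
  have TmU: "Tm \<subseteq> U" using R by (force simp: U_def)
  have AG: "Aab \<subseteq> G" using TmU by (auto simp: Aab_def touching_def G_def)
  have finA: "finite Aab" using AG finG finite_subset by blast
  have upper: "card (Aab - \<B>) \<le> card {Z \<in> F. \<exists>\<alpha>\<in>{max 0 (a - \<epsilon>)..min 1 (b + \<epsilon>)}. tile_of \<sigma> j \<alpha> Z}"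
  proof (rule card_inj_on_le)
    show "inj_on (\<lambda>X. ap X n) (Aab - \<B>)" using ap_inj AG by (auto intro: inj_on_subset)
    show "finite {Z \<in> F. \<exists>\<alpha>\<in>{max 0 (a - \<epsilon>)..min 1 (b + \<epsilon>)}. tile_of \<sigma> j \<alpha> Z}" using finF by simp
    show "(\<lambda>X. ap X n) ` (Aab - \<B>) \<subseteq> {Z \<in> F. \<exists>\<alpha>\<in>{max 0 (a - \<epsilon>)..min 1 (b + \<epsilon>)}. tile_of \<sigma> j \<alpha> Z}"
    proof (rule image_subsetI)
      fix X assume X: "X \<in> Aab - \<B>"
      then have XG: "X \<in> G" using AG by blast
      obtain p where p: "p \<in> X" "p \<in> Tm" using X by (auto simp: Aab_def touching_def)
      have "p \<notin> nbhd (D + 1) (frontier Tm)" using X p(1) GT[OF XG] by (auto simp: \<B>_def)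
      then have "ball p (D + 1) \<subseteq> Tm" using p(2) D0 by (intro ball_subset_of_far_frontier) auto
      moreover have "X \<subseteq> ball p (D + 1)" using diam[OF GT[OF XG] p(1)] by force
      ultimately have "X \<subseteq> Tm" by blast
      then have "pt X \<in> interior Tm" using pt[OF XG] interior_mono by blast
      then have "pt X \<in> interior (ap X n) \<inter> interior Y" using n_pt XG by (simp add: Y_def x_def)
      then have "ap X n \<in> F" by (intro tile_mem_tessellation[OF disjS FS finF tessF n_ap(1)[OF XG]]) blast
      moreover have "ty X = j" "a \<le> al X" "al X \<le> b" using X X_type[OF XG] by (auto simp: Aab_def)
      \<comment> \<open>Scales of \<open>ap X n\<close> lie in (0, 1], so the widened interval can
        be clipped to [0, 1], where the asymptotics of counts apply.\<close>
      then have "tile_of \<sigma> j (\<alpha>s X n) (ap X n)" "\<alpha>s X n \<in> {max 0 (a - \<epsilon>)..min 1 (b + \<epsilon>)}"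
        using ap_type[OF XG] n_ap(2,3,4)[OF XG] by (auto simp: abs_less_iff)
      ultimately show "ap X n \<in> {Z \<in> F. \<exists>\<alpha>\<in>{max 0 (a - \<epsilon>)..min 1 (b + \<epsilon>)}. tile_of \<sigma> j \<alpha> Z}" by blast
    qed
  qed
  have lower: "card {Z \<in> F. \<exists>\<alpha>\<in>{a + \<epsilon>..b - \<epsilon>}. tile_of \<sigma> j \<alpha> Z} \<le> card (Aab \<union> \<B>)"
  proof (rule surj_card_le[where f = "\<lambda>X. ap X n"])
    show "finite (Aab \<union> \<B>)" using finA \<B>(1) by simp
    show "{Z \<in> F. \<exists>\<alpha>\<in>{a + \<epsilon>..b - \<epsilon>}. tile_of \<sigma> j \<alpha> Z} \<subseteq> (\<lambda>X. ap X n) ` (Aab \<union> \<B>)"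
    proof
      fix Z assume Z: "Z \<in> {Z \<in> F. \<exists>\<alpha>\<in>{a + \<epsilon>..b - \<epsilon>}. tile_of \<sigma> j \<alpha> Z}"
      then have ZF: "Z \<in> F" by simp
      have near: "\<exists>q\<in>Tm. dist y q < 1 / 2" if y: "y \<in> Y" for y
      proof -
        obtain y' where "y' \<in> proto \<sigma> i" "y = zs n + \<gamma>s n *\<^sub>R y'" using y by (auto simp: Y_def copy_def x_def)
        then show ?thesis using n_Y[of y'] by (intro bexI[of _ "z + \<gamma> *\<^sub>R y'"]) (auto simp: Tmc(3) copy_def)
      qed
      have ZY: "Z \<subseteq> Y" using ZF tessF by (auto simp: tessellation_def)
      have "Y \<subseteq> U"
      proof
        fix y assume "y \<in> Y"
        then obtain q where q: "q \<in> Tm" "dist y q < 1 / 2" using near by blast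
        have "norm y \<le> norm q + dist y q" by (metis dist_norm norm_triangle_sub)
        then show "y \<in> U" using R[OF q(1)] q(2) by (simp add: U_def)
      qed
      then obtain X where X: "X \<in> G" "Z = ap X n" using n_cov[of Z] ZY ZF FS by blast
      obtain \<alpha> where "\<alpha> \<in> {a + \<epsilon>..b - \<epsilon>}" "tile_of \<sigma> j \<alpha> (ap X n)" using Z X(2) by blast
      then have "ty X = j" "\<alpha>s X n \<in> {a + \<epsilon>..b - \<epsilon>}" using ap_type[OF X(1)] by auto
      then have typX: "\<exists>\<alpha>\<in>{a..b}. tile_of \<sigma> j \<alpha> X" using X_type[OF X(1)] n_ap(4)[OF X(1)] by (auto simp: abs_less_iff)
      \<comment> \<open>The same prototile point is placed in Z and in X. The two images are within
        1 / 2, and the one in Z is within 1 / 2 of \<open>Tm\<close>; so X has a point within 1 of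
        \<open>Tm\<close>, and X meets \<open>Tm\<close> or belongs to the boundary set.\<close>
      obtain y' where y': "y' \<in> proto \<sigma> (ty X)" using proto_nonempty[OF rep(1)[OF GT[OF X(1)]]] by blast
      define y where "y = ws X n + \<alpha>s X n *\<^sub>R y'"
      define x' where "x' = ve X + al X *\<^sub>R y'"
      have "y \<in> Z" using y' by (auto simp: X(2) ap_def copy_def y_def)
      then obtain q where q: "q \<in> Tm" "dist y q < 1 / 2" using near ZY by blast
      have "x' \<in> copy (al X) (ve X) (proto \<sigma> (ty X))" using y' by (auto simp: copy_def x'_def)
      then have x'X: "x' \<in> X" using rep(4)[OF GT[OF X(1)]] by simp
      have yx: "dist y x' < 1 / 2" unfolding y_def x'_def by (rule n_ap(5)[OF X(1) y'])
      have "dist q x' \<le> dist y q + dist y x'" by (metis dist_commute dist_triangle)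
      then have qx: "dist q x' < 1" using q(2) yx by linarith
      have "X \<in> Aab \<union> \<B>"
      proof (cases "x' \<in> Tm")
        case True
        then show ?thesis using typX x'X GT[OF X(1)] by (auto simp: Aab_def touching_def)
      next
        case False
        have "q \<in> ball x' 1 \<inter> Tm" "x' \<in> ball x' 1 - Tm" using False q(1) qx by (simp_all add: dist_commute)
        then have "ball x' 1 \<inter> frontier Tm \<noteq> {}" by (intro connected_Int_frontier connected_ball) blast+
        then obtain c where "c \<in> frontier Tm" "dist x' c < 1" by auto
        then have "x' \<in> nbhd (D + 1) (frontier Tm)" using D0 by (auto simp: mem_nbhd dist_commute intro!: bexI[of _ c])
        then show ?thesis using x'X GT[OF X(1)] by (auto simp: \<B>_def)
      qed
      then show "Z \<in> (\<lambda>X. ap X n) ` (Aab \<union> \<B>)" using X(2) by blast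
    qed
  qed
  have cA: "count_tiles \<sigma> j a b (touching Tm \<T>) = card Aab" by (simp add: count_tiles_def Aab_def)
  have "card Aab \<le> card ((Aab - \<B>) \<union> \<B>)" using finA \<B>(1) by (intro card_mono) auto
  also have "\<dots> \<le> card (Aab - \<B>) + card \<B>" by (rule card_Un_le)
  also have "\<dots> \<le> cnt j (max 0 (a - \<epsilon>)) (min 1 (b + \<epsilon>)) i x + card \<B>"
    using upper unfolding cntF[symmetric] count_tiles_def by simp
  finally have up: "card Aab \<le> cnt j (max 0 (a - \<epsilon>)) (min 1 (b + \<epsilon>)) i x + card \<B>" .
  have "cnt j (a + \<epsilon>) (b - \<epsilon>) i x \<le> card (Aab \<union> \<B>)"
    using lower unfolding cntF[symmetric] count_tiles_def by simp
  also have "\<dots> \<le> card Aab + card \<B>" by (rule card_Un_le)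
  finally have low: "cnt j (a + \<epsilon>) (b - \<epsilon>) i x \<le> card Aab + card \<B>" .
  show ?thesis
    using Tmc(1,3) \<gamma>low n_\<gamma>(2) n_vol \<B>(2) up low unfolding cA
    by (intro exI[of _ i] exI[of _ x] exI[of _ \<gamma>] exI[of _ z] exI[of _ "real (card \<B>)"])
      (simp add: x_def E_def c0_def)
qed

end

section \<open>Asymptotics of counts in flow patches and supertiles\<close>

context mixing_scheme
begin

text \<open>The maxima in \<open>phi\<close> are at least \<alpha> > 0, so the negative powers stay
  continuous in the end points even at a = 0.\<close>

lemma phi_tendsto:
  assumes f: "(f \<longlongrightarrow> a) F" and g: "(g \<longlongrightarrow> b) F"
  shows "((\<lambda>x. phi \<sigma> j (f x) (g x)) \<longlongrightarrow> phi \<sigma> j a b) F"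
proof -
  have eq: "phi \<sigma> j a b = (\<Sum>h<ntypes \<sigma>. (1 / real DIM('a) * (\<Sum>(l, \<alpha>, w) | (l, \<alpha>, w) \<in> set (rule \<sigma> h) \<and> l = j. \<alpha> ^ DIM('a) *
        (max a \<alpha> powi (- int DIM('a)) - max b \<alpha> powi (- int DIM('a))))) * q_col \<sigma> h)" for a b
    unfolding phi_def by (intro sum.cong refl) (simp add: sum_list_consts)
  have lim: "((\<lambda>x. \<alpha> ^ DIM('a) * (max (f x) \<alpha> powi (- int DIM('a)) - max (g x) \<alpha> powi (- int DIM('a)))) \<longlongrightarrow>
     \<alpha> ^ DIM('a) * (max a \<alpha> powi (- int DIM('a)) - max b \<alpha> powi (- int DIM('a)))) F" if "\<alpha> > 0" for \<alpha>
    using that by (intro tendsto_intros tendsto_power_int tendsto_max f g) auto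
  show ?thesis unfolding eq case_prod_unfold
    by (intro tendsto_sum[OF tendsto_mult[OF tendsto_mult[OF tendsto_const tendsto_sum[OF lim]] tendsto_const]])
      (use rule_entry in auto)
qed

lemma cnt_asymptotic:
  assumes ab: "0 \<le> a" "a < b" "b \<le> 1" and \<delta>: "\<delta> > 0"
  shows "\<forall>\<^sub>F x in at_top. \<forall>i\<in>{..<ntypes \<sigma>}. \<bar>real (cnt j a b i x) - phi \<sigma> j a b * x ^ DIM('a)\<bar> \<le> \<delta> * x ^ DIM('a)"
proof (intro eventually_ball_finite finite_lessThan ballI)
  fix i assume "i \<in> {..<ntypes \<sigma>}"
  then have "((\<lambda>t. exp (- real DIM('a) * t) * real (cnt j a b i (exp t))) \<longlongrightarrow> phi \<sigma> j a b) at_top"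
    by (intro cnt_tendsto_phi ab) simp
  from tendstoD[OF this \<delta>]
  have "\<forall>\<^sub>F x in at_top. dist (exp (- real DIM('a) * ln x) * real (cnt j a b i (exp (ln x)))) (phi \<sigma> j a b) < \<delta>"
    by (rule eventually_compose_filterlim) (rule ln_at_top)
  then show "\<forall>\<^sub>F x in at_top. \<bar>real (cnt j a b i x) - phi \<sigma> j a b * x ^ DIM('a)\<bar> \<le> \<delta> * x ^ DIM('a)"
    using eventually_gt_at_top[of 0]
  proof eventually_elim
    case (elim x)
    have xd: "x ^ DIM('a) > 0" using elim by simp
    have "exp (- real DIM('a) * ln x) = inverse (x ^ DIM('a))"
      using elim(2) by (simp add: exp_minus exp_of_nat_mult)
    then have "\<bar>real (cnt j a b i x) / x ^ DIM('a) - phi \<sigma> j a b\<bar> < \<delta>"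
      using elim by (simp add: dist_real_def divide_inverse mult.commute)
    then have "\<bar>real (cnt j a b i x) / x ^ DIM('a) - phi \<sigma> j a b\<bar> * x ^ DIM('a) \<le> \<delta> * x ^ DIM('a)"
      using xd by (intro mult_right_mono) auto
    moreover have "\<bar>real (cnt j a b i x) / x ^ DIM('a) - phi \<sigma> j a b\<bar> * x ^ DIM('a) 
       = \<bar>(real (cnt j a b i x) / x ^ DIM('a) - phi \<sigma> j a b) * x ^ DIM('a)\<bar>"
      using xd by (simp add: abs_mult)
    moreover have "(real (cnt j a b i x) / x ^ DIM('a) - phi \<sigma> j a b) * x ^ DIM('a) = real (cnt j a b i x) - phi \<sigma> j a b * x ^ DIM('a)"
      using elim(2) by (simp add: left_diff_distrib)
    ultimately show ?case by simp
  qed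
qed

theorem flow_count_asymptotic:
  assumes ab: "0 \<le> a" "a < b" "b \<le> 1" and T: "legal_tile \<sigma> T"
  shows "(\<lambda>t. real (count_tiles \<sigma> j a b (flow \<sigma> t T)) - phi \<sigma> j a b * measure lebesgue (copy (exp t) 0 T))
        \<in> o[at_top](\<lambda>t::real. measure lebesgue (copy (exp t) 0 T))"
proof (rule landau_o.smallI)
  fix c :: real assume c: "c > 0"
  obtain i \<alpha> v where i: "i < ntypes \<sigma>" "\<alpha> > 0" "T = copy \<alpha> v (proto \<sigma> i)"
    using T unfolding legal_tile_def tile_of_def by blast
  have "filterlim (\<lambda>t. exp t * \<alpha>) at_top at_top"
    using filterlim_tendsto_pos_mult_at_top[OF tendsto_const i(2) exp_at_top] by (simp add: mult.commute)
  then have "\<forall>\<^sub>F t in at_top. \<forall>i\<in>{..<ntypes \<sigma>}. \<bar>real (cnt j a b i (exp t * \<alpha>)) - phi \<sigma> j a b * (exp t * \<alpha>) ^ DIM('a)\<bar> \<le> c * (exp t * \<alpha>) ^ DIM('a)"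
    by (rule eventually_compose_filterlim[OF cnt_asymptotic[OF ab c]])
  then show "\<forall>\<^sub>F t in at_top. norm (real (count_tiles \<sigma> j a b (flow \<sigma> t T)) - phi \<sigma> j a b * measure lebesgue (copy (exp t) 0 T))
      \<le> c * norm (measure lebesgue (copy (exp t) 0 T))"
  proof eventually_elim
    case (elim t)
    have eq: "copy (exp t) 0 T = copy (exp t * \<alpha>) (exp t *\<^sub>R v) (proto \<sigma> i)" by (simp add: i(3) copy_copy)
    have pos: "exp t * \<alpha> > 0" using i(2) by simp
    have "flow \<sigma> t T = FT i (exp t * \<alpha>) (exp t *\<^sub>R v)" by (simp only: flow_eq_final eq FT_def)
    then have "count_tiles \<sigma> j a b (flow \<sigma> t T) = cnt j a b i (exp t * \<alpha>)" using count_FT[OF i(1) pos] by simp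
    moreover have "measure lebesgue (copy (exp t) 0 T) = (exp t * \<alpha>) ^ DIM('a)"
      unfolding eq using measure_copy_proto[OF i(1)] pos by simp
    ultimately show ?case using elim i(1) pos by simp
  qed
qed

lemma frontier_nbhd_small:
  assumes "e > 0"
  obtains r where "r > 0" "\<And>i r'. i < ntypes \<sigma> \<Longrightarrow> r' \<le> r \<Longrightarrow> measure lebesgue (nbhd r' (frontier (proto \<sigma> i))) \<le> e"
proof -
  have "\<exists>r>0. \<forall>r'\<le>r. measure lebesgue (nbhd r' (frontier (proto \<sigma> i))) \<le> e" if "i < ntypes \<sigma>" for i
  proof -
    have C: "compact (frontier (proto \<sigma> i))" "negligible (frontier (proto \<sigma> i))"
      using tile_proto[OF that] by (auto simp: tile_def compact_frontier_bounded negligible_iff_null_sets)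
    show ?thesis by (rule measure_nbhd_null_small[OF C assms]) blast
  qed
  then obtain rf where rf: "\<And>i. i < ntypes \<sigma> \<Longrightarrow> rf i > 0"
    "\<And>i r'. i < ntypes \<sigma> \<Longrightarrow> r' \<le> rf i \<Longrightarrow> measure lebesgue (nbhd r' (frontier (proto \<sigma> i))) \<le> e" by metis
  have ne: "rf ` {..<ntypes \<sigma>} \<noteq> {}" using ntypes_pos by (auto simp: lessThan_empty_iff)
  have "Min (rf ` {..<ntypes \<sigma>}) > 0" using rf(1) ne by (subst Min_gr_iff) auto
  moreover have "Min (rf ` {..<ntypes \<sigma>}) \<le> rf i" if "i < ntypes \<sigma>" for i using that by (intro Min_le) auto
  ultimately show ?thesis using that rf(2) by (meson order_trans)
qed

text \<open>The approximating supertile changes with m and has its own type and scale. This is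
  harmless because the count asymptotics hold uniformly in the type once the scale is large, and
  \<epsilon> is fixed before m grows.\<close>

theorem supertile_count_asymptotic:
  assumes ab: "0 \<le> a" "a < b" "b \<le> 1" 
    and st: "stationary \<sigma> s S" and T: "\<T> \<in> tiling_space \<sigma>" and sup: "supertile_tilings \<sigma> s S v \<T> \<T>sup"
    and Tm: "\<And>m. Tm m \<in> \<T>sup m"
  shows "(\<lambda>m. real (count_tiles \<sigma> j a b (touching (Tm m) \<T>)) - phi \<sigma> j a b * measure lebesgue (Tm m))
          \<in> o[sequentially](\<lambda>m::nat. measure lebesgue (Tm m))"
proof (rule landau_o.smallI)
  fix c :: real assume c: "c > 0"
  define \<phi> where "\<phi> = phi \<sigma> j a b"
  \<comment> \<open>Error budget in units of \<delta> V, with V the volume of the supertile: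
    \<open>\<bar>\<phi>\<bar>\<close> for replacing the approximating volume X by V, 2 for the
    change of \<open>phi\<close> with its interval, 2 for the count asymptotics (both scale with X
    <= 2 V), and 1 for the tiles near the boundary.\<close>
  define \<delta> where "\<delta> = min 1 (c / (\<bar>\<phi>\<bar> + 5))"
  have \<delta>: "\<delta> > 0" "\<delta> \<le> 1" using c by (auto simp: \<delta>_def)
  have "\<bar>\<phi>\<bar> + 5 > 0" "\<delta> \<le> c / (\<bar>\<phi>\<bar> + 5)" by (simp_all add: \<delta>_def)
  then have \<delta>c: "\<delta> * (\<bar>\<phi>\<bar> + 5) \<le> c" by (simp only: pos_le_divide_eq)
  define a1 where "a1 \<epsilon> = a + \<epsilon>" for \<epsilon> define b1 where "b1 \<epsilon> = b - \<epsilon>" for \<epsilon>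
  define a2 where "a2 \<epsilon> = max 0 (a - \<epsilon>)" for \<epsilon> define b2 where "b2 \<epsilon> = min 1 (b + \<epsilon>)" for \<epsilon>
  have id0: "((\<lambda>\<epsilon>::real. \<epsilon>) \<longlongrightarrow> 0) (at_right 0)" by (rule tendsto_ident_at)
  have "(a1 \<longlongrightarrow> a + 0) (at_right 0)" "(b1 \<longlongrightarrow> b - 0) (at_right 0)"
    "(a2 \<longlongrightarrow> max 0 (a - 0)) (at_right 0)" "(b2 \<longlongrightarrow> min 1 (b + 0)) (at_right 0)"
    unfolding a1_def b1_def a2_def b2_def by (intro tendsto_intros id0)+
  then have "(a1 \<longlongrightarrow> a) (at_right 0)" "(b1 \<longlongrightarrow> b) (at_right 0)" "(a2 \<longlongrightarrow> a) (at_right 0)" "(b2 \<longlongrightarrow> b) (at_right 0)"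
    using ab by (simp_all add: max_def min_def)
  then have "((\<lambda>\<epsilon>. phi \<sigma> j (a1 \<epsilon>) (b1 \<epsilon>)) \<longlongrightarrow> \<phi>) (at_right 0)" "((\<lambda>\<epsilon>. phi \<sigma> j (a2 \<epsilon>) (b2 \<epsilon>)) \<longlongrightarrow> \<phi>) (at_right 0)"
    unfolding \<phi>_def by (auto intro: phi_tendsto)
  note lims = this[THEN tendstoD, OF \<delta>(1)]
  \<comment> \<open>Below (b - a) / 2 the narrowed interval is still nondegenerate.\<close>
  have "\<forall>\<^sub>F \<epsilon> in at_right 0. 0 < \<epsilon> \<and> \<epsilon> < min \<delta> ((b - a) / 2)"
    unfolding eventually_at_right_field using \<delta> ab by (intro exI[of _ "min \<delta> ((b - a) / 2)"]) auto
  from eventually_happens'[OF trivial_limit_at_right_real eventually_conj[OF this eventually_conj[OF lims]]]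
  obtain \<epsilon> where e: "0 < \<epsilon> \<and> \<epsilon> < min \<delta> ((b - a) / 2)"
    "dist (phi \<sigma> j (a1 \<epsilon>) (b1 \<epsilon>)) \<phi> < \<delta>" "dist (phi \<sigma> j (a2 \<epsilon>) (b2 \<epsilon>)) \<phi> < \<delta>" by blast
  then have \<epsilon>: "0 < \<epsilon>" "\<epsilon> < \<delta>" "\<epsilon> < (b - a) / 2" by simp_all
  have phi1: "\<bar>phi \<sigma> j (a1 \<epsilon>) (b1 \<epsilon>) - \<phi>\<bar> < \<delta>" and phi2: "\<bar>phi \<sigma> j (a2 \<epsilon>) (b2 \<epsilon>) - \<phi>\<bar> < \<delta>"
    using e(2,3) by (simp_all only: dist_real_def)
  have r1: "0 \<le> a1 \<epsilon>" "a1 \<epsilon> < b1 \<epsilon>" "b1 \<epsilon> \<le> 1" and r2: "0 \<le> a2 \<epsilon>" "a2 \<epsilon> < b2 \<epsilon>" "b2 \<epsilon> \<le> 1"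
    using ab \<epsilon> by (auto simp: a1_def b1_def a2_def b2_def)
  have "\<forall>\<^sub>F x in at_top. (\<forall>i\<in>{..<ntypes \<sigma>}. \<bar>real (cnt j (a1 \<epsilon>) (b1 \<epsilon>) i x) - phi \<sigma> j (a1 \<epsilon>) (b1 \<epsilon>) * x ^ DIM('a)\<bar> \<le> \<delta> * x ^ DIM('a)) \<and>
     (\<forall>i\<in>{..<ntypes \<sigma>}. \<bar>real (cnt j (a2 \<epsilon>) (b2 \<epsilon>) i x) - phi \<sigma> j (a2 \<epsilon>) (b2 \<epsilon>) * x ^ DIM('a)\<bar> \<le> \<delta> * x ^ DIM('a))"
    by (intro eventually_conj cnt_asymptotic r1 r2 \<delta>)
  then obtain X0 where X0: "\<And>x i. x \<ge> X0 \<Longrightarrow> i < ntypes \<sigma> \<Longrightarrow> \<bar>real (cnt j (a1 \<epsilon>) (b1 \<epsilon>) i x) - phi \<sigma> j (a1 \<epsilon>) (b1 \<epsilon>) * x ^ DIM('a)\<bar> \<le> \<delta> * x ^ DIM('a)"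
    "\<And>x i. x \<ge> X0 \<Longrightarrow> i < ntypes \<sigma> \<Longrightarrow> \<bar>real (cnt j (a2 \<epsilon>) (b2 \<epsilon>) i x) - phi \<sigma> j (a2 \<epsilon>) (b2 \<epsilon>) * x ^ DIM('a)\<bar> \<le> \<delta> * x ^ DIM('a)"
    unfolding eventually_at_top_linorder by (metis lessThan_iff)
  obtain B where B: "B > 0" "\<forall>l<ntypes \<sigma>. \<forall>x\<in>proto \<sigma> l. norm x \<le> B" by (rule proto_bound) blast
  define c0 where "c0 = min_ratio ^ DIM('a)"
  have c0: "c0 > 0" using min_ratio(1) by (simp add: c0_def)
  obtain r0 where r0: "r0 > 0" "\<And>i r'. i < ntypes \<sigma> \<Longrightarrow> r' \<le> r0 \<Longrightarrow> measure lebesgue (nbhd r' (frontier (proto \<sigma> i))) \<le> \<delta> * c0"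
    using frontier_nbhd_small[of "\<delta> * c0"] \<delta> c0 by (metis mult_pos_pos)
  \<comment> \<open>Scales above X0 are in the asymptotic range of the counts; above the second
    bound the collar of width 4 B + 1, rescaled to the prototile, is thinner than r0.\<close>
  define X1 where "X1 = max X0 ((4 * B + 1) / r0)"
  have "filterlim (\<lambda>m::nat. real m * s) at_top sequentially"
    using filterlim_tendsto_pos_mult_at_top[OF tendsto_const stationary_pos[OF st] filterlim_real_sequentially]
    by (simp add: mult.commute)
  then have "filterlim (\<lambda>m::nat. exp (real m * s)) at_top sequentially" by (rule filterlim_compose[OF exp_at_top])
  then have "filterlim (\<lambda>m::nat. min_ratio * exp (real m * s)) at_top sequentially"
    by (rule filterlim_tendsto_pos_mult_at_top[OF tendsto_const min_ratio(1)])
  then have "filterlim (\<lambda>m::nat. exp (real m * s) * min_ratio) at_top sequentially"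
    by (simp only: mult.commute[of min_ratio])
  then have "\<forall>\<^sub>F m in sequentially. X1 \<le> exp (real m * s) * min_ratio" by (simp add: filterlim_at_top)
  then show "\<forall>\<^sub>F m in sequentially. norm (real (count_tiles \<sigma> j a b (touching (Tm m) \<T>)) - phi \<sigma> j a b * measure lebesgue (Tm m))
      \<le> c * norm (measure lebesgue (Tm m))"
  proof eventually_elim
    case (elim m)
    define N where "N = real (count_tiles \<sigma> j a b (touching (Tm m) \<T>))"
    obtain i x \<gamma> z M where ap: "i < ntypes \<sigma>" "Tm m = copy \<gamma> z (proto \<sigma> i)"
     "exp (real m * s) * min_ratio \<le> \<gamma>" "exp (real m * s) * min_ratio \<le> x"
     "\<bar>x ^ DIM('a) / \<gamma> ^ DIM('a) - 1\<bar> \<le> \<epsilon>"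
     "M * c0 \<le> measure lebesgue (nbhd (4 * B + 1) (frontier (Tm m)))"
     "N \<le> real (cnt j (a2 \<epsilon>) (b2 \<epsilon>) i x) + M"
     "real (cnt j (a1 \<epsilon>) (b1 \<epsilon>) i x) \<le> N + M"
      using supertile_approx[OF st T sup Tm \<epsilon>(1) B, where j = j and a = a and b = b and m = m]
      unfolding N_def a1_def b1_def a2_def b2_def c0_def by blast
    have pos: "exp (real m * s) * min_ratio > 0" using min_ratio(1) by simp
    have g0: "\<gamma> > 0" using ap(3) pos by linarith
    have x0: "x \<ge> X0" using ap(4) elim by (simp add: X1_def)
    define V where "V = \<gamma> ^ DIM('a)" define X where "X = x ^ DIM('a)"
    have V0: "V > 0" using g0 by (simp add: V_def)
    have vol: "measure lebesgue (Tm m) = V" unfolding ap(2) V_def using measure_copy_proto[OF ap(1)] g0 by simp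
    have "\<bar>X - V\<bar> \<le> \<epsilon> * V"
    proof -
      have "X - V = (X / V - 1) * V" using V0 by (simp add: left_diff_distrib)
      then have "\<bar>X - V\<bar> = \<bar>X / V - 1\<bar> * V" using V0 by (simp only: abs_mult abs_of_pos)
      also have "\<dots> \<le> \<epsilon> * V" using ap(5) V0 by (intro mult_right_mono) (auto simp: X_def V_def)
      finally show ?thesis .
    qed
    also have "\<dots> \<le> \<delta> * V" using \<epsilon>(2) V0 by simp
    finally have XV: "\<bar>X - V\<bar> \<le> \<delta> * V" .
    have X2: "0 \<le> X" "X \<le> 2 * V"
    proof -
      show "0 \<le> X" using ap(4) pos by (simp add: X_def)
      have "\<delta> * V \<le> 1 * V" using \<delta>(2) V0 by (intro mult_right_mono) auto
      then show "X \<le> 2 * V" using XV by linarith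
    qed
    have "M * c0 \<le> measure lebesgue (copy \<gamma> z (nbhd ((4 * B + 1) / \<gamma>) (frontier (proto \<sigma> i))))"
      using ap(6) g0 by (simp add: ap(2) frontier_copy copy_nbhd)
    also have "\<dots> = V * measure lebesgue (nbhd ((4 * B + 1) / \<gamma>) (frontier (proto \<sigma> i)))"
      using g0 by (simp add: measure_copy V_def)
    also have "\<dots> \<le> V * (\<delta> * c0)"
    proof (intro mult_left_mono r0(2) ap(1))
      have "(4 * B + 1) / r0 \<le> \<gamma>" using ap(3) elim by (simp add: X1_def)
      then show "(4 * B + 1) / \<gamma> \<le> r0" using g0 r0(1) by (simp add: field_simps)
    qed (use V0 in simp)
    finally have "M * c0 \<le> (\<delta> * V) * c0" by (simp add: mult_ac)
    then have M: "M \<le> \<delta> * V" using c0 by simp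
    have \<phi>X: "\<bar>\<phi> * X - \<phi> * V\<bar> \<le> \<bar>\<phi>\<bar> * (\<delta> * V)"
      unfolding right_diff_distrib[symmetric] abs_mult by (intro mult_left_mono XV abs_ge_zero)
    have dX: "\<delta> * X \<le> 2 * (\<delta> * V)" using mult_left_mono[OF X2(2), of \<delta>] \<delta>(1) by simp
    have p1: "\<bar>phi \<sigma> j (a1 \<epsilon>) (b1 \<epsilon>) * X - \<phi> * X\<bar> \<le> \<delta> * X"
      unfolding left_diff_distrib[symmetric] abs_mult
      using mult_right_mono[OF less_imp_le[OF phi1] X2(1)] X2(1) by simp
    have p2: "\<bar>phi \<sigma> j (a2 \<epsilon>) (b2 \<epsilon>) * X - \<phi> * X\<bar> \<le> \<delta> * X"
      unfolding left_diff_distrib[symmetric] abs_mult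
      using mult_right_mono[OF less_imp_le[OF phi2] X2(1)] X2(1) by simp
    note cnt1 = X0(1)[OF x0 ap(1), folded X_def] and cnt2 = X0(2)[OF x0 ap(1), folded X_def]
    have "N - \<phi> * V \<le> \<bar>\<phi>\<bar> * (\<delta> * V) + 5 * (\<delta> * V)"
      using ap(7) M cnt2 p2 dX \<phi>X unfolding abs_le_iff by linarith
    moreover have "- (N - \<phi> * V) \<le> \<bar>\<phi>\<bar> * (\<delta> * V) + 5 * (\<delta> * V)"
      using ap(8) M cnt1 p1 dX \<phi>X unfolding abs_le_iff by linarith
    ultimately have "\<bar>N - \<phi> * V\<bar> \<le> \<bar>\<phi>\<bar> * (\<delta> * V) + 5 * (\<delta> * V)" by linarith
    also have "\<dots> = \<delta> * (\<bar>\<phi>\<bar> + 5) * V" by (simp add: algebra_simps)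
    also have "\<dots> \<le> c * V" using \<delta>c V0 by (intro mult_right_mono) auto
    finally show ?case using V0 by (simp add: vol N_def \<phi>_def)
  qed
qed

end

theorem corollary7p5:
  fixes \<sigma> :: "('a::euclidean_space) scheme" and j :: nat and a b :: real
  assumes "multiscale_scheme \<sigma>"
    and "normalized \<sigma>"
    and "irreducible_scheme \<sigma>"
    and "incommensurable \<sigma>"
    and "j < ntypes \<sigma>"
    and "0 \<le> a" and "a < b" and "b \<le> 1"
  shows "(\<forall>T. legal_tile \<sigma> T \<longrightarrow>
      (\<lambda>t. real (count_tiles \<sigma> j a b (flow \<sigma> t T))
            - phi \<sigma> j a b * measure lebesgue (copy (exp t) 0 T))
        \<in> o[at_top](\<lambda>t::real. measure lebesgue (copy (exp t) 0 T)))
    \<and> (origin_interior \<sigma> \<longrightarrow>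
      (\<forall>s \<S> v \<T> \<T>sup Tm. stationary \<sigma> s \<S> \<longrightarrow> \<T> \<in> tiling_space \<sigma> \<longrightarrow>
        supertile_tilings \<sigma> s \<S> v \<T> \<T>sup \<longrightarrow> (\<forall>m. Tm m \<in> \<T>sup m) \<longrightarrow>
        (\<lambda>m. real (count_tiles \<sigma> j a b (touching (Tm m) \<T>))
              - phi \<sigma> j a b * measure lebesgue (Tm m))
          \<in> o[sequentially](\<lambda>m::nat. measure lebesgue (Tm m))))"
proof -
  interpret mixing_scheme \<sigma> by unfold_locales (fact assms)+
  show ?thesis
    using flow_count_asymptotic[OF assms(6-8)] supertile_count_asymptotic[OF assms(6-8)] by blast
qed

end
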